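(* Let $\Omega\subseteq\mathbb{R}^n$ be a connected open set and $\bar L(\cdot):=b(x)\partial_\mu(a^{\mu\nu}(x)\partial_\nu(\cdot))$ with $b\in C^\infty(\Omega,\mathbb{R})$, $b>0$, and $a\in C^\infty(\Omega,M_{n\times n}(\mathbb{C}))$ pointwise symmetric with $\mathrm{Re}(a^{\mu\nu}(x)\xi^*_\mu\xi_\nu)\ge\ell(x)\delta^{\mu\nu}\xi^*_\mu\xi_\nu$ for all $\xi\in\mathbb{C}^n$ and some continuous $\ell:\Omega\to\mathbb{R}_{>0}$. Let $(f_j)_{j\in\mathbb{N}_0}$ be a sequence in $L^2_{\mathrm{loc}}(\Omega)$ and $k\in\mathbb{N}$ such that $f_j,\bar Lf_j,\dots,\bar L^kf_j\in L^2_{\mathrm{loc}}(\Omega)$ for all $j$. Suppose $F:B_S(0)\to L^2_{\mathrm{loc}}(\Omega)$, $B_S(0)=\{\zeta\in\mathbb{C}:|\zeta|<S\}$, is analytic and for each $\zeta\in B_S(0)$: (i) $F(\zeta)=\sum_{j=0}^\infty\frac{\zeta^j}{j!}f_j$ with convergence in $L^2_{\mathrm{loc}}(\Omega)$; (ii) $F(\zeta),\bar LF(\zeta),\dots,\bar L^kF(\zeta)\in L^2_{\mathrm{loc}}(\Omega)$; (iii) for each $l\in\{1,\dots,k\}$, $\bar L^lF(\zeta)=\sum_{j=0}^\infty\frac{\zeta^j}{j!}\bar L^lf_j$ with convergence in $L^2_{\mathrm{loc}}(\Omega)$. If there is $m\in\mathbb{N}_0$ with $k>m/2+n/4$, then for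 each $\zeta\in B_S(0)$ there is a $C^m(\Omega)$ representative $F(\zeta,\cdot)$ of $F(\zeta)$, and the map $B_S(0)\times\Omega\ni(\zeta,x)\mapsto F(\zeta,x)\in\mathbb{C}$ is jointly $C^m$.
   Context: $L^2_{\mathrm{loc}}(\Omega)$ is defined with respect to Lebesgue measure, with convergence meaning $L^2$-convergence on every relatively compact open subset of $\Omega$; $\bar L^j$ acts distributionally. *)

theory Defs
  imports "HOL-Analysis.Analysis"
begin

fun Ck :: "nat \<Rightarrow> 'a::euclidean_space set \<Rightarrow> ('a \<Rightarrow> 'b::real_normed_vector) \<Rightarrow> bool" where
  "Ck 0 U f = continuous_on U f"
| "Ck (Suc m) U f = ((\<forall>x\<in>U. f differentiable (at x)) \<and>
      (\<forall>v\<in>Basis. Ck m U (\<lambda>x. frechet_derivative f (at x) v)))"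

definition smooth_on :: "'a::euclidean_space set \<Rightarrow> ('a \<Rightarrow> 'b::real_normed_vector) \<Rightarrow> bool" where
  "smooth_on U f \<longleftrightarrow> (\<forall>m. Ck m U f)"

definition partial :: "'n::finite \<Rightarrow> (real^'n \<Rightarrow> 'b::real_normed_vector) \<Rightarrow> real^'n \<Rightarrow> 'b" where
  "partial i f x = frechet_derivative f (at x) (axis i 1)"

definition test_fun :: "(real^'n::finite) set \<Rightarrow> (real^'n \<Rightarrow> complex) \<Rightarrow> bool" where
  "test_fun \<Omega> \<phi> \<longleftrightarrow> smooth_on UNIV \<phi> \<and> compact (closure {x. \<phi> x \<noteq> 0})
      \<and> closure {x. \<phi> x \<noteq> 0} \<subseteq> \<Omega>"

definition relcompact_open :: "'a::euclidean_space set \<Rightarrow> 'a set \<Rightarrow> bool" where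
  "relcompact_open U \<Omega> \<longleftrightarrow> open U \<and> compact (closure U) \<and> closure U \<subseteq> \<Omega>"

definition L2loc :: "(real^'n::finite) set \<Rightarrow> (real^'n \<Rightarrow> complex) \<Rightarrow> bool" where
  "L2loc \<Omega> f \<longleftrightarrow> set_borel_measurable lebesgue \<Omega> f \<and>
     (\<forall>U. relcompact_open U \<Omega> \<longrightarrow> set_integrable lebesgue U (\<lambda>x. (norm (f x))\<^sup>2))"

definition L2dist :: "(real^'n::finite) set \<Rightarrow> (real^'n \<Rightarrow> complex) \<Rightarrow> (real^'n \<Rightarrow> complex) \<Rightarrow> real" where
  "L2dist U f g = (LINT x:U|lebesgue. (norm (f x - g x))\<^sup>2)"

definition L2loc_lim :: "(real^'n::finite) set \<Rightarrow> (nat \<Rightarrow> real^'n \<Rightarrow> complex) \<Rightarrow> (real^'n \<Rightarrow> complex) \<Rightarrow> bool" where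
  "L2loc_lim \<Omega> g f \<longleftrightarrow> (\<forall>U. relcompact_open U \<Omega> \<longrightarrow> (\<lambda>N. L2dist U (g N) f) \<longlonglongrightarrow> 0)"

definition analytic_L2loc :: "(real^'n::finite) set \<Rightarrow> complex set \<Rightarrow> (complex \<Rightarrow> real^'n \<Rightarrow> complex) \<Rightarrow> bool" where
  "analytic_L2loc \<Omega> D F \<longleftrightarrow> (\<forall>z0\<in>D. \<exists>G. L2loc \<Omega> G \<and>
     (\<forall>U. relcompact_open U \<Omega> \<longrightarrow>
        ((\<lambda>z. L2dist U (\<lambda>x. (F z x - F z0 x) / (z - z0)) G) \<longlongrightarrow> 0) (at z0)))"

text \<open>Formal transpose of Lbar u = b \<partial>_\<mu>(a^{\<mu>\<nu>} \<partial>_\<nu> u) acting on test functions: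
  Lbar^t \<phi> = \<partial>_\<nu>(a^{\<mu>\<nu>} \<partial>_\<mu>(b \<phi>)).\<close>
definition Lbar_transpose :: "('n::finite \<Rightarrow> 'n \<Rightarrow> real^'n \<Rightarrow> complex) \<Rightarrow> (real^'n \<Rightarrow> real)
     \<Rightarrow> (real^'n \<Rightarrow> complex) \<Rightarrow> real^'n \<Rightarrow> complex" where
  "Lbar_transpose a b \<phi> x = (\<Sum>\<nu>\<in>UNIV. \<Sum>\<mu>\<in>UNIV.
      partial \<nu> (\<lambda>y. a \<mu> \<nu> y * partial \<mu> (\<lambda>z. complex_of_real (b z) * \<phi> z) y) x)"

definition Lbar_weak :: "(real^'n::finite) set \<Rightarrow> ('n \<Rightarrow> 'n \<Rightarrow> real^'n \<Rightarrow> complex) \<Rightarrow> (real^'n \<Rightarrow> real)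
     \<Rightarrow> (real^'n \<Rightarrow> complex) \<Rightarrow> (real^'n \<Rightarrow> complex) \<Rightarrow> bool" where
  "Lbar_weak \<Omega> a b u g \<longleftrightarrow> (\<forall>\<phi>. test_fun \<Omega> \<phi> \<longrightarrow>
      (LINT x:\<Omega>|lebesgue. g x * \<phi> x) = (LINT x:\<Omega>|lebesgue. u x * Lbar_transpose a b \<phi> x))"

end

theory Submission
  imports Defs "HOL-Real_Asymp.Real_Asymp"
begin

text \<open>Elliptic regularity is used in a form that never mentions weak derivatives. A compactly supported
  cutoff of \<open>f\<^sub>j\<close> is mollified, and the elliptic estimate for test functions is applied to the
  mollification; the Friedrichs commutators of mollification with the coefficients are bounded in the
  mean uniformly in the mollification parameter. Bootstrapping through \<open>f\<^sub>j, Lbar f\<^sub>j, \<dots>, Lbar\<^sup>k f\<^sub>j\<close> bounds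
  all derivatives of order at most \<open>2k\<close> of the mollifications in the mean, uniformly over the family
  \<open>\<rho>\<^sup>j / j! \<cdot> f\<^sub>j\<close> for any \<open>\<rho> < S\<close>, since the terms of a convergent series are bounded. As \<open>2k > m + n/2\<close>,
  the Sobolev embedding turns these into pointwise bounds, and every \<open>f\<^sub>j\<close> has a \<open>C\<^sup>m\<close> representative
  whose derivatives up to order \<open>m\<close> are locally bounded by a multiple of \<open>j! / \<rho>\<^sup>j\<close>. The power
  series therefore converges locally uniformly with all its derivatives up to order \<open>m\<close>, and Fatou's
  lemma identifies the pointwise limit with \<open>F(\<zeta>)\<close> almost everywhere.\<close>

section \<open>Functions of class \<open>C\<^sup>m\<close>\<close>

subsection \<open>Calculus\<close>

lemma Ck_cong:
  fixes f g :: "'a::euclidean_space \<Rightarrow> 'b::real_normed_vector"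
  assumes "open U"
  shows "(\<And>x. x \<in> U \<Longrightarrow> f x = g x) \<Longrightarrow> Ck m U f \<Longrightarrow> Ck m U g"
proof (induction m arbitrary: f g)
  case 0
  then show ?case by (metis Ck.simps(1) continuous_on_cong)
next
  case (Suc m)
  have diff: "f differentiable at x" if "x \<in> U" for x
    using Suc.prems(2) that by simp
  have "g differentiable at x" if "x \<in> U" for x
    using diff[OF that] has_derivative_transform_within_open[OF _ assms that Suc.prems(1)]
    unfolding differentiable_def by fast
  moreover have "frechet_derivative f (at x) = frechet_derivative g (at x)" if "x \<in> U" for x
    using frechet_derivative_transform_within_open[OF diff[OF that] assms that Suc.prems(1)] .
  then have "Ck m U (\<lambda>x. frechet_derivative g (at x) v)" if "v \<in> Basis" for v
    using Suc.IH[of "\<lambda>x. frechet_derivative f (at x) v"] Suc.prems(2) that by simp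
  ultimately show ?case by simp
qed

lemma Ck_SucI:
  fixes f :: "'a::euclidean_space \<Rightarrow> 'b::real_normed_vector"
  assumes "open U" and deriv: "\<And>x. x \<in> U \<Longrightarrow> (f has_derivative f' x) (at x)"
    and "\<And>v. v \<in> Basis \<Longrightarrow> Ck m U (\<lambda>x. f' x v)"
  shows "Ck (Suc m) U f"
proof -
  have "f' x = frechet_derivative f (at x)" if "x \<in> U" for x
    using deriv[OF that] by (rule frechet_derivative_at)
  then have "Ck m U (\<lambda>x. frechet_derivative f (at x) v)" if "v \<in> Basis" for v
    using Ck_cong[OF assms(1) _ assms(3)[OF that]] by simp
  moreover have "f differentiable (at x)" if "x \<in> U" for x
    using deriv[OF that] by (rule differentiableI)
  ultimately show ?thesis by simp
qed

lemma Ck_Suc_has_derivative: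
  assumes "Ck (Suc m) U f" "x \<in> U"
  shows "(f has_derivative frechet_derivative f (at x)) (at x)"
  using assms by (simp add: frechet_derivative_works)

lemma Ck_frechet_derivative:
  "Ck (Suc m) U f \<Longrightarrow> v \<in> Basis \<Longrightarrow> Ck m U (\<lambda>x. frechet_derivative f (at x) v)"
  by simp

lemma Ck_SucD: "Ck (Suc m) U f \<Longrightarrow> Ck m U f"
proof (induction m arbitrary: f)
  case 0
  then show ?case
    by (auto intro!: continuous_at_imp_continuous_on differentiable_imp_continuous_within)
next
  case (Suc m)
  have "f differentiable at x" if "x \<in> U" for x
    using Suc.prems that by (auto simp only: Ck.simps)
  moreover have "Ck m U (\<lambda>x. frechet_derivative f (at x) v)" if "v \<in> Basis" for v
    using Suc.prems Suc.IH that by (auto simp only: Ck.simps)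
  ultimately show ?case by simp
qed

lemma Ck_mono: "m \<le> n \<Longrightarrow> Ck n U f \<Longrightarrow> Ck m U f"
  by (induction n rule: dec_induct) (blast intro: Ck_SucD)+

lemma Ck_continuous_on: "Ck m U f \<Longrightarrow> continuous_on U f"
  using Ck_mono[of 0 m] by auto

lemma Ck_subset: "V \<subseteq> U \<Longrightarrow> Ck m U f \<Longrightarrow> Ck m V f"
  by (induction m arbitrary: f) (auto intro: continuous_on_subset)

lemma Ck_local:
  assumes "\<And>x. x \<in> U \<Longrightarrow> \<exists>V. open V \<and> x \<in> V \<and> Ck m V f"
  shows "Ck m U f"
  using assms
proof (induction m arbitrary: f)
  case 0
  then have "continuous (at x) f" if "x \<in> U" for x
    using that by (metis Ck.simps(1) continuous_on_eq_continuous_at)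
  then show ?case by (simp add: continuous_at_imp_continuous_on)
next
  case (Suc m)
  have "f differentiable at x" if "x \<in> U" for x
    using Suc.prems[OF that] by auto
  moreover have "Ck m U (\<lambda>x. frechet_derivative f (at x) v)" if "v \<in> Basis" for v
    using Suc.prems that by (intro Suc.IH) force
  ultimately show ?case by simp
qed

lemma Ck_const [simp]: "Ck m U (\<lambda>x. c)"
  by (induction m arbitrary: c) simp_all

lemma Ck_bounded_linear_compose:
  fixes f :: "'a::euclidean_space \<Rightarrow> 'b::real_normed_vector"
  assumes "bounded_linear T" "open U"
  shows "Ck m U f \<Longrightarrow> Ck m U (\<lambda>x. T (f x))"
proof (induction m arbitrary: f)
  case 0
  then show ?case using bounded_linear.continuous_on[OF assms(1)] by auto
next
  case (Suc m)
  show ?case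
  proof (rule Ck_SucI[OF assms(2)])
    show "((\<lambda>x. T (f x)) has_derivative (\<lambda>h. T (frechet_derivative f (at x) h))) (at x)" if "x \<in> U" for x
      by (rule bounded_linear.has_derivative[OF assms(1) Ck_Suc_has_derivative[OF Suc.prems that]])
    show "Ck m U (\<lambda>x. T (frechet_derivative f (at x) v))" if "v \<in> Basis" for v
      by (rule Suc.IH[OF Ck_frechet_derivative[OF Suc.prems that]])
  qed
qed

lemma Ck_bounded_linear:
  assumes "bounded_linear T" "open U"
  shows "Ck m U T"
proof (cases m)
  case 0
  then show ?thesis using assms(1) by (simp add: linear_continuous_on)
next
  case (Suc k)
  then show ?thesis using assms
    by (simp only: Suc) (rule Ck_SucI[where f'="\<lambda>x. T"], auto intro: bounded_linear_imp_has_derivative)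
qed

lemma Ck_add:
  fixes f g :: "'a::euclidean_space \<Rightarrow> 'b::real_normed_vector"
  assumes "open U"
  shows "Ck m U f \<Longrightarrow> Ck m U g \<Longrightarrow> Ck m U (\<lambda>x. f x + g x)"
proof (induction m arbitrary: f g)
  case 0
  then show ?case by (auto intro: continuous_on_add)
next
  case (Suc m)
  show ?case
    by (rule Ck_SucI[OF assms has_derivative_add[OF Suc.prems[THEN Ck_Suc_has_derivative]]])
       (auto intro: Suc.IH Suc.prems[THEN Ck_frechet_derivative])
qed

lemma Ck_mult:
  fixes f g :: "'a::euclidean_space \<Rightarrow> 'b::real_normed_algebra"
  assumes "open U"
  shows "Ck m U f \<Longrightarrow> Ck m U g \<Longrightarrow> Ck m U (\<lambda>x. f x * g x)"
proof (induction m arbitrary: f g)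
  case 0
  then show ?case by (auto intro: continuous_on_mult)
next
  case (Suc m)
  show ?case
    by (rule Ck_SucI[OF assms has_derivative_mult[OF Suc.prems[THEN Ck_Suc_has_derivative]]])
       (auto intro!: Ck_add[OF assms] Suc.IH Suc.prems[THEN Ck_frechet_derivative] Suc.prems[THEN Ck_SucD]
          simp del: Ck.simps)
qed

lemma Ck_diff:
  fixes f g :: "'a::euclidean_space \<Rightarrow> 'b::real_normed_vector"
  assumes "open U" "Ck m U f" "Ck m U g"
  shows "Ck m U (\<lambda>x. f x - g x)"
  using Ck_add[OF assms(1,2) Ck_bounded_linear_compose[OF bounded_linear_minus[OF bounded_linear_ident] assms(1,3)]]
  by simp

lemma Ck_sum:
  fixes f :: "'i \<Rightarrow> 'a::euclidean_space \<Rightarrow> 'b::real_normed_vector"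
  assumes "open U" "\<And>i. i \<in> I \<Longrightarrow> Ck m U (f i)"
  shows "Ck m U (\<lambda>x. \<Sum>i\<in>I. f i x)"
  using assms(2) by (induction I rule: infinite_finite_induct) (auto intro: Ck_add assms)

lemma Ck_inverse:
  fixes f :: "'a::euclidean_space \<Rightarrow> 'b::real_normed_div_algebra"
  assumes "open U" "\<And>x. x \<in> U \<Longrightarrow> f x \<noteq> 0"
  shows "Ck m U f \<Longrightarrow> Ck m U (\<lambda>x. inverse (f x))"
proof (induction m)
  case 0
  then show ?case using assms(2) by (auto intro!: continuous_on_inverse)
next
  case (Suc m)
  let ?f' = "\<lambda>x h. - (inverse (f x) * frechet_derivative f (at x) h * inverse (f x))"
  have inverse: "Ck m U (\<lambda>x. inverse (f x))"
    using Suc Ck_SucD by blast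
  show ?case
  proof (rule Ck_SucI[OF assms(1)])
    show "((\<lambda>x. inverse (f x)) has_derivative ?f' x) (at x)" if "x \<in> U" for x
      by (rule Deriv.has_derivative_inverse[OF assms(2) Ck_Suc_has_derivative[OF Suc.prems]]) (rule that)+
    show "Ck m U (\<lambda>x. ?f' x v)" if "v \<in> Basis" for v
      by (intro Ck_bounded_linear_compose[OF bounded_linear_minus[OF bounded_linear_ident]] Ck_mult
          Ck_frechet_derivative[OF Suc.prems that] inverse assms(1))
  qed
qed

lemma has_derivative_affine_compose:
  fixes f :: "'a::real_normed_vector \<Rightarrow> 'b::real_normed_vector"
  assumes "(f has_derivative F) (at (d + c *\<^sub>R x))"
  shows "((\<lambda>x. f (d + c *\<^sub>R x)) has_derivative (\<lambda>h. c *\<^sub>R F h)) (at x)"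
proof -
  have "((\<lambda>x. d + c *\<^sub>R x) has_derivative (\<lambda>h. c *\<^sub>R h)) (at x)"
    by (auto intro!: derivative_eq_intros)
  from has_derivative_compose[OF this assms] show ?thesis
    by (simp add: linear_scale[OF has_derivative_linear[OF assms]])
qed

lemma Ck_affine_compose:
  fixes f :: "'a::euclidean_space \<Rightarrow> 'b::real_normed_vector"
  shows "Ck m UNIV f \<Longrightarrow> Ck m UNIV (\<lambda>x. f (d + c *\<^sub>R x))"
proof (induction m arbitrary: f)
  case 0
  then show ?case
    using continuous_on_compose2[of UNIV f UNIV "\<lambda>x. d + c *\<^sub>R x"] by (simp add: continuous_intros)
next
  case (Suc m)
  show ?case
  proof (rule Ck_SucI[OF open_UNIV])
    show "((\<lambda>x. f (d + c *\<^sub>R x)) has_derivative (\<lambda>h. c *\<^sub>R frechet_derivative f (at (d + c *\<^sub>R x)) h)) (at x)" for x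
      by (rule has_derivative_affine_compose[OF Ck_Suc_has_derivative[OF Suc.prems UNIV_I]])
    show "Ck m UNIV (\<lambda>x. c *\<^sub>R frechet_derivative f (at (d + c *\<^sub>R x)) v)" if "v \<in> Basis" for v
      by (rule Ck_bounded_linear_compose[OF bounded_linear_scaleR_right open_UNIV
            Suc.IH[OF Ck_frechet_derivative[OF Suc.prems that]]])
  qed
qed

lemma Ck_section:
  fixes F :: "'a::euclidean_space \<times> 'b::euclidean_space \<Rightarrow> 'c::real_normed_vector"
  assumes "open B" "z \<in> A"
  shows "Ck m (A \<times> B) F \<Longrightarrow> Ck m B (\<lambda>x. F (z, x))"
proof (induction m arbitrary: F)
  case 0
  then have "continuous_on (A \<times> B) F" by simp
  moreover have "continuous_on B (\<lambda>x. (z, x))" by (intro continuous_intros)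
  ultimately show ?case using continuous_on_compose2[of "A \<times> B" F B "\<lambda>x. (z, x)"] assms(2) by auto
next
  case (Suc m)
  show ?case
  proof (rule Ck_SucI[OF assms(1), where f'="\<lambda>x h. frechet_derivative F (at (z, x)) (0, h)"])
    fix x assume "x \<in> B"
    then have "(F has_derivative frechet_derivative F (at (z, x))) (at (z, x))"
      using Ck_Suc_has_derivative[OF Suc.prems] assms(2) by simp
    moreover have "((\<lambda>x. (z, x)) has_derivative (\<lambda>h. (0, h))) (at x)"
      by (intro has_derivative_Pair has_derivative_const has_derivative_ident)
    ultimately show "((\<lambda>x. F (z, x)) has_derivative (\<lambda>h. frechet_derivative F (at (z, x)) (0, h))) (at x)"
      using has_derivative_compose by fastforce
  next
    fix v :: 'b assume "v \<in> Basis"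
    then have "(0, v) \<in> (Basis :: ('a \<times> 'b) set)" by (simp add: Basis_prod_def)
    from Suc.IH[OF Ck_frechet_derivative[OF Suc.prems this]]
    show "Ck m B (\<lambda>x. frechet_derivative F (at (z, x)) (0, v))" by simp
  qed
qed

lemma smooth_on_continuous_on: "smooth_on U f \<Longrightarrow> continuous_on U f"
  unfolding smooth_on_def using Ck_continuous_on by blast

lemma smooth_on_has_derivative:
  "smooth_on U f \<Longrightarrow> x \<in> U \<Longrightarrow> (f has_derivative frechet_derivative f (at x)) (at x)"
  unfolding smooth_on_def using Ck_Suc_has_derivative by blast

lemma smooth_on_frechet_derivative:
  "smooth_on U f \<Longrightarrow> v \<in> Basis \<Longrightarrow> smooth_on U (\<lambda>x. frechet_derivative f (at x) v)"
  unfolding smooth_on_def by (metis Ck.simps(2))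

lemma smooth_on_mult:
  fixes f g :: "'a::euclidean_space \<Rightarrow> 'b::real_normed_algebra"
  assumes "open U" "smooth_on U f" "smooth_on U g"
  shows "smooth_on U (\<lambda>x. f x * g x)"
  using assms Ck_mult unfolding smooth_on_def by metis

lemma smooth_on_add:
  fixes f g :: "'a::euclidean_space \<Rightarrow> 'b::real_normed_vector"
  assumes "open U" "smooth_on U f" "smooth_on U g"
  shows "smooth_on U (\<lambda>x. f x + g x)"
  using assms Ck_add unfolding smooth_on_def by metis

subsection \<open>Uniform bounds on derivatives\<close>

fun Ck_bounded :: "nat \<Rightarrow> 'a::euclidean_space set \<Rightarrow> real \<Rightarrow> ('a \<Rightarrow> 'b::real_normed_vector) \<Rightarrow> bool" where
  "Ck_bounded 0 U D f \<longleftrightarrow> (\<forall>x\<in>U. norm (f x) \<le> D) \<and> continuous_on U f"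
| "Ck_bounded (Suc m) U D f \<longleftrightarrow> (\<forall>x\<in>U. norm (f x) \<le> D) \<and> (\<forall>x\<in>U. f differentiable at x)
      \<and> (\<forall>v\<in>Basis. Ck_bounded m U D (\<lambda>x. frechet_derivative f (at x) v))"

lemma Ck_bounded_imp_Ck: "Ck_bounded m U D f \<Longrightarrow> Ck m U f"
  by (induction m arbitrary: f) auto

lemma Ck_bounded_SucD: "Ck_bounded (Suc m) U D f \<Longrightarrow> Ck_bounded m U D f"
proof (induction m arbitrary: f)
  case 0
  then show ?case
    by (auto intro!: continuous_at_imp_continuous_on differentiable_imp_continuous_within)
next
  case (Suc m)
  have "Ck_bounded m U D (\<lambda>x. frechet_derivative f (at x) v)" if "v \<in> Basis" for v
    using Suc.prems Suc.IH that by (auto simp only: Ck_bounded.simps)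
  moreover have "\<forall>x\<in>U. norm (f x) \<le> D" "\<forall>x\<in>U. f differentiable at x"
    using Suc.prems by (auto simp only: Ck_bounded.simps)
  ultimately show ?case by simp
qed

lemma Ck_bounded_norm_le: "Ck_bounded m U D f \<Longrightarrow> x \<in> U \<Longrightarrow> norm (f x) \<le> D"
  by (cases m) auto

lemma Ck_bounded_subset: "V \<subseteq> U \<Longrightarrow> Ck_bounded m U D f \<Longrightarrow> Ck_bounded m V D f"
  by (induction m arbitrary: f) (auto intro: continuous_on_subset)

lemma Ck_bounded_mono: "D \<le> E \<Longrightarrow> Ck_bounded m U D f \<Longrightarrow> Ck_bounded m U E f"
  by (induction m arbitrary: f) (auto intro: order_trans)

lemma Ck_bounded_cong:
  fixes f g :: "'a::euclidean_space \<Rightarrow> 'b::real_normed_vector"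
  assumes "open U"
  shows "(\<And>x. x \<in> U \<Longrightarrow> f x = g x) \<Longrightarrow> Ck_bounded m U D f \<Longrightarrow> Ck_bounded m U D g"
proof (induction m arbitrary: f g)
  case 0
  then show ?case by (simp cong: continuous_on_cong)
next
  case (Suc m)
  have diff: "f differentiable at x" if "x \<in> U" for x
    using Suc.prems(2) that by simp
  have "g differentiable at x" if "x \<in> U" for x
    using diff[OF that] has_derivative_transform_within_open[OF _ assms that Suc.prems(1)]
    unfolding differentiable_def by fast
  moreover have "frechet_derivative f (at x) = frechet_derivative g (at x)" if "x \<in> U" for x
    using frechet_derivative_transform_within_open[OF diff[OF that] assms that Suc.prems(1)] .
  then have "Ck_bounded m U D (\<lambda>x. frechet_derivative g (at x) v)" if "v \<in> Basis" for v
    using Suc.IH[of "\<lambda>x. frechet_derivative f (at x) v"] Suc.prems(2) that by simp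
  ultimately show ?case using Suc.prems by simp
qed

lemma Ck_bounded_SucI:
  fixes f :: "'a::euclidean_space \<Rightarrow> 'b::real_normed_vector"
  assumes "open U" and deriv: "\<And>x. x \<in> U \<Longrightarrow> (f has_derivative f' x) (at x)"
    and "\<And>x. x \<in> U \<Longrightarrow> norm (f x) \<le> D"
    and "\<And>v. v \<in> Basis \<Longrightarrow> Ck_bounded m U D (\<lambda>x. f' x v)"
  shows "Ck_bounded (Suc m) U D f"
proof -
  have "f' x = frechet_derivative f (at x)" if "x \<in> U" for x
    using deriv[OF that] by (rule frechet_derivative_at)
  then have "Ck_bounded m U D (\<lambda>x. frechet_derivative f (at x) v)" if "v \<in> Basis" for v
    using Ck_bounded_cong[OF assms(1) _ assms(4)[OF that]] by simp
  moreover have "f differentiable (at x)" if "x \<in> U" for x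
    using deriv[OF that] by (rule differentiableI)
  ultimately show ?thesis using assms(3) by simp
qed

lemma Ck_bounded_add:
  fixes f g :: "'a::euclidean_space \<Rightarrow> 'b::real_normed_vector"
  assumes "open U"
  shows "Ck_bounded m U D f \<Longrightarrow> Ck_bounded m U E g \<Longrightarrow> Ck_bounded m U (D + E) (\<lambda>x. f x + g x)"
proof (induction m arbitrary: f g)
  case 0
  then show ?case by (auto intro!: continuous_on_add norm_triangle_mono)
next
  case (Suc m)
  show ?case
    by (rule Ck_bounded_SucI[OF assms
        has_derivative_add[OF Suc.prems[THEN Ck_bounded_imp_Ck, THEN Ck_Suc_has_derivative]]])
       (use Suc in \<open>auto intro!: norm_triangle_mono\<close>)
qed

lemma Ck_bounded_bounded_linear_compose:
  fixes f :: "'a::euclidean_space \<Rightarrow> 'b::real_normed_vector"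
  assumes "bounded_linear T" "\<And>y. norm (T y) \<le> K * norm y" "K \<ge> 0" "open U"
  shows "Ck_bounded m U D f \<Longrightarrow> Ck_bounded m U (K * D) (\<lambda>x. T (f x))"
proof (induction m arbitrary: f)
  case 0
  then show ?case
    using bounded_linear.continuous_on[OF assms(1)] order_trans[OF assms(2) mult_left_mono[OF _ assms(3)]] by auto
next
  case (Suc m)
  show ?case
  proof (rule Ck_bounded_SucI[OF assms(4)])
    show "((\<lambda>x. T (f x)) has_derivative (\<lambda>h. T (frechet_derivative f (at x) h))) (at x)" if "x \<in> U" for x
      by (rule bounded_linear.has_derivative[OF assms(1)
          Ck_Suc_has_derivative[OF Ck_bounded_imp_Ck[OF Suc.prems] that]])
    show "norm (T (f x)) \<le> K * D" if "x \<in> U" for x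
      using order_trans[OF assms(2) mult_left_mono[OF _ assms(3)]] Suc.prems that by auto
    show "Ck_bounded m U (K * D) (\<lambda>x. T (frechet_derivative f (at x) v))" if "v \<in> Basis" for v
      using Suc that by simp
  qed
qed

lemma Ck_bounded_minus:
  fixes f :: "'a::euclidean_space \<Rightarrow> 'b::real_normed_vector"
  assumes "open U" "Ck_bounded m U D f"
  shows "Ck_bounded m U D (\<lambda>x. - f x)"
  using Ck_bounded_bounded_linear_compose[OF bounded_linear_minus[OF bounded_linear_ident], where K=1] assms by simp

lemma Ck_bounded_sum:
  fixes f :: "'i \<Rightarrow> 'a::euclidean_space \<Rightarrow> 'b::real_normed_vector"
  assumes "open U" "finite I" "\<And>i. i \<in> I \<Longrightarrow> Ck_bounded m U (D i) (f i)"
  shows "Ck_bounded m U (\<Sum>i\<in>I. D i) (\<lambda>x. \<Sum>i\<in>I. f i x)"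
  using assms(2,3)
proof (induction I rule: finite_induct)
  case empty
  have "Ck_bounded m U 0 (\<lambda>x::'a. 0::'b)" by (induction m) simp_all
  then show ?case by simp
qed (simp add: Ck_bounded_add[OF assms(1)])

lemma norm_linear_diff_le_on_Basis:
  fixes L :: "'a::euclidean_space \<Rightarrow> 'b::real_normed_vector"
  assumes lin: "linear L" and close: "\<And>v. v \<in> Basis \<Longrightarrow> norm (L v - G v) \<le> e / DIM('a)"
  shows "norm (L h - (\<Sum>v\<in>Basis. (h \<bullet> v) *\<^sub>R G v)) \<le> e * norm h"
proof -
  have "L h = L (\<Sum>v\<in>Basis. (h \<bullet> v) *\<^sub>R v)" by (simp only: euclidean_representation)
  also have "\<dots> = (\<Sum>v\<in>Basis. (h \<bullet> v) *\<^sub>R L v)" by (simp add: linear_sum[OF lin] linear_scale[OF lin])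
  finally have "norm (L h - (\<Sum>v\<in>Basis. (h \<bullet> v) *\<^sub>R G v)) = norm (\<Sum>v\<in>Basis. (h \<bullet> v) *\<^sub>R (L v - G v))"
    by (simp add: scaleR_diff_right sum_subtractf)
  also have "\<dots> \<le> (\<Sum>v\<in>(Basis::'a set). norm h * (e / DIM('a)))"
    by (rule sum_norm_le, unfold norm_scaleR) (intro mult_mono close, simp_all add: Basis_le_norm)
  finally show ?thesis by (simp add: mult.commute)
qed

lemma has_derivative_componentwise_sequence:
  fixes f :: "nat \<Rightarrow> 'a::euclidean_space \<Rightarrow> 'b::banach"
  assumes "open U" "x \<in> U" and deriv: "\<And>n x. x \<in> U \<Longrightarrow> (f n has_derivative f' n x) (at x)"
    and lim: "\<And>x. x \<in> U \<Longrightarrow> (\<lambda>n. f n x) \<longlonglongrightarrow> g x"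
    and lim': "\<And>v. v \<in> Basis \<Longrightarrow> uniform_limit U (\<lambda>n x. f' n x v) (G v) sequentially"
  shows "(g has_derivative (\<lambda>h. \<Sum>v\<in>Basis. (h \<bullet> v) *\<^sub>R G v x)) (at x)"
proof -
  let ?g' = "\<lambda>x h. \<Sum>v\<in>Basis. (h \<bullet> v) *\<^sub>R G v x"
  obtain r where r: "r > 0" "ball x r \<subseteq> U" using assms(1,2) open_contains_ball by blast
  have "\<exists>\<gamma>. \<forall>x'\<in>ball x r. (\<lambda>n. f n x') \<longlonglongrightarrow> \<gamma> x' \<and> (\<gamma> has_derivative ?g' x') (at x' within ball x r)"
  proof (rule has_derivative_sequence[where S="ball x r" and f=f and f'=f' and g'="?g'" and ?x0.0=x and l="g x",
      OF convex_ball])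
    show "(f n has_derivative f' n y) (at y within ball x r)" if "y \<in> ball x r" for n y
      by (rule has_derivative_at_withinI[OF deriv]) (use r(2) that in blast)
    show "x \<in> ball x r" using r(1) by simp
    show "(\<lambda>n. f n x) \<longlonglongrightarrow> g x" by (rule lim[OF assms(2)])
    fix e :: real assume "e > 0"
    then have "\<forall>\<^sub>F n in sequentially. \<forall>v\<in>Basis. \<forall>y\<in>U. dist (f' n y v) (G v y) < e / DIM('a)"
      using lim' by (intro eventually_ball_finite) (auto simp: uniform_limit_iff)
    then show "\<forall>\<^sub>F n in sequentially. \<forall>y\<in>ball x r. \<forall>h. norm (f' n y h - ?g' y h) \<le> e * norm h"
    proof eventually_elim
      case (elim n)
      show ?case
      proof (intro ballI allI)
        fix y and h :: 'a assume "y \<in> ball x r"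
        then have y: "y \<in> U" using r(2) by blast
        show "norm (f' n y h - ?g' y h) \<le> e * norm h"
          by (rule norm_linear_diff_le_on_Basis[OF has_derivative_linear[OF deriv[OF y]]])
             (use elim y in \<open>simp add: dist_norm less_imp_le\<close>)
      qed
    qed
  qed
  then obtain \<gamma> where \<gamma>: "\<And>y. y \<in> ball x r \<Longrightarrow> (\<lambda>n. f n y) \<longlonglongrightarrow> \<gamma> y \<and> (\<gamma> has_derivative ?g' y) (at y within ball x r)"
    by blast
  have x: "x \<in> ball x r" using r(1) by simp
  then have "(\<gamma> has_derivative ?g' x) (at x)"
    using \<gamma>[OF x] by (simp add: at_within_open[OF x open_ball])
  moreover have "\<gamma> y = g y" if "y \<in> ball x r" for y
  proof (rule LIMSEQ_unique)
    show "(\<lambda>n. f n y) \<longlonglongrightarrow> \<gamma> y" using \<gamma>[OF that] by blast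
    show "(\<lambda>n. f n y) \<longlonglongrightarrow> g y" using lim r(2) that by blast
  qed
  ultimately show ?thesis
    by (rule has_derivative_transform_within_open[OF _ open_ball x])
qed

definition Ck_Cauchy :: "nat \<Rightarrow> 'a::euclidean_space set \<Rightarrow> (nat \<Rightarrow> 'a \<Rightarrow> 'b::real_normed_vector) \<Rightarrow> bool" where
  "Ck_Cauchy m U f \<longleftrightarrow> (\<forall>n. Ck m U (f n)) \<and>
     (\<forall>e>0. \<exists>N. \<forall>i\<ge>N. \<forall>j\<ge>N. Ck_bounded m U e (\<lambda>x. f i x - f j x))"

lemma Ck_Cauchy_uniform_limit:
  fixes f :: "nat \<Rightarrow> 'a::euclidean_space \<Rightarrow> 'b::banach"
  assumes "Ck_Cauchy m U f"
  obtains g where "uniform_limit U f g sequentially"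
proof -
  have "uniformly_Cauchy_on U f"
    unfolding uniformly_Cauchy_on_def
  proof (intro allI impI)
    fix e :: real assume e: "e > 0"
    then obtain N where N: "\<And>i j. i \<ge> N \<Longrightarrow> j \<ge> N \<Longrightarrow> Ck_bounded m U (e / 2) (\<lambda>x. f i x - f j x)"
      using assms unfolding Ck_Cauchy_def by (meson half_gt_zero)
    have "dist (f i x) (f j x) < e" if "x \<in> U" "i \<ge> N" "j \<ge> N" for i j x
      using Ck_bounded_norm_le[OF N[OF that(2,3)] that(1)] e by (simp add: dist_norm)
    then show "\<exists>N. \<forall>x\<in>U. \<forall>i\<ge>N. \<forall>j\<ge>N. dist (f i x) (f j x) < e" by blast
  qed
  then show ?thesis using that Cauchy_uniformly_convergent unfolding uniformly_convergent_on_def by blast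
qed

lemma Ck_Cauchy_frechet_derivative:
  fixes f :: "nat \<Rightarrow> 'a::euclidean_space \<Rightarrow> 'b::banach"
  assumes "open U" "Ck_Cauchy (Suc m) U f" "v \<in> Basis"
  shows "Ck_Cauchy m U (\<lambda>n x. frechet_derivative (f n) (at x) v)"
  unfolding Ck_Cauchy_def
proof (intro conjI allI impI)
  have Ck: "Ck (Suc m) U (f n)" for n using assms(2) by (simp add: Ck_Cauchy_def)
  show "Ck m U (\<lambda>x. frechet_derivative (f n) (at x) v)" for n
    by (rule Ck_frechet_derivative[OF Ck assms(3)])
  fix e :: real assume "e > 0"
  then obtain N where N: "\<And>i j. i \<ge> N \<Longrightarrow> j \<ge> N \<Longrightarrow> Ck_bounded (Suc m) U e (\<lambda>x. f i x - f j x)"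
    using assms(2) unfolding Ck_Cauchy_def by blast
  have "Ck_bounded m U e (\<lambda>x. frechet_derivative (f i) (at x) v - frechet_derivative (f j) (at x) v)"
    if "i \<ge> N" "j \<ge> N" for i j
  proof (rule Ck_bounded_cong[OF assms(1)])
    show "Ck_bounded m U e (\<lambda>x. frechet_derivative (\<lambda>x. f i x - f j x) (at x) v)"
      using N[OF that] assms(3) by simp
    show "frechet_derivative (\<lambda>x. f i x - f j x) (at x) v
        = frechet_derivative (f i) (at x) v - frechet_derivative (f j) (at x) v"
      if "x \<in> U" for x
      using frechet_derivative_at[OF has_derivative_diff[OF Ck[THEN Ck_Suc_has_derivative, OF that]
          Ck[THEN Ck_Suc_has_derivative, OF that]]]
      by metis
  qed
  then show "\<exists>N. \<forall>i\<ge>N. \<forall>j\<ge>N. Ck_bounded m U e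
      (\<lambda>x. frechet_derivative (f i) (at x) v - frechet_derivative (f j) (at x) v)" by blast
qed

theorem Ck_Cauchy_limit:
  fixes f :: "nat \<Rightarrow> 'a::euclidean_space \<Rightarrow> 'b::banach"
  assumes "open U"
  shows "Ck_Cauchy m U f \<Longrightarrow> \<exists>g. uniform_limit U f g sequentially \<and> Ck m U g
    \<and> (\<forall>D. (\<forall>n. Ck_bounded m U D (f n)) \<longrightarrow> Ck_bounded m U D g)"
proof (induction m arbitrary: f)
  case (0 f)
  obtain g where g: "uniform_limit U f g sequentially" using Ck_Cauchy_uniform_limit[OF 0] .
  have "continuous_on U g"
    using 0 by (intro uniform_limit_theorem[OF _ g]) (auto simp: Ck_Cauchy_def)
  moreover have "norm (g x) \<le> D" if "\<And>n. Ck_bounded 0 U D (f n)" "x \<in> U" for x D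
    by (rule LIMSEQ_le_const2[OF tendsto_norm[OF tendsto_uniform_limitI[OF g that(2)]]]) (use that in auto)
  ultimately show ?case using g by auto
next
  case (Suc m f)
  obtain g where g: "uniform_limit U f g sequentially" using Ck_Cauchy_uniform_limit[OF Suc.prems] .
  have "\<exists>G. uniform_limit U (\<lambda>n x. frechet_derivative (f n) (at x) v) G sequentially \<and> Ck m U G
      \<and> (\<forall>D. (\<forall>n. Ck_bounded m U D (\<lambda>x. frechet_derivative (f n) (at x) v)) \<longrightarrow> Ck_bounded m U D G)"
    if "v \<in> Basis" for v
    by (rule Suc.IH[OF Ck_Cauchy_frechet_derivative[OF assms Suc.prems that]])
  then obtain G where G:
      "\<And>v. v \<in> Basis \<Longrightarrow> uniform_limit U (\<lambda>n x. frechet_derivative (f n) (at x) v) (G v) sequentially"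
    "\<And>v. v \<in> Basis \<Longrightarrow> Ck m U (G v)"
    "\<And>v D. v \<in> Basis \<Longrightarrow> (\<And>n. Ck_bounded m U D (\<lambda>x. frechet_derivative (f n) (at x) v)) \<Longrightarrow> Ck_bounded m U D (G v)"
    by metis
  have f_deriv: "(f n has_derivative frechet_derivative (f n) (at x)) (at x)" if "x \<in> U" for n x
    using Suc.prems that by (intro Ck_Suc_has_derivative[of m U]) (simp_all add: Ck_Cauchy_def)
  have g_deriv: "(g has_derivative (\<lambda>h. \<Sum>v\<in>Basis. (h \<bullet> v) *\<^sub>R G v x)) (at x)" if "x \<in> U" for x
    by (rule has_derivative_componentwise_sequence[OF assms that f_deriv tendsto_uniform_limitI[OF g] G(1)])
  have along_basis: "(\<lambda>x. \<Sum>w\<in>Basis. (v \<bullet> w) *\<^sub>R G w x) = G v" if "v \<in> Basis" for v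
    using sum_inner_Basis_scaleR[OF that, of "\<lambda>w. G w x" for x] by (simp add: inner_commute[of v] fun_eq_iff)
  have "Ck (Suc m) U g"
    by (rule Ck_SucI[OF assms g_deriv]) (auto simp: along_basis G(2))
  moreover have "Ck_bounded (Suc m) U D g" if "\<And>n. Ck_bounded (Suc m) U D (f n)" for D
  proof (rule Ck_bounded_SucI[OF assms g_deriv])
    show "norm (g x) \<le> D" if "x \<in> U" for x
      by (rule LIMSEQ_le_const2[OF tendsto_norm[OF tendsto_uniform_limitI[OF g that]]])
         (use \<open>\<And>n. Ck_bounded (Suc m) U D (f n)\<close> that in auto)
    show "Ck_bounded m U D (\<lambda>x. \<Sum>w\<in>Basis. (v \<bullet> w) *\<^sub>R G w x)" if "v \<in> Basis" for v
      using G(3)[OF that] \<open>\<And>n. Ck_bounded (Suc m) U D (f n)\<close> that by (simp add: along_basis)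
  qed
  ultimately show ?case using g by blast
qed

theorem Ck_suminf:
  fixes f :: "nat \<Rightarrow> 'a::euclidean_space \<Rightarrow> 'b::banach"
  assumes "open U" and bound: "\<And>j. Ck_bounded m U (D j) (f j)" and "summable D"
  shows "Ck m U (\<lambda>x. \<Sum>j. f j x)"
proof -
  let ?S = "\<lambda>n x. \<Sum>j<n. f j x"
  have "Ck_Cauchy m U ?S"
    unfolding Ck_Cauchy_def
  proof (intro conjI allI impI)
    show "Ck m U (?S n)" for n by (intro Ck_sum assms Ck_bounded_imp_Ck[OF bound])
    fix e :: real assume "e > 0"
    then obtain N where N: "\<And>i j. i \<ge> N \<Longrightarrow> norm (sum D {i..<j}) < e"
      using \<open>summable D\<close> unfolding summable_Cauchy by blast
    have tail: "Ck_bounded m U e (\<lambda>x. ?S j x - ?S i x)" if "N \<le> i" "i \<le> j" for i j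
    proof -
      have "sum D {i..<j} \<le> e" using N[OF that(1), of j] by simp
      moreover have "Ck_bounded m U (sum D {i..<j}) (\<lambda>x. \<Sum>k\<in>{i..<j}. f k x)"
        by (intro Ck_bounded_sum assms bound) simp
      ultimately have "Ck_bounded m U e (\<lambda>x. \<Sum>k\<in>{i..<j}. f k x)" by (rule Ck_bounded_mono)
      then show ?thesis using that(2) by (simp add: lessThan_atLeast0 sum_diff_nat_ivl)
    qed
    have "Ck_bounded m U e (\<lambda>x. ?S i x - ?S j x)" if "N \<le> i" "N \<le> j" for i j
      using tail[of i j] tail[of j i] Ck_bounded_minus[OF assms(1) tail[of i j]] that by (cases "i \<le> j") auto
    then show "\<exists>N. \<forall>i\<ge>N. \<forall>j\<ge>N. Ck_bounded m U e (\<lambda>x. ?S i x - ?S j x)" by blast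
  qed
  from Ck_Cauchy_limit[OF assms(1) this] obtain g where g: "uniform_limit U ?S g sequentially" "Ck m U g"
    by blast
  have "g x = (\<Sum>j. f j x)" if "x \<in> U" for x
    using tendsto_uniform_limitI[OF g(1) that] by (intro sums_unique) (simp add: sums_def)
  then show ?thesis by (rule Ck_cong[OF assms(1) _ g(2)])
qed

subsection \<open>Power series with coefficients of class \<open>C\<^sup>m\<close>\<close>

lemma has_derivative_power_times:
  fixes h :: "'a::real_normed_vector \<Rightarrow> complex"
  assumes "(h has_derivative h') (at (snd p))"
  shows "((\<lambda>p. fst p ^ i * h (snd p)) has_derivative
    (\<lambda>d. fst p ^ (i - 1) * (of_nat i * fst d * h (snd p)) + fst p ^ i * h' (snd d))) (at p)"
proof -
  from has_derivative_compose[OF has_derivative_snd[OF has_derivative_ident] assms]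
  have "((\<lambda>p. h (snd p)) has_derivative (\<lambda>d. h' (snd d))) (at p)" .
  from has_derivative_mult[OF has_derivative_power[OF has_derivative_fst[OF has_derivative_ident]] this]
  show ?thesis by (simp add: mult_ac add.commute)
qed

lemma norm_power_times_le:
  fixes z w :: complex
  assumes "norm z < \<rho>" "norm w \<le> D"
  shows "norm (z ^ i * w) \<le> D * \<rho> ^ i"
proof -
  have "0 \<le> D" using norm_ge_zero assms(2) by (rule order_trans)
  then show ?thesis
    using mult_mono[of "norm (z ^ i)" "\<rho> ^ i" "norm w" D] assms
        order_trans[OF norm_ge_zero less_imp_le[OF assms(1)]]
    by (simp add: norm_mult norm_power power_mono less_imp_le mult.commute)
qed

lemma power_times_derivative_bound:
  fixes \<rho> :: real
  assumes "\<rho> > 0"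
  shows "real i * ((1 + real (i - 1) / \<rho>) ^ m * \<rho> ^ (i - 1)) \<le> (1 + real i / \<rho>) ^ Suc m * \<rho> ^ i"
proof (cases i)
  case (Suc i')
  have "real i * ((1 + real i' / \<rho>) ^ m * \<rho> ^ i') \<le> ((1 + real i / \<rho>) * \<rho>) * ((1 + real i / \<rho>) ^ m * \<rho> ^ i')"
    using assms Suc by (intro mult_mono power_mono mult_right_mono) (auto simp: field_simps)
  then show ?thesis by (simp add: Suc mult_ac)
qed simp

lemma Ck_bounded_power_times_scalar_derivative:
  fixes h :: "'a::euclidean_space \<Rightarrow> complex"
  assumes "open B" "\<rho> > 0" "D \<ge> 0" and h: "Ck_bounded m B D h" and norm_c: "norm c = 1"
    and power_times: "\<And>i (h :: 'a \<Rightarrow> complex) D. Ck_bounded m B D h \<Longrightarrow> D \<ge> 0 \<Longrightarrow>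
      Ck_bounded m (ball 0 \<rho> \<times> B) (D * ((1 + real i / \<rho>) ^ m * \<rho> ^ i)) (\<lambda>p. fst p ^ i * h (snd p))"
  shows "Ck_bounded m (ball 0 \<rho> \<times> B) (D * ((1 + real i / \<rho>) ^ Suc m * \<rho> ^ i))
    (\<lambda>p. fst p ^ (i - 1) * (of_nat i * c * h (snd p)))"
proof (rule Ck_bounded_mono)
  have "Ck_bounded m B (real i * D) (\<lambda>x. of_nat i * c * h x)"
    by (rule Ck_bounded_bounded_linear_compose[OF bounded_linear_mult_right _ _ assms(1) h])
        (simp_all add: norm_mult norm_c)
  from power_times[OF this, of "i - 1"]
  show "Ck_bounded m (ball 0 \<rho> \<times> B) (real i * D * ((1 + real (i - 1) / \<rho>) ^ m * \<rho> ^ (i - 1)))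
      (\<lambda>p. fst p ^ (i - 1) * (of_nat i * c * h (snd p)))"
    using assms(3) by simp
  show "real i * D * ((1 + real (i - 1) / \<rho>) ^ m * \<rho> ^ (i - 1)) \<le> D * ((1 + real i / \<rho>) ^ Suc m * \<rho> ^ i)"
    using mult_left_mono[OF power_times_derivative_bound[OF assms(2), of i m] assms(3)] by (simp add: mult_ac)
qed

lemma Ck_bounded_power_times:
  fixes h :: "'a::euclidean_space \<Rightarrow> complex"
  assumes "open B" "\<rho> > 0"
  shows "Ck_bounded m B D h \<Longrightarrow> D \<ge> 0 \<Longrightarrow>
    Ck_bounded m (ball 0 \<rho> \<times> B) (D * ((1 + real i / \<rho>) ^ m * \<rho> ^ i)) (\<lambda>p. fst p ^ i * h (snd p))"
proof (induction m arbitrary: i h D)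
  case (0 i h D)
  have "continuous_on (ball 0 \<rho> \<times> B) (\<lambda>p. fst p ^ i * h (snd p))"
    using 0 by (auto intro!: continuous_intros continuous_on_compose2[of B h])
  then show ?case using 0 by (auto intro: norm_power_times_le)
next
  case (Suc m i h D)
  let ?bound = "D * ((1 + real i / \<rho>) ^ Suc m * \<rho> ^ i)"
  let ?f' = "\<lambda>p d. fst p ^ (i - 1) * (of_nat i * fst d * h (snd p))
      + fst p ^ i * frechet_derivative h (at (snd p)) (snd d)"
  have open_domain: "open (ball (0::complex) \<rho> \<times> B)" using assms(1) by (intro open_Times) auto
  note deriv = Ck_Suc_has_derivative[OF Ck_bounded_imp_Ck[OF Suc.prems(1)]]
  show ?case
  proof (rule Ck_bounded_SucI[OF open_domain, where f'="?f'"])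
    fix p assume "p \<in> ball (0::complex) \<rho> \<times> B"
    then have p: "norm (fst p) < \<rho>" "snd p \<in> B" by auto
    show "((\<lambda>p. fst p ^ i * h (snd p)) has_derivative ?f' p) (at p)"
      by (rule has_derivative_power_times[OF deriv[OF p(2)]])
    have "norm (fst p ^ i * h (snd p)) \<le> D * (1 * \<rho> ^ i)"
      using norm_power_times_le[OF p(1) Ck_bounded_norm_le[OF Suc.prems(1) p(2)]] by simp
    also have "\<dots> \<le> ?bound"
      using assms(2) Suc.prems(2) by (intro mult_left_mono mult_right_mono one_le_power) auto
    finally show "norm (fst p ^ i * h (snd p)) \<le> ?bound" .
  next
    fix d :: "complex \<times> 'a" assume "d \<in> Basis"
    then consider (scalar) "snd d = 0" "norm (fst d) = 1" | (vector) "fst d = 0" "snd d \<in> Basis"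
      by (auto simp: Basis_prod_def norm_Basis)
    then show "Ck_bounded m (ball 0 \<rho> \<times> B) ?bound (\<lambda>p. ?f' p d)"
    proof cases
      case scalar
      note Ck_bounded_power_times_scalar_derivative[OF assms Suc.prems(2) Ck_bounded_SucD[OF Suc.prems(1)] scalar(2)
          Suc.IH]
      then show ?thesis
        by (rule Ck_bounded_cong[OF open_domain, rotated])
           (auto simp: scalar(1) linear_0[OF has_derivative_linear[OF deriv]])
    next
      case vector
      have "D * ((1 + real i / \<rho>) ^ m * \<rho> ^ i) \<le> ?bound"
        using assms(2) Suc.prems(2) by (intro mult_left_mono mult_right_mono power_increasing) auto
      moreover have "Ck_bounded m (ball 0 \<rho> \<times> B) (D * ((1 + real i / \<rho>) ^ m * \<rho> ^ i))
          (\<lambda>p. fst p ^ i * frechet_derivative h (at (snd p)) (snd d))"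
        using Suc.prems vector(2) by (intro Suc.IH) simp_all
      ultimately show ?thesis using Ck_bounded_mono by (simp add: vector(1))
    qed
  qed
qed

lemma summable_polynomial_times_geometric:
  fixes q c :: real
  assumes "0 < q" "q < 1" "0 < c"
  shows "summable (\<lambda>i. (1 + c * real i) ^ m * q ^ i)"
proof -
  obtain r where r: "q < r" "r < 1" using dense[OF assms(2)] by blast
  have "(\<lambda>i. (1 + c * real i) ^ m * q ^ i) \<in> O(\<lambda>i. r ^ i)" using assms r by real_asymp
  moreover have "summable (\<lambda>i. norm (r ^ i))" using assms r by (simp add: summable_geometric)
  ultimately show ?thesis using summable_comparison_test_bigo by blast
qed

theorem Ck_power_series:
  fixes g :: "nat \<Rightarrow> 'a::euclidean_space \<Rightarrow> complex"
  assumes "open \<Omega>"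
    and bound: "\<And>\<rho> x. 0 < \<rho> \<Longrightarrow> \<rho> < S \<Longrightarrow> x \<in> \<Omega> \<Longrightarrow>
      \<exists>r>0. \<exists>D. \<forall>j. Ck_bounded m (ball x r) D (\<lambda>y. of_real (\<rho> ^ j) * g j y)"
  shows "Ck m (ball 0 S \<times> \<Omega>) (\<lambda>(z, x). \<Sum>j. z ^ j * g j x)"
proof (rule Ck_local)
  fix p assume "p \<in> ball (0::complex) S \<times> \<Omega>"
  then obtain z x where p: "p = (z, x)" "norm z < S" "x \<in> \<Omega>" by (cases p) auto
  obtain \<rho> where \<rho>: "norm z < \<rho>" "\<rho> < S" using dense[OF p(2)] by blast
  obtain \<rho>' where \<rho>': "\<rho> < \<rho>'" "\<rho>' < S" using dense[OF \<rho>(2)] by blast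
  have pos: "0 < \<rho>" "0 < \<rho>'" using \<rho>(1) \<rho>'(1) norm_ge_zero[of z] by linarith+
  obtain r D where r: "r > 0" and D: "\<And>j. Ck_bounded m (ball x r) D (\<lambda>y. of_real (\<rho>' ^ j) * g j y)"
    using bound[OF pos(2) \<rho>'(2) p(3)] by blast
  have "norm (of_real (\<rho>' ^ 0) * g 0 x) \<le> D"
    by (rule Ck_bounded_norm_le[OF D]) (simp add: r)
  then have "D \<ge> 0" by (rule order_trans[OF norm_ge_zero])
  let ?A = "ball (0::complex) \<rho> \<times> ball x r"
  have "Ck_bounded m ?A (D / \<rho>' ^ j * ((1 + real j / \<rho>) ^ m * \<rho> ^ j)) (\<lambda>p. fst p ^ j * g j (snd p))" for j
  proof (rule Ck_bounded_power_times[OF open_ball pos(1)])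
    have "Ck_bounded m (ball x r) (1 / \<rho>' ^ j * D) (\<lambda>y. of_real (1 / \<rho>' ^ j) * (of_real (\<rho>' ^ j) * g j y))"
      by (rule Ck_bounded_bounded_linear_compose[OF bounded_linear_mult_right _ _ open_ball D])
         (use pos in \<open>simp_all add: norm_mult norm_divide norm_power\<close>)
    then show "Ck_bounded m (ball x r) (D / \<rho>' ^ j) (g j)" using pos by simp
    show "0 \<le> D / \<rho>' ^ j" using \<open>D \<ge> 0\<close> pos by simp
  qed
  moreover have "summable (\<lambda>j. D / \<rho>' ^ j * ((1 + real j / \<rho>) ^ m * \<rho> ^ j))"
    using summable_mult[OF summable_polynomial_times_geometric[of "\<rho> / \<rho>'" "1 / \<rho>" m], of D] pos \<rho>'(1)
    by (simp add: power_divide mult_ac)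
  ultimately have "Ck m ?A (\<lambda>p. \<Sum>j. fst p ^ j * g j (snd p))"
    by (intro Ck_suminf open_Times open_ball)
  moreover have "open ?A" "p \<in> ?A" using \<rho>(1) r p(1) by (auto intro!: open_Times)
  ultimately show "\<exists>V. open V \<and> p \<in> V \<and> Ck m V (\<lambda>(z, x). \<Sum>j. z ^ j * g j x)"
    by (auto simp: case_prod_unfold)
qed

section \<open>Test functions\<close>

subsection \<open>Partial derivatives\<close>

lemma sum_axis: "(\<Sum>i\<in>UNIV. x $ i *\<^sub>R axis i 1) = (x :: real^'n::finite)"
  using basis_expansion[of x] by (simp add: scalar_mult_eq_scaleR)

lemma partial_eqI: "(f has_derivative f') (at x) \<Longrightarrow> partial i f x = f' (axis i 1)"
  unfolding partial_def using frechet_derivative_at by metis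

lemma frechet_derivative_eq_sum_partial:
  fixes f :: "real^'n::finite \<Rightarrow> 'b::real_normed_vector"
  assumes "f differentiable at x"
  shows "frechet_derivative f (at x) h = (\<Sum>i\<in>UNIV. h $ i *\<^sub>R partial i f x)"
proof -
  have lin: "linear (frechet_derivative f (at x))"
    using assms has_derivative_linear unfolding frechet_derivative_works by blast
  have "frechet_derivative f (at x) h = frechet_derivative f (at x) (\<Sum>i\<in>UNIV. h $ i *\<^sub>R axis i 1)"
    by (simp only: sum_axis)
  also have "\<dots> = (\<Sum>i\<in>UNIV. h $ i *\<^sub>R partial i f x)"
    by (simp add: linear_sum[OF lin] linear_scale[OF lin] partial_def)
  finally show ?thesis .
qed

lemma partial_eq_component:
  fixes f :: "real^'n::finite \<Rightarrow> 'b::real_normed_vector"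
  assumes "(f has_derivative (\<lambda>h. \<Sum>i\<in>UNIV. h $ i *\<^sub>R G i)) (at x)"
  shows "partial i f x = G i"
proof -
  have "partial i f x = (\<Sum>j\<in>UNIV. axis i 1 $ j *\<^sub>R G j)" by (rule partial_eqI[OF assms])
  also have "\<dots> = (\<Sum>j\<in>UNIV. if j = i then G j else 0)" by (intro sum.cong) (auto simp: axis_def)
  finally show ?thesis by simp
qed

lemma partial_add:
  assumes "f differentiable at x" "g differentiable at x"
  shows "partial i (\<lambda>x. f x + g x) x = partial i f x + partial i g x"
  using partial_eqI[OF has_derivative_add[OF assms[unfolded frechet_derivative_works]]]
  by (simp add: partial_def)

lemma partial_diff:
  assumes "f differentiable at x" "g differentiable at x"
  shows "partial i (\<lambda>x. f x - g x) x = partial i f x - partial i g x"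
  using partial_eqI[OF has_derivative_diff[OF assms[unfolded frechet_derivative_works]]]
  by (simp add: partial_def)

lemma partial_mult:
  fixes f g :: "real^'n::finite \<Rightarrow> 'b::real_normed_algebra"
  assumes "f differentiable at x" "g differentiable at x"
  shows "partial i (\<lambda>x. f x * g x) x = partial i f x * g x + f x * partial i g x"
  using partial_eqI[OF has_derivative_mult[OF assms[unfolded frechet_derivative_works]]]
  by (simp add: partial_def)

lemma partial_sum:
  assumes "\<And>j. j \<in> I \<Longrightarrow> f j differentiable at x"
  shows "partial i (\<lambda>x. \<Sum>j\<in>I. f j x) x = (\<Sum>j\<in>I. partial i (f j) x)"
  using partial_eqI[OF has_derivative_sum[OF assms[unfolded frechet_derivative_works]]]
  by (simp add: partial_def)

lemma partial_const [simp]: "partial i (\<lambda>x. c) x = 0"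
  by (simp add: partial_def)

lemma partial_cong_open:
  assumes "f differentiable at x" "open U" "x \<in> U" "\<And>y. y \<in> U \<Longrightarrow> f y = g y"
  shows "partial i f x = partial i g x"
  unfolding partial_def using frechet_derivative_transform_within_open[OF assms] by simp

lemma partial_outside_support:
  assumes "x \<notin> closure {x. f x \<noteq> 0}"
  shows "partial i f x = 0"
proof -
  have "partial i (\<lambda>x. 0) x = partial i f x"
  proof (rule partial_cong_open)
    show "0 = f y" if "y \<in> - closure {x. f x \<noteq> 0}" for y
      using that closure_subset[of "{x. f x \<noteq> 0}"] by auto
  qed (use assms in auto)
  then show ?thesis by simp
qed

lemma support_partial: "{x. partial i f x \<noteq> 0} \<subseteq> closure {x. f x \<noteq> 0}"
  using partial_outside_support by blast

subsection \<open>Closure properties of test functions\<close>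

lemma in_closure_support: "f x \<noteq> 0 \<Longrightarrow> x \<in> closure {x. f x \<noteq> 0}"
  using closure_subset by fast

lemma test_fun_UNIV_iff: "test_fun UNIV \<phi> \<longleftrightarrow> smooth_on UNIV \<phi> \<and> bounded {x. \<phi> x \<noteq> 0}"
  by (simp add: test_fun_def compact_closure)

lemma test_fun_mono: "test_fun A f \<Longrightarrow> A \<subseteq> B \<Longrightarrow> test_fun B f"
  unfolding test_fun_def by blast

lemma test_fun_UNIV: "test_fun \<Omega> \<phi> \<Longrightarrow> test_fun UNIV \<phi>"
  by (simp add: test_fun_mono)

lemma test_fun_outside: "test_fun \<Omega> f \<Longrightarrow> x \<notin> \<Omega> \<Longrightarrow> f x = 0"
  unfolding test_fun_def using in_closure_support[of f x] by blast

lemma test_fun_smooth_on: "test_fun \<Omega> \<phi> \<Longrightarrow> smooth_on UNIV \<phi>"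
  by (simp add: test_fun_def)

lemma test_fun_has_derivative: "test_fun \<Omega> f \<Longrightarrow> (f has_derivative frechet_derivative f (at x)) (at x)"
  using smooth_on_has_derivative[OF test_fun_smooth_on] by auto

lemma test_fun_differentiable: "test_fun \<Omega> f \<Longrightarrow> f differentiable at x"
  using test_fun_has_derivative differentiable_def by blast

lemma test_fun_continuous_on: "test_fun \<Omega> f \<Longrightarrow> continuous_on A f"
  using smooth_on_continuous_on[OF test_fun_smooth_on] continuous_on_subset by blast

lemma test_fun_measurable: "test_fun \<Omega> f \<Longrightarrow> f \<in> borel_measurable borel"
  by (intro borel_measurable_continuous_onI test_fun_continuous_on)

lemma test_funI:
  assumes "smooth_on UNIV f" "{x. f x \<noteq> 0} \<subseteq> C" "compact C" "C \<subseteq> \<Omega>"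
  shows "test_fun \<Omega> f"
proof -
  have "closure {x. f x \<noteq> 0} \<subseteq> C"
    using assms by (intro closure_minimal compact_imp_closed)
  then show ?thesis
    unfolding test_fun_def using assms compact_closure bounded_subset compact_imp_bounded
    by (metis subset_trans)
qed

lemma test_fun_partial:
  assumes "test_fun \<Omega> f" shows "test_fun \<Omega> (partial i f)"
proof (rule test_funI[where C="closure {x. f x \<noteq> 0}"])
  show "smooth_on UNIV (partial i f)"
    using smooth_on_frechet_derivative[of UNIV f "axis i 1"] assms
    by (simp add: partial_def[abs_def] test_fun_def)
qed (use assms support_partial in \<open>auto simp: test_fun_def\<close>)

lemma test_fun_mult_smooth:
  assumes "test_fun \<Omega> f" "smooth_on UNIV g" shows "test_fun \<Omega> (\<lambda>x. g x * f x)"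
  by (rule test_funI[where C="closure {x. f x \<noteq> 0}"])
     (use assms in \<open>auto simp: test_fun_def intro!: smooth_on_mult in_closure_support\<close>)

lemma test_fun_mult:
  assumes "test_fun \<Omega> f" "test_fun UNIV g" shows "test_fun \<Omega> (\<lambda>x. f x * g x)"
  using test_fun_mult_smooth[OF assms(1) test_fun_smooth_on[OF assms(2)]] by (simp add: mult.commute)

lemma test_fun_cmult: "test_fun \<Omega> f \<Longrightarrow> test_fun \<Omega> (\<lambda>x. c * f x)"
  by (rule test_fun_mult_smooth) (auto simp: smooth_on_def)

lemma test_fun_zero [simp]: "test_fun \<Omega> (\<lambda>x. 0)"
  by (simp add: test_fun_def smooth_on_def)

lemma test_fun_add:
  assumes "test_fun \<Omega> f" "test_fun \<Omega> g" shows "test_fun \<Omega> (\<lambda>x. f x + g x)"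
  by (rule test_funI[where C="closure {x. f x \<noteq> 0} \<union> closure {x. g x \<noteq> 0}"])
     (use assms in \<open>auto simp: test_fun_def intro!: smooth_on_add in_closure_support\<close>)

lemma test_fun_diff:
  assumes "test_fun \<Omega> f" "test_fun \<Omega> g" shows "test_fun \<Omega> (\<lambda>x. f x - g x)"
  using test_fun_add[OF assms(1) test_fun_cmult[OF assms(2), of "-1"]] by simp

lemma test_fun_sum:
  "(\<And>i. i \<in> I \<Longrightarrow> test_fun \<Omega> (f i)) \<Longrightarrow> test_fun \<Omega> (\<lambda>x. \<Sum>i\<in>I. f i x)"
  by (induction I rule: infinite_finite_induct) (auto intro: test_fun_add)

lemma test_fun_mult_smooth_on:
  assumes \<eta>: "test_fun \<Omega> \<eta>" and \<Omega>: "open \<Omega>" and g: "smooth_on \<Omega> g"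
  shows "test_fun \<Omega> (\<lambda>x. \<eta> x * g x)"
proof (rule test_funI[where C="closure {x. \<eta> x \<noteq> 0}"])
  show "smooth_on UNIV (\<lambda>x. \<eta> x * g x)"
    unfolding smooth_on_def
  proof (intro allI Ck_local)
    fix m x
    show "\<exists>V. open V \<and> x \<in> V \<and> Ck m V (\<lambda>x. \<eta> x * g x)"
    proof (cases "x \<in> \<Omega>")
      case True
      have "Ck m \<Omega> \<eta>" using \<eta> Ck_subset[of \<Omega> UNIV m \<eta>] by (simp add: test_fun_def smooth_on_def)
      then have "Ck m \<Omega> (\<lambda>x. \<eta> x * g x)" using g by (intro Ck_mult[OF \<Omega>]) (auto simp: smooth_on_def)
      then show ?thesis using True \<Omega> by blast
    next
      case False
      let ?V = "- closure {x. \<eta> x \<noteq> 0}"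
      have "Ck m ?V (\<lambda>x. \<eta> x * g x)"
      proof (rule Ck_cong[of _ "\<lambda>x. 0"])
        show "0 = \<eta> y * g y" if "y \<in> ?V" for y using that in_closure_support[of \<eta> y] by auto
      qed auto
      moreover have "x \<in> ?V" "open ?V" using False \<eta> by (auto simp: test_fun_def)
      ultimately show ?thesis by (intro exI[of _ ?V]) simp
    qed
  qed
  show "{x. \<eta> x * g x \<noteq> 0} \<subseteq> closure {x. \<eta> x \<noteq> 0}" using in_closure_support[of \<eta>] by auto
qed (use \<eta> in \<open>auto simp: test_fun_def\<close>)

lemma test_fun_affine:
  assumes "test_fun UNIV f" "c \<noteq> 0" shows "test_fun UNIV (\<lambda>x. f (d + c *\<^sub>R x))"
proof -
  let ?T = "\<lambda>y. (1/c) *\<^sub>R (y - d)"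
  have "{x. f (d + c *\<^sub>R x) \<noteq> 0} \<subseteq> ?T ` {x. f x \<noteq> 0}"
  proof
    fix x assume "x \<in> {x. f (d + c *\<^sub>R x) \<noteq> 0}"
    then show "x \<in> ?T ` {x. f x \<noteq> 0}"
      using assms(2) by (intro image_eqI[of _ _ "d + c *\<^sub>R x"]) auto
  qed
  moreover have "bounded (?T ` {x. f x \<noteq> 0})"
    using assms(1) by (auto simp: test_fun_UNIV_iff image_image[symmetric, of "\<lambda>y. (1/c) *\<^sub>R y" "\<lambda>y. y - d"]
         intro!: bounded_scaling bounded_translation_minus)
  ultimately show ?thesis
    using assms Ck_affine_compose unfolding test_fun_UNIV_iff smooth_on_def by (metis bounded_subset)
qed

lemma test_fun_cnj:
  assumes "test_fun UNIV f" shows "test_fun UNIV (\<lambda>x. cnj (f x))"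
  using assms Ck_bounded_linear_compose[OF bounded_linear_cnj open_UNIV] unfolding test_fun_UNIV_iff smooth_on_def
  by (simp del: Ck.simps) blast

lemma partial_cnj:
  assumes "test_fun \<Omega> f" shows "partial i (\<lambda>x. cnj (f x)) x = cnj (partial i f x)"
  by (subst partial_eqI[OF bounded_linear.has_derivative[OF bounded_linear_cnj test_fun_has_derivative[OF assms]]])
     (simp add: partial_def)

lemma partial_affine:
  assumes "test_fun \<Omega> f" shows "partial i (\<lambda>x. f (d + c *\<^sub>R x)) x = c *\<^sub>R partial i f (d + c *\<^sub>R x)"
  using partial_eqI[OF has_derivative_affine_compose[OF test_fun_has_derivative[OF assms]]]
  by (simp add: partial_def)

lemma partial_mult_test_fun:
  "test_fun \<Omega> f \<Longrightarrow> test_fun \<Omega>' g \<Longrightarrow> partial i (\<lambda>x. f x * g x) = (\<lambda>x. partial i f x * g x + f x * partial i g x)"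
  by (rule ext, rule partial_mult) (rule test_fun_differentiable, assumption)+

lemma partial_add_test_fun:
  "test_fun \<Omega> f \<Longrightarrow> test_fun \<Omega>' g \<Longrightarrow> partial i (\<lambda>x. f x + g x) = (\<lambda>x. partial i f x + partial i g x)"
  by (rule ext, rule partial_add) (rule test_fun_differentiable, assumption)+

lemma partial_diff_test_fun:
  "test_fun \<Omega> f \<Longrightarrow> test_fun \<Omega>' g \<Longrightarrow> partial i (\<lambda>x. f x - g x) = (\<lambda>x. partial i f x - partial i g x)"
  by (rule ext, rule partial_diff) (rule test_fun_differentiable, assumption)+

lemma partial_cmult_test_fun:
  "test_fun \<Omega> f \<Longrightarrow> partial i (\<lambda>x. c * f x) = (\<lambda>x. c * partial i f x)"
  by (rule ext, subst partial_mult) (auto intro: test_fun_differentiable)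

lemma partial_sum_test_fun:
  "(\<And>j. j \<in> I \<Longrightarrow> test_fun \<Omega> (f j)) \<Longrightarrow> partial i (\<lambda>x. \<Sum>j\<in>I. f j x) = (\<lambda>x. \<Sum>j\<in>I. partial i (f j) x)"
  by (rule ext, rule partial_sum) (rule test_fun_differentiable)

lemma compact_support_bounded:
  fixes f :: "'a::topological_space \<Rightarrow> 'b::real_normed_vector"
  assumes "continuous_on C f" "compact C" "{x. f x \<noteq> 0} \<subseteq> C"
  obtains B where "B > 0" "\<And>x. norm (f x) \<le> B"
proof -
  have "bounded (f ` C)"
    by (intro compact_imp_bounded compact_continuous_image assms)
  then obtain B where B: "B > 0" "\<And>x. x \<in> C \<Longrightarrow> norm (f x) \<le> B"
    unfolding bounded_pos by auto
  have "norm (f x) \<le> B" for x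
    using B assms(3) by (cases "f x = 0") auto
  then show ?thesis using B(1) that by blast
qed

lemma test_fun_bounded:
  assumes "test_fun \<Omega> f" obtains B where "B > 0" "\<And>x. norm (f x) \<le> B"
  using compact_support_bounded[OF test_fun_continuous_on[OF assms] _ closure_subset] assms that
  unfolding test_fun_def by metis

lemma bounded_support_cball:
  assumes "bounded {x. f x \<noteq> 0}" obtains R where "R > 0" "{x. f x \<noteq> 0} \<subseteq> cball 0 R"
  using bounded_subset_ballD[OF assms, of 0] that ball_subset_cball by (metis subset_trans)

lemma test_fun_frechet_derivative_bounded:
  assumes "test_fun \<Omega> f"
  obtains L where "L > 0" "\<And>x h. norm (frechet_derivative f (at x) h) \<le> L * norm h"
proof -
  have "\<exists>B>0. \<forall>x. norm (partial i f x) \<le> B" for i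
    using test_fun_bounded[OF test_fun_partial[OF assms, of i]] by metis
  then obtain B where B: "\<And>i. B i > 0" "\<And>i x. norm (partial i f x) \<le> B i"
    by metis
  define L where "L = 1 + (\<Sum>i\<in>UNIV. B i)"
  have "L > 0" unfolding L_def using B(1) by (intro add_pos_nonneg sum_nonneg) (auto simp: less_imp_le)
  moreover have "norm (frechet_derivative f (at x) h) \<le> L * norm h" for x h
  proof -
    have "norm (frechet_derivative f (at x) h) \<le> (\<Sum>i\<in>UNIV. \<bar>h $ i\<bar> * norm (partial i f x))"
      unfolding frechet_derivative_eq_sum_partial[OF test_fun_differentiable[OF assms]]
      by (rule sum_norm_le) simp
    also have "\<dots> \<le> (\<Sum>i\<in>UNIV. norm h * B i)"
      by (intro sum_mono mult_mono B component_le_norm_cart) auto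
    also have "\<dots> = (\<Sum>i\<in>UNIV. B i) * norm h"
      by (subst sum_distrib_right) (simp add: mult.commute)
    also have "\<dots> \<le> L * norm h"
      unfolding L_def by (simp add: distrib_right)
    finally show ?thesis .
  qed
  ultimately show ?thesis using that by blast
qed

lemma test_fun_lipschitz:
  assumes "test_fun \<Omega> f" obtains L where "L > 0" "\<And>x y. norm (f x - f y) \<le> L * norm (x - y)"
proof -
  obtain L where L: "L > 0" "\<And>x h. norm (frechet_derivative f (at x) h) \<le> L * norm h"
    using test_fun_frechet_derivative_bounded[OF assms] by metis
  have "norm (f x - f y) \<le> L * norm (x - y)" for x y
    by (rule differentiable_bound[where S=UNIV and f'="\<lambda>x. frechet_derivative f (at x)"])
       (use test_fun_has_derivative[OF assms] L in \<open>auto intro!: onorm_le\<close>)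
  then show ?thesis using L(1) that by blast
qed

subsection \<open>A smooth bump function\<close>

text \<open>Differentiation maps the linear span of these functions into itself.\<close>
definition flat_exp :: "nat \<Rightarrow> real \<Rightarrow> real" where
  "flat_exp p t = (if t > 0 then exp (- (1/t)) / t ^ p else 0)"

lemma DERIV_flat_exp:
  "(flat_exp p has_real_derivative (flat_exp (p + 2) t - of_nat p * flat_exp (p + 1) t)) (at t)"
proof -
  let ?D = "flat_exp (p + 2) t - of_nat p * flat_exp (p + 1) t"
  consider (pos) "t > 0" | (neg) "t < 0" | (zero) "t = 0" by linarith
  then show ?thesis
  proof cases
    case pos
    then have "((\<lambda>t. exp (- (1/t)) / t ^ p) has_real_derivative ?D) (at t)"
      by (auto intro!: derivative_eq_intros simp: flat_exp_def) (cases p; simp add: field_simps power2_eq_square)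
    then show ?thesis
      by (rule DERIV_cong_ev[THEN iffD1, rotated 3])
         (use pos in \<open>auto simp: flat_exp_def eventually_nhds intro!: exI[of _ "{0<..}"]\<close>)
  next
    case neg
    then have "((\<lambda>t. 0) has_real_derivative ?D) (at t)"
      by (auto simp: flat_exp_def)
    then show ?thesis
      by (rule DERIV_cong_ev[THEN iffD1, rotated 3])
         (use neg in \<open>auto simp: flat_exp_def eventually_nhds intro!: exI[of _ "{..<0}"]\<close>)
  next
    case zero
    have "((\<lambda>h. (flat_exp p (0 + h) - flat_exp p 0) / h) \<longlongrightarrow> 0) (at 0)"
    proof (rule filterlim_split_at)
      have "\<forall>\<^sub>F h in at_left 0. 0 = (flat_exp p (0 + h) - flat_exp p 0) / h"
        unfolding eventually_at_filter by (intro always_eventually) (auto simp: flat_exp_def)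
      then show "((\<lambda>h. (flat_exp p (0 + h) - flat_exp p 0) / h) \<longlongrightarrow> 0) (at_left 0)"
        by (rule Lim_transform_eventually[OF tendsto_const])
      have "((\<lambda>h::real. exp (- (1/h)) / h ^ p / h) \<longlongrightarrow> 0) (at_right 0)" by real_asymp
      moreover have "\<forall>\<^sub>F h in at_right 0. exp (- (1/h)) / h ^ p / h = (flat_exp p (0 + h) - flat_exp p 0) / h"
        using eventually_at_right_less[of "0::real"] by eventually_elim (auto simp: flat_exp_def)
      ultimately show "((\<lambda>h. (flat_exp p (0 + h) - flat_exp p 0) / h) \<longlongrightarrow> 0) (at_right 0)"
        by (rule Lim_transform_eventually)
    qed
    then show ?thesis using zero by (simp add: DERIV_def) (simp add: flat_exp_def)
  qed
qed

definition bump :: "'a::euclidean_space \<Rightarrow> real" where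
  "bump x = flat_exp 0 (1 - x \<bullet> x)"

lemma bump_nonneg [simp]: "0 \<le> bump x"
  by (simp add: bump_def flat_exp_def)

lemma bump_eq_0_iff [simp]: "bump x = 0 \<longleftrightarrow> 1 \<le> norm x"
  by (auto simp: bump_def flat_exp_def dot_square_norm power_less_one_iff abs_square_less_1)

lemma smooth_on_bump: "smooth_on UNIV bump"
proof -
  have "Ck m UNIV (\<lambda>x::'a::euclidean_space. flat_exp p (1 - x \<bullet> x))" for m p
  proof (induction m arbitrary: p)
    case 0
    have "isCont (flat_exp p) t" for t using DERIV_flat_exp DERIV_isCont by blast
    then have "continuous_on UNIV (flat_exp p)" by (simp add: continuous_at_imp_continuous_on)
    then show ?case
      using continuous_on_compose2[of UNIV "flat_exp p" UNIV "\<lambda>x. 1 - x \<bullet> x"] by (simp add: continuous_intros)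
  next
    case (Suc m)
    let ?D = "\<lambda>x::'a. flat_exp (p + 2) (1 - x \<bullet> x) - of_nat p * flat_exp (p + 1) (1 - x \<bullet> x)"
    show ?case
    proof (rule Ck_SucI)
      fix x :: 'a
      have "((\<lambda>x. 1 - x \<bullet> x) has_derivative (\<lambda>h. - 2 * (x \<bullet> h))) (at x)"
        by (auto intro!: derivative_eq_intros simp: inner_commute)
      then show "((\<lambda>x. flat_exp p (1 - x \<bullet> x)) has_derivative (\<lambda>h. ?D x * (- 2 * (x \<bullet> h)))) (at x)"
        using has_derivative_compose[OF _ DERIV_flat_exp[unfolded has_field_derivative_def]] by blast
    next
      show "Ck m UNIV (\<lambda>x::'a. ?D x * (- 2 * (x \<bullet> v)))" for v
        using Suc.IH by (intro Ck_mult Ck_diff Ck_const Ck_bounded_linear[OF bounded_linear_inner_left]) auto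
    qed simp
  qed
  then show ?thesis unfolding smooth_on_def bump_def[abs_def] by blast
qed

lemma test_fun_bump: "test_fun UNIV (\<lambda>x::real^'n::finite. of_real (bump x))"
proof (rule test_funI[where C="cball 0 1"])
  show "smooth_on UNIV (\<lambda>x::real^'n. complex_of_real (bump x))"
    using smooth_on_bump Ck_bounded_linear_compose[OF bounded_linear_of_real open_UNIV]
    unfolding smooth_on_def by blast
qed auto

section \<open>Square integrable functions\<close>

subsection \<open>Integration on Euclidean space\<close>

lemma nn_integral_lborel_affine:
  fixes f :: "'a::euclidean_space \<Rightarrow> ennreal"
  assumes "f \<in> borel_measurable borel" "c \<noteq> 0"
  shows "(\<integral>\<^sup>+x. f x \<partial>lborel) = ennreal (\<bar>c\<bar> ^ DIM('a)) * (\<integral>\<^sup>+x. f (t + c *\<^sub>R x) \<partial>lborel)"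
  using assms(1)
  by (subst lborel_affine[OF assms(2), of t])
     (simp add: nn_integral_density nn_integral_distr nn_integral_cmult)

lemma integral_lborel_affine:
  fixes f :: "'a::euclidean_space \<Rightarrow> 'b::{banach,second_countable_topology}"
  assumes [measurable]: "f \<in> borel_measurable borel" and nonzero: "c \<noteq> 0"
  shows "(\<integral>x. f x \<partial>lborel) = (\<bar>c\<bar> ^ DIM('a)) *\<^sub>R (\<integral>x. f (t + c *\<^sub>R x) \<partial>lborel)"
  by (subst lborel_affine[OF nonzero, of t])
     (simp add: integral_density integral_distr)

lemma integral_lborel_reflect:
  fixes f :: "'a::euclidean_space \<Rightarrow> 'b::{banach,second_countable_topology}"
  assumes "f \<in> borel_measurable borel"
  shows "(\<integral>y. f (x - y) \<partial>lborel) = (\<integral>y. f y \<partial>lborel)"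
  using integral_lborel_affine[OF assms, of "-1" x] by simp

lemma integrable_lborel_reflect:
  fixes f :: "'a::euclidean_space \<Rightarrow> 'b::{banach,second_countable_topology}"
  assumes f: "integrable lborel f"
  shows "integrable lborel (\<lambda>y. f (x - y))"
proof (rule integrableI_bounded)
  have [measurable]: "f \<in> borel_measurable borel" using f by auto
  show "(\<lambda>y. f (x - y)) \<in> borel_measurable lborel" by measurable
  have "(\<integral>\<^sup>+y. norm (f (x - y)) \<partial>lborel) = (\<integral>\<^sup>+y. norm (f y) \<partial>lborel)"
    using nn_integral_lborel_affine[of "\<lambda>y. norm (f y)" "-1" x] by simp
  then show "(\<integral>\<^sup>+y. norm (f (x - y)) \<partial>lborel) < \<infinity>"
    using f by (simp add: integrable_iff_bounded)
qed

lemma integrable_lborel_indicator_bounded: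
  assumes "bounded (A :: 'a::euclidean_space set)" "A \<in> sets borel"
  shows "integrable lborel (indicator A :: 'a \<Rightarrow> real)"
  using assms emeasure_bounded_finite[OF assms(1)] by (intro integrable_real_indicator) auto

lemma integral_dominated_convergence_at:
  fixes s :: "'a::first_countable_topology \<Rightarrow> 'b \<Rightarrow> 'c::{banach,second_countable_topology}"
  assumes "f \<in> borel_measurable M" "\<And>y. s y \<in> borel_measurable M" "integrable M w"
    and "AE \<omega> in M. ((\<lambda>y. s y \<omega>) \<longlongrightarrow> f \<omega>) (at x)" "\<And>y. AE \<omega> in M. norm (s y \<omega>) \<le> w \<omega>"
  shows "((\<lambda>y. \<integral>\<omega>. s y \<omega> \<partial>M) \<longlongrightarrow> (\<integral>\<omega>. f \<omega> \<partial>M)) (at x)"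
  unfolding tendsto_at_iff_sequentially comp_def
proof (intro allI impI)
  fix Y :: "nat \<Rightarrow> 'a" assume Y: "\<forall>i. Y i \<in> UNIV - {x}" "Y \<longlonglongrightarrow> x"
  show "(\<lambda>i. \<integral>\<omega>. s (Y i) \<omega> \<partial>M) \<longlonglongrightarrow> (\<integral>\<omega>. f \<omega> \<partial>M)"
  proof (rule integral_dominated_convergence[OF assms(1,2,3) _ assms(5)])
    show "AE \<omega> in M. (\<lambda>i. s (Y i) \<omega>) \<longlonglongrightarrow> f \<omega>"
      using assms(4) by eventually_elim (use Y in \<open>auto simp: tendsto_at_iff_sequentially comp_def\<close>)
  qed
qed

lemma bounded_linear_integral:
  fixes L :: "'b \<Rightarrow> 'a::real_normed_vector \<Rightarrow> 'c::{banach,second_countable_topology}"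
  assumes lin: "\<And>\<omega>. linear (L \<omega>)" and int: "\<And>h. integrable M (\<lambda>\<omega>. L \<omega> h)"
    and bound: "\<And>\<omega> h. norm (L \<omega> h) \<le> g \<omega> * norm h" and g: "integrable M g"
  shows "bounded_linear (\<lambda>h. \<integral>\<omega>. L \<omega> h \<partial>M)"
proof (rule bounded_linear_intro[where K="\<integral>\<omega>. g \<omega> \<partial>M"])
  show "(\<integral>\<omega>. L \<omega> (h + k) \<partial>M) = (\<integral>\<omega>. L \<omega> h \<partial>M) + (\<integral>\<omega>. L \<omega> k \<partial>M)" for h k
    by (simp add: linear_add[OF lin] int)
  show "(\<integral>\<omega>. L \<omega> (r *\<^sub>R h) \<partial>M) = r *\<^sub>R (\<integral>\<omega>. L \<omega> h \<partial>M)" for r h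
    by (simp add: linear_scale[OF lin])
  have "norm (\<integral>\<omega>. L \<omega> h \<partial>M) \<le> (\<integral>\<omega>. g \<omega> * norm h \<partial>M)" for h
    by (intro order_trans[OF integral_norm_bound integral_mono] integrable_norm int integrable_mult_left g bound)
  then show "norm (\<integral>\<omega>. L \<omega> h \<partial>M) \<le> norm h * (\<integral>\<omega>. g \<omega> \<partial>M)" for h
    by (simp add: mult.commute)
qed

theorem has_derivative_integral:
  fixes f :: "'a::euclidean_space \<Rightarrow> 'b \<Rightarrow> 'c::{banach,second_countable_topology}"
  assumes int: "\<And>x. integrable M (f x)"
    and der: "\<And>x \<omega>. ((\<lambda>x. f x \<omega>) has_derivative f' x \<omega>) (at x)"
    and bound: "\<And>x \<omega> h. norm (f' x \<omega> h) \<le> g \<omega> * norm h"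
    and g: "integrable M g"
    and meas: "\<And>x h. (\<lambda>\<omega>. f' x \<omega> h) \<in> borel_measurable M"
  shows "((\<lambda>x. \<integral>\<omega>. f x \<omega> \<partial>M) has_derivative (\<lambda>h. \<integral>\<omega>. f' x \<omega> h \<partial>M)) (at x)"
  unfolding has_derivative_iff_norm
proof
  have int': "integrable M (\<lambda>\<omega>. f' x \<omega> h)" for x h
    by (rule Bochner_Integration.integrable_bound[OF integrable_mult_left[OF g, of "norm h"] meas])
       (use bound in \<open>auto intro: order_trans[OF bound] abs_ge_self\<close>)
  show "bounded_linear (\<lambda>h. \<integral>\<omega>. f' x \<omega> h \<partial>M)"
    by (rule bounded_linear_integral[OF has_derivative_linear[OF der] int' bound g])
  define rem where "rem y \<omega> = norm (f y \<omega> - f x \<omega> - f' x \<omega> (y - x)) / norm (y - x)" for y \<omega>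
  have lipschitz: "norm (f y \<omega> - f x \<omega>) \<le> g \<omega> * norm (y - x)" for y \<omega>
    by (rule differentiable_bound[where S=UNIV and f'="\<lambda>x. f' x \<omega>"])
       (use der bound in \<open>auto intro!: onorm_le\<close>)
  have "norm (f y \<omega> - f x \<omega> - f' x \<omega> (y - x)) \<le> g \<omega> * norm (y - x) + g \<omega> * norm (y - x)" for y \<omega>
    by (rule norm_triangle_le_diff[OF add_mono[OF lipschitz bound]])
  then have rem_le: "norm (rem y \<omega>) \<le> 2 * g \<omega>" if "y \<noteq> x" for y \<omega>
    using that by (simp add: rem_def divide_le_eq mult.assoc)
  have "0 \<le> g \<omega>" for \<omega>
    using order_trans[OF norm_ge_zero bound[of x \<omega> "SOME i. i \<in> Basis"]] nonempty_Basis
    by (simp add: some_in_eq norm_Basis)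
  then have "norm (rem y \<omega>) \<le> 2 * g \<omega>" for y \<omega>
    using rem_le by (cases "y = x") (auto simp: rem_def)
  then have "((\<lambda>y. \<integral>\<omega>. rem y \<omega> \<partial>M) \<longlongrightarrow> (\<integral>\<omega>. 0 \<partial>M)) (at x)"
    using der[of _ x] int[THEN borel_measurable_integrable] meas g
    by (intro integral_dominated_convergence_at[where w="\<lambda>\<omega>. 2 * g \<omega>"])
       (auto simp: rem_def has_derivative_iff_norm intro!: borel_measurable_divide borel_measurable_norm
           borel_measurable_diff)
  then have rem_0: "((\<lambda>y. \<integral>\<omega>. rem y \<omega> \<partial>M) \<longlongrightarrow> 0) (at x)" by simp
  have "norm ((\<integral>\<omega>. f y \<omega> \<partial>M) - (\<integral>\<omega>. f x \<omega> \<partial>M) - (\<integral>\<omega>. f' x \<omega> (y - x) \<partial>M)) / norm (y - x) \<le> (\<integral>\<omega>. rem y \<omega> \<partial>M)" for y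
  proof -
    have "norm ((\<integral>\<omega>. f y \<omega> \<partial>M) - (\<integral>\<omega>. f x \<omega> \<partial>M) - (\<integral>\<omega>. f' x \<omega> (y - x) \<partial>M))
        = norm (\<integral>\<omega>. (f y \<omega> - f x \<omega> - f' x \<omega> (y - x)) \<partial>M)"
      by (simp add: int int')
    also have "\<dots> \<le> (\<integral>\<omega>. norm (f y \<omega> - f x \<omega> - f' x \<omega> (y - x)) \<partial>M)"
      by (rule integral_norm_bound)
    finally show ?thesis by (simp add: rem_def divide_right_mono)
  qed
  then show "((\<lambda>y. norm ((\<integral>\<omega>. f y \<omega> \<partial>M) - (\<integral>\<omega>. f x \<omega> \<partial>M) - (\<integral>\<omega>. f' x \<omega> (y - x) \<partial>M)) / norm (y - x)) \<longlongrightarrow> 0) (at x)"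
    by (intro tendsto_sandwich[OF _ _ tendsto_const rem_0] always_eventually) auto
qed

lemma continuous_on_AE_eq_imp_eq:
  fixes f g :: "'a::euclidean_space \<Rightarrow> 'b::real_normed_vector"
  assumes "open U" "continuous_on U f" "continuous_on U g" "AE x in lebesgue. x \<in> U \<longrightarrow> f x = g x" "x \<in> U"
  shows "f x = g x"
proof -
  have "open (U \<inter> (\<lambda>x. f x - g x) -` (- {0}))"
    by (rule continuous_open_preimage[OF continuous_on_diff[OF assms(2,3)] assms(1)]) auto
  moreover have "U \<inter> (\<lambda>x. f x - g x) -` (- {0}) = {x. \<not> (x \<in> U \<longrightarrow> f x = g x)}" by auto
  ultimately have open_diff: "open {x. \<not> (x \<in> U \<longrightarrow> f x = g x)}" by simp
  then have "{x. \<not> (x \<in> U \<longrightarrow> f x = g x)} \<in> sets lebesgue" by (simp add: borel_open)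
  then have "negligible {x. \<not> (x \<in> U \<longrightarrow> f x = g x)}"
    using assms(4) AE_iff_null[of lebesgue "\<lambda>x. x \<in> U \<longrightarrow> f x = g x"] by (simp add: negligible_iff_null_sets)
  then show ?thesis using open_not_negligible[OF open_diff] assms(5) by auto
qed

lemma AE_open_local:
  fixes U :: "'a::second_countable_topology set"
  assumes "\<And>x. x \<in> U \<Longrightarrow> \<exists>V. open V \<and> x \<in> V \<and> (AE y in M. y \<in> V \<longrightarrow> P y)"
  shows "AE y in M. y \<in> U \<longrightarrow> P y"
proof -
  obtain V where V: "\<And>x. x \<in> U \<Longrightarrow> open (V x) \<and> x \<in> V x \<and> (AE y in M. y \<in> V x \<longrightarrow> P y)"
    using assms by metis
  obtain C where C: "C \<subseteq> V ` U" "countable C" "\<Union>C = \<Union>(V ` U)"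
    using Lindelof[of "V ` U"] V by blast
  have "AE y in M. \<forall>W\<in>C. y \<in> W \<longrightarrow> P y"
    using C(1,2) V by (subst AE_ball_countable) auto
  then show ?thesis
  proof eventually_elim
    case (elim y)
    have "y \<in> \<Union>C" if "y \<in> U" using that V C(3) by blast
    then show ?case using elim by blast
  qed
qed

subsection \<open>The space \<open>L\<^sup>2\<close>\<close>

definition square_integrable :: "'a measure \<Rightarrow> ('a \<Rightarrow> 'b::{second_countable_topology,real_normed_vector}) \<Rightarrow> bool"
    where
  "square_integrable M f \<longleftrightarrow> f \<in> borel_measurable M \<and> integrable M (\<lambda>x. (norm (f x))\<^sup>2)"

definition L2sq :: "'a measure \<Rightarrow> ('a \<Rightarrow> 'b::real_normed_vector) \<Rightarrow> real" where
  "L2sq M f = (\<integral>x. (norm (f x))\<^sup>2 \<partial>M)"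

lemma square_integrableD:
  assumes "square_integrable M f"
  shows "f \<in> borel_measurable M" "integrable M (\<lambda>x. (norm (f x))\<^sup>2)"
  using assms by (auto simp: square_integrable_def)

lemma L2sq_nonneg [simp]: "0 \<le> L2sq M f"
  by (simp add: L2sq_def)

lemma L2sq_minus_commute: "L2sq M (\<lambda>x. f x - g x) = L2sq M (\<lambda>x. g x - f x)"
  by (simp add: L2sq_def norm_minus_commute)

lemma L2sq_cnj [simp]: "L2sq M (\<lambda>x. cnj (f x)) = L2sq M f"
  by (simp add: L2sq_def)

lemma square_integrable_dominated:
  fixes f :: "'a \<Rightarrow> 'b::{second_countable_topology,real_normed_vector}"
    and g :: "'a \<Rightarrow> 'c::{second_countable_topology,real_normed_vector}"
  assumes f: "square_integrable M f" and g: "g \<in> borel_measurable M" and dominated: "\<And>x. norm (g x) \<le> B * norm (f x)"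
  shows "square_integrable M g" "L2sq M g \<le> B\<^sup>2 * L2sq M f"
proof -
  have sq_le: "(norm (g x))\<^sup>2 \<le> B\<^sup>2 * (norm (f x))\<^sup>2" for x
    using power_mono[OF dominated norm_ge_zero, of x 2] by (simp add: power_mult_distrib)
  have int_f: "integrable M (\<lambda>x. B\<^sup>2 * (norm (f x))\<^sup>2)" using square_integrableD[OF f] by simp
  then have int_g: "integrable M (\<lambda>x. (norm (g x))\<^sup>2)"
    by (rule Bochner_Integration.integrable_bound) (use g sq_le in auto)
  then show "square_integrable M g" using g by (simp add: square_integrable_def)
  have "L2sq M g \<le> (\<integral>x. B\<^sup>2 * (norm (f x))\<^sup>2 \<partial>M)"
    unfolding L2sq_def by (rule integral_mono[OF int_g int_f sq_le])
  then show "L2sq M g \<le> B\<^sup>2 * L2sq M f" by (simp add: L2sq_def)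
qed

lemma norm_add_square_le:
  "(norm (a + b :: 'a::real_normed_vector))\<^sup>2 \<le> 2 * (norm a)\<^sup>2 + 2 * (norm b)\<^sup>2"
proof -
  have "(norm (a + b))\<^sup>2 \<le> (norm a + norm b)\<^sup>2"
    by (intro power_mono norm_triangle_ineq) auto
  also have "\<dots> \<le> 2 * (norm a)\<^sup>2 + 2 * (norm b)\<^sup>2"
    using sum_squares_bound[of "norm a" "norm b"] by (simp add: power2_sum)
  finally show ?thesis .
qed

lemma square_integrable_add:
  assumes "square_integrable M f" "square_integrable M g"
  shows "square_integrable M (\<lambda>x. f x + g x)" "L2sq M (\<lambda>x. f x + g x) \<le> 2 * L2sq M f + 2 * L2sq M g"
proof -
  note D = square_integrableD[OF assms(1)] square_integrableD[OF assms(2)]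
  have int_sum: "integrable M (\<lambda>x. 2 * (norm (f x))\<^sup>2 + 2 * (norm (g x))\<^sup>2)" using D by simp
  then have int: "integrable M (\<lambda>x. (norm (f x + g x))\<^sup>2)"
    by (rule Bochner_Integration.integrable_bound) (use D norm_add_square_le in auto)
  then show "square_integrable M (\<lambda>x. f x + g x)" using D by (simp add: square_integrable_def)
  have "L2sq M (\<lambda>x. f x + g x) \<le> (\<integral>x. 2 * (norm (f x))\<^sup>2 + 2 * (norm (g x))\<^sup>2 \<partial>M)"
    unfolding L2sq_def by (rule integral_mono[OF int int_sum norm_add_square_le])
  then show "L2sq M (\<lambda>x. f x + g x) \<le> 2 * L2sq M f + 2 * L2sq M g"
    using D by (simp add: L2sq_def)
qed

lemma square_integrable_minus: "square_integrable M f \<Longrightarrow> square_integrable M (\<lambda>x. - f x)"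
  by (simp add: square_integrable_def)

lemma square_integrable_diff:
  assumes "square_integrable M f" "square_integrable M g"
  shows "square_integrable M (\<lambda>x. f x - g x)" "L2sq M (\<lambda>x. f x - g x) \<le> 2 * L2sq M f + 2 * L2sq M g"
  using square_integrable_add[OF assms(1) square_integrable_minus[OF assms(2)]] by (simp_all add: L2sq_def)

lemma square_integrable_cmult:
  fixes f :: "'a \<Rightarrow> 'b::{second_countable_topology,real_normed_algebra}"
  assumes "square_integrable M f" shows "square_integrable M (\<lambda>x. c * f x)"
  using assms square_integrableD(1)[OF assms]
  by (intro square_integrable_dominated(1)[OF assms, where B="norm c"]) (auto intro: norm_mult_ineq)

lemma L2sq_cmult:
  fixes f :: "'a \<Rightarrow> 'b::real_normed_div_algebra"
  shows "L2sq M (\<lambda>x. c * f x) = (norm c)\<^sup>2 * L2sq M f"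
  by (simp add: L2sq_def norm_mult power_mult_distrib)

theorem L2_Cauchy_Schwarz:
  fixes f g :: "'a \<Rightarrow> 'b::{second_countable_topology,real_normed_algebra,banach}"
  assumes f: "square_integrable M f" and g: "square_integrable M g"
  shows "norm (\<integral>x. f x * g x \<partial>M) \<le> sqrt (L2sq M f) * sqrt (L2sq M g)"
proof -
  note [measurable] = square_integrableD(1)[OF f] square_integrableD(1)[OF g]
  have L2: "(\<integral>\<^sup>+x. (ennreal (norm (h x)))\<^sup>2 \<partial>M) = ennreal (L2sq M h)" if "square_integrable M h" for h :: "'a \<Rightarrow> 'b"
    using square_integrableD[OF that] by (simp add: ennreal_power nn_integral_eq_integral L2sq_def)
  have "ennreal (norm (\<integral>x. f x * g x \<partial>M)) \<le> (\<integral>\<^sup>+x. norm (f x * g x) \<partial>M)"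
  proof (cases "integrable M (\<lambda>x. f x * g x)")
    case True
    then show ?thesis by (rule integral_norm_bound_ennreal)
  qed (simp add: not_integrable_integral_eq)
  also have "\<dots> \<le> (\<integral>\<^sup>+x. ennreal (norm (f x)) * ennreal (norm (g x)) \<partial>M)"
    by (intro nn_integral_mono) (simp add: ennreal_mult[symmetric] norm_mult_ineq ennreal_leI)
  finally have "(ennreal (norm (\<integral>x. f x * g x \<partial>M)))\<^sup>2 \<le> (\<integral>\<^sup>+x. ennreal (norm (f x)) * ennreal (norm (g x)) \<partial>M)\<^sup>2"
    by (rule power_mono) simp
  also have "\<dots> \<le> ennreal (L2sq M f) * ennreal (L2sq M g)"
    unfolding L2[OF f, symmetric] L2[OF g, symmetric] by (rule Cauchy_Schwarz_nn_integral) measurable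
  finally have "(norm (\<integral>x. f x * g x \<partial>M))\<^sup>2 \<le> L2sq M f * L2sq M g"
    by (simp add: ennreal_power ennreal_mult[symmetric])
  then show ?thesis unfolding real_sqrt_mult[symmetric] by (rule real_le_rsqrt)
qed

lemma L2_weighted_Cauchy_Schwarz:
  fixes f g :: "'a \<Rightarrow> 'b::{second_countable_topology,real_normed_algebra,banach}"
  assumes "square_integrable M f" "square_integrable M g" "t > 0"
  shows "norm (\<integral>x. f x * g x \<partial>M) \<le> 1 / (2 * t) * L2sq M f + t / 2 * L2sq M g"
proof -
  have "0 \<le> (sqrt (L2sq M f) - t * sqrt (L2sq M g))\<^sup>2 / (2 * t)" using assms(3) by simp
  also have "\<dots> = 1 / (2 * t) * L2sq M f + t / 2 * L2sq M g - sqrt (L2sq M f) * sqrt (L2sq M g)"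
    using assms(3) by (simp add: power2_diff power_mult_distrib field_simps power2_eq_square)
  finally show ?thesis using L2_Cauchy_Schwarz[OF assms(1,2)] by simp
qed

lemma AE_eq_L2_limit:
  fixes f :: "nat \<Rightarrow> 'a \<Rightarrow> 'b::{second_countable_topology,real_normed_vector}"
  assumes int: "\<And>n. square_integrable M (\<lambda>x. f n x - g x)"
    and lim: "(\<lambda>n. L2sq M (\<lambda>x. f n x - g x)) \<longlonglongrightarrow> 0" and pointwise: "AE x in M. (\<lambda>n. f n x) \<longlonglongrightarrow> h x"
  shows "AE x in M. h x = g x"
proof -
  let ?d = "\<lambda>n x. ennreal ((norm (f n x - g x))\<^sup>2)"
  have [measurable]: "?d n \<in> borel_measurable M" for n using square_integrableD[OF int] by measurable
  have "(\<integral>\<^sup>+x. liminf (\<lambda>n. ?d n x) \<partial>M) \<le> liminf (\<lambda>n. \<integral>\<^sup>+x. ?d n x \<partial>M)"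
    by (rule nn_integral_liminf) measurable
  also have "(\<lambda>n. \<integral>\<^sup>+x. ?d n x \<partial>M) = (\<lambda>n. ennreal (L2sq M (\<lambda>x. f n x - g x)))"
    using square_integrableD[OF int] by (simp add: nn_integral_eq_integral L2sq_def)
  also have "liminf \<dots> = ennreal 0"
    by (rule lim_imp_Liminf[OF _ tendsto_ennrealI[OF lim]]) simp
  finally have "AE x in M. liminf (\<lambda>n. ?d n x) = 0"
    by (simp add: nn_integral_0_iff_AE)
  with pointwise show ?thesis
  proof eventually_elim
    case (elim x)
    have "liminf (\<lambda>n. ?d n x) = ennreal ((norm (h x - g x))\<^sup>2)"
      by (intro lim_imp_Liminf tendsto_ennrealI tendsto_intros elim(1)) simp
    then show ?case using elim(2) by simp
  qed
qed

subsection \<open>Compactly supported square integrable functions\<close>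

definition L2c :: "('a::euclidean_space \<Rightarrow> 'b::{second_countable_topology,real_normed_vector}) \<Rightarrow> bool" where
  "L2c w \<longleftrightarrow> square_integrable lborel w \<and> bounded {x. w x \<noteq> 0}"

lemma L2cD:
  assumes "L2c w"
  shows "square_integrable lborel w" "w \<in> borel_measurable borel" "bounded {x. w x \<noteq> 0}"
  using assms by (auto simp: L2c_def square_integrable_def)

lemma L2c_dominated:
  assumes "L2c f" "g \<in> borel_measurable borel" "\<And>x. norm (g x) \<le> B * norm (f x)"
  shows "L2c g" "L2sq lborel g \<le> B\<^sup>2 * L2sq lborel f"
proof -
  have "{x. g x \<noteq> 0} \<subseteq> {x. f x \<noteq> 0}"
  proof
    fix x assume "x \<in> {x. g x \<noteq> 0}"
    then show "x \<in> {x. f x \<noteq> 0}" using assms(3)[of x] by (cases "f x = 0") auto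
  qed
  then have "bounded {x. g x \<noteq> 0}" using L2cD(3)[OF assms(1)] bounded_subset by blast
  then show "L2c g" "L2sq lborel g \<le> B\<^sup>2 * L2sq lborel f"
    using square_integrable_dominated[OF L2cD(1)[OF assms(1)] _ assms(3)] assms(2) by (auto simp: L2c_def)
qed

lemma L2c_add:
  assumes "L2c f" "L2c g" shows "L2c (\<lambda>x. f x + g x)"
  unfolding L2c_def
proof
  show "bounded {x. f x + g x \<noteq> 0}"
    by (rule bounded_subset[of "{x. f x \<noteq> 0} \<union> {x. g x \<noteq> 0}"]) (use assms in \<open>auto simp: L2c_def\<close>)
qed (use assms in \<open>simp add: L2c_def square_integrable_add\<close>)

lemma L2c_diff:
  assumes "L2c f" "L2c g" shows "L2c (\<lambda>x. f x - g x)"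
  using L2c_add[OF assms(1), of "\<lambda>x. - g x"] assms(2) by (simp add: L2c_def square_integrable_minus)

lemma L2c_integrable:
  fixes w :: "'a::euclidean_space \<Rightarrow> 'b::{second_countable_topology,banach}"
  assumes "L2c w" shows "integrable lborel w"
proof -
  obtain R where R: "{x. w x \<noteq> 0} \<subseteq> cball 0 R"
    using bounded_support_cball[OF L2cD(3)[OF assms]] by metis
  have "norm (w x) \<le> norm (indicator (cball 0 R) x + (norm (w x))\<^sup>2)" for x
    using sum_squares_bound[of 1 "norm (w x)"] norm_ge_zero[of "w x"] R
    by (cases "w x = 0") (auto simp: indicator_def power2_eq_square simp del: norm_ge_zero)
  moreover have int: "integrable lborel (\<lambda>x. indicator (cball 0 R) x + (norm (w x))\<^sup>2)"
    by (intro Bochner_Integration.integrable_add integrable_lborel_indicator_bounded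
        square_integrableD(2)[OF L2cD(1)[OF assms]]) simp_all
  ultimately show ?thesis
    by (intro Bochner_Integration.integrable_bound[OF int]) (simp_all add: L2cD(2)[OF assms])
qed

lemma L2c_of_bounded:
  fixes f :: "'a::euclidean_space \<Rightarrow> 'b::{second_countable_topology,real_normed_vector}"
  assumes "f \<in> borel_measurable borel" "\<And>x. norm (f x) \<le> B" "{x. f x \<noteq> 0} \<subseteq> A" "bounded A" "A \<in> sets borel"
  shows "L2c f" "L2sq lborel f \<le> B\<^sup>2 * measure lborel A"
proof -
  have "integrable lborel (indicator A :: 'a \<Rightarrow> real)"
    by (rule integrable_lborel_indicator_bounded[OF assms(4,5)])
  moreover have indicator_square: "(norm (indicator A x :: real))\<^sup>2 = indicator A x" for x
    by (simp add: indicator_def)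
  moreover have "{x. indicator A x \<noteq> (0::real)} = A" by (auto simp: indicator_def)
  ultimately have "L2c (indicator A :: 'a \<Rightarrow> real)"
    using assms(4,5) by (simp only: L2c_def square_integrable_def) simp
  moreover have "norm (f x) \<le> B * norm (indicator A x :: real)" for x
    using assms(2,3) by (cases "f x = 0") (auto simp: indicator_def intro: order_trans[OF norm_ge_zero])
  ultimately show "L2c f" "L2sq lborel f \<le> B\<^sup>2 * measure lborel A"
    using L2c_dominated[of "indicator A :: 'a \<Rightarrow> real" f B] assms(1,5)
    by (auto simp: L2sq_def indicator_square simp del: real_norm_def)
qed

lemma continuous_compact_support_L2c:
  fixes g :: "'a::euclidean_space \<Rightarrow> 'b::{second_countable_topology,real_normed_vector}"
  assumes "continuous_on UNIV g" "bounded {x. g x \<noteq> 0}"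
  shows "L2c g"
proof -
  obtain R where R: "{x. g x \<noteq> 0} \<subseteq> cball 0 R" using bounded_support_cball[OF assms(2)] by metis
  obtain B where B: "\<And>x. norm (g x) \<le> B"
    using compact_support_bounded[OF continuous_on_subset[OF assms(1)] compact_cball R] by auto
  show ?thesis using L2c_of_bounded(1)[OF borel_measurable_continuous_onI[OF assms(1)] B R] by simp
qed

lemma test_fun_L2c:
  assumes "test_fun UNIV f" shows "L2c f"
  by (rule continuous_compact_support_L2c[OF test_fun_continuous_on[OF assms]])
     (use assms in \<open>simp add: test_fun_UNIV_iff\<close>)

lemma test_fun_integrable: "test_fun UNIV f \<Longrightarrow> integrable lborel f"
  using test_fun_L2c L2c_integrable by blast

lemma L2c_test_fun_mult:
  assumes "test_fun UNIV a" "L2c w" shows "L2c (\<lambda>x. a x * w x)"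
proof -
  obtain B where B: "\<And>x. norm (a x) \<le> B" using test_fun_bounded[OF assms(1)] by metis
  show ?thesis
  proof (rule L2c_dominated(1)[OF assms(2)])
    show "(\<lambda>x. a x * w x) \<in> borel_measurable borel"
      using test_fun_measurable[OF assms(1)] L2cD(2)[OF assms(2)] by measurable
    show "norm (a x * w x) \<le> B * norm (w x)" for x unfolding norm_mult by (intro mult_right_mono B) simp
  qed
qed

lemma L2sq_test_fun_mult:
  assumes "test_fun UNIV a"
  obtains C where "C \<ge> 0" "\<And>w. L2c w \<Longrightarrow> L2sq lborel (\<lambda>x. a x * w x) \<le> C * L2sq lborel w"
proof -
  obtain B where B: "\<And>x. norm (a x) \<le> B" using test_fun_bounded[OF assms] by metis
  have "L2sq lborel (\<lambda>x. a x * w x) \<le> B\<^sup>2 * L2sq lborel w" if w: "L2c w" for w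
  proof (rule L2c_dominated(2)[OF w L2cD(2)[OF L2c_test_fun_mult[OF assms w]]])
    show "norm (a x * w x) \<le> B * norm (w x)" for x unfolding norm_mult by (intro mult_right_mono B) simp
  qed
  then show ?thesis using that[of "B\<^sup>2"] by simp
qed

subsection \<open>Approximation by continuous functions\<close>

lemma AE_limit_of_bounded_continuous:
  fixes w :: "'a::euclidean_space \<Rightarrow> 'b::euclidean_space"
  assumes w: "w \<in> borel_measurable borel" and C: "\<And>x. norm (w x) \<le> C" and R: "{x. w x \<noteq> 0} \<subseteq> cball 0 R"
  obtains h where "\<And>n. continuous_on UNIV (h n)" "\<And>n. {x. h n x \<noteq> 0} \<subseteq> cball 0 (R + 1)"
    "\<And>n x. norm (h n x) \<le> C" "AE x in lborel. (\<lambda>n. h n x) \<longlonglongrightarrow> w x"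
proof -
  have "C \<ge> 0" using order_trans[OF norm_ge_zero C] .
  define T :: "'b \<Rightarrow> 'b" where "T = closest_point (cball 0 C)"
  have T_le: "norm (T z) \<le> C" and T_id: "norm z \<le> C \<Longrightarrow> T z = z" for z
    using closest_point_in_set[of "cball 0 C" z] closest_point_self[of z "cball 0 C"] \<open>C \<ge> 0\<close> by (auto simp: T_def)
  have T_cont: "continuous_on UNIV T"
    unfolding T_def using \<open>C \<ge> 0\<close> by (intro continuous_on_closest_point) auto
  define \<theta> where "\<theta> x = max 0 (min 1 (R + 1 - norm x))" for x :: 'a
  have \<theta>: "0 \<le> \<theta> x" "\<theta> x \<le> 1" "norm x \<le> R \<Longrightarrow> \<theta> x = 1" "R + 1 < norm x \<Longrightarrow> \<theta> x = 0" for x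
    by (auto simp: \<theta>_def)
  obtain N g where N: "negligible N" and g_cont: "\<And>n. continuous_on UNIV (g n)"
    and g_lim: "\<And>x. x \<notin> N \<Longrightarrow> (\<lambda>n. g n x) \<longlonglongrightarrow> w x"
  proof -
    have "w \<in> borel_measurable (lebesgue_on UNIV)"
      using w by (simp add: lebesgue_on_UNIV_eq measurable_completion)
    then have "w measurable_on UNIV" by (simp add: measurable_on_iff_borel_measurable)
    then show ?thesis using that unfolding measurable_on_def by auto
  qed
  define h where "h n x = \<theta> x *\<^sub>R T (g n x)" for n x
  have h_cont: "continuous_on UNIV (h n)" for n
    unfolding h_def[abs_def] \<theta>_def
    by (intro continuous_intros continuous_on_compose2[OF T_cont g_cont]) auto
  have h_support: "{x. h n x \<noteq> 0} \<subseteq> cball 0 (R + 1)" for n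
    using \<theta>(4) by (force simp: h_def)
  have h_le: "norm (h n x) \<le> C" for n x
    using mult_mono[OF \<theta>(2)[of x] T_le[of "g n x"]] \<theta>(1)[of x] by (simp add: h_def)
  have h_lim: "(\<lambda>n. h n x) \<longlonglongrightarrow> w x" if "x \<notin> N" for x
  proof -
    have "isCont T (w x)" using T_cont continuous_on_eq_continuous_at by blast
    from isCont_tendsto_compose[OF this g_lim[OF that]]
    have "(\<lambda>n. h n x) \<longlonglongrightarrow> \<theta> x *\<^sub>R T (w x)" unfolding h_def by (rule tendsto_scaleR[OF tendsto_const])
    moreover have "\<theta> x *\<^sub>R T (w x) = w x" using R \<theta>(3)[of x] T_id[of "w x"] T_id[of 0] C[of x] \<open>C \<ge> 0\<close>
      by (cases "w x = 0") auto
    ultimately show ?thesis by simp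
  qed
  have "AE x in lborel. x \<notin> N"
    using AE_not_in[of N lebesgue] N by (simp add: negligible_iff_null_sets AE_completion_iff)
  then have "AE x in lborel. (\<lambda>n. h n x) \<longlonglongrightarrow> w x" by eventually_elim (rule h_lim)
  then show ?thesis using that h_cont h_support h_le by blast
qed

lemma L2c_bounded_approx_continuous:
  fixes w :: "'a::euclidean_space \<Rightarrow> 'b::euclidean_space"
  assumes w: "L2c w" and C: "\<And>x. norm (w x) \<le> C" and \<eta>: "\<eta> > 0"
  obtains g where "continuous_on UNIV g" "bounded {x. g x \<noteq> 0}" "L2sq lborel (\<lambda>x. g x - w x) < \<eta>"
proof -
  obtain R where R: "{x. w x \<noteq> 0} \<subseteq> cball 0 R" using bounded_support_cball[OF L2cD(3)[OF w]] by metis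
  obtain h where h_cont: "\<And>n. continuous_on UNIV (h n)" and h_support: "\<And>n. {x. h n x \<noteq> 0} \<subseteq> cball 0 (R + 1)"
    and h_le: "\<And>n x. norm (h n x) \<le> C" and h_lim: "AE x in lborel. (\<lambda>n. h n x) \<longlonglongrightarrow> w x"
    using AE_limit_of_bounded_continuous[OF L2cD(2)[OF w] C R] by blast
  have "(\<lambda>n. \<integral>x. (norm (h n x - w x))\<^sup>2 \<partial>lborel) \<longlonglongrightarrow> (\<integral>x. 0 \<partial>(lborel :: 'a measure))"
  proof (rule integral_dominated_convergence[where w="\<lambda>x. (2 * C)\<^sup>2 * indicator (cball 0 (R+1)) x"])
    have [measurable]: "w \<in> borel_measurable borel" "\<And>n. h n \<in> borel_measurable borel"
      using L2cD(2)[OF w] borel_measurable_continuous_onI[OF h_cont] by auto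
    show "(\<lambda>x. (norm (h n x - w x))\<^sup>2) \<in> borel_measurable lborel" for n by measurable
    show "integrable lborel (\<lambda>x. (2 * C)\<^sup>2 * indicator (cball (0::'a) (R+1)) x)"
      by (intro integrable_mult_right integrable_lborel_indicator_bounded) auto
    have "norm (h n x - w x) \<le> 2 * C" for n x
      using norm_triangle_le_diff[OF add_mono[OF h_le C]] by simp
    then have "(norm (h n x - w x))\<^sup>2 \<le> (2 * C)\<^sup>2" for n x by (intro power_mono) auto
    moreover have "h n x - w x = 0" if "x \<notin> cball 0 (R + 1)" for n x
      using h_support[of n] R that by (cases "w x = 0") auto
    ultimately show "AE x in lborel. norm ((norm (h n x - w x))\<^sup>2) \<le> (2 * C)\<^sup>2 * indicator (cball 0 (R+1)) x" for n
      by (intro AE_I2) (auto simp: indicator_def)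
    show "AE x in lborel. (\<lambda>n. (norm (h n x - w x))\<^sup>2) \<longlonglongrightarrow> 0"
      using h_lim
    proof eventually_elim
      case (elim x)
      have "(\<lambda>n. norm (h n x - w x)) \<longlonglongrightarrow> 0" by (rule tendsto_norm_zero[OF LIM_zero[OF elim]])
      from tendsto_power[OF this, of 2] show ?case by simp
    qed
  qed auto
  then have "\<forall>\<^sub>F n in sequentially. L2sq lborel (\<lambda>x. h n x - w x) < \<eta>"
    unfolding L2sq_def using \<eta> by (intro order_tendstoD) auto
  then obtain n where "L2sq lborel (\<lambda>x. h n x - w x) < \<eta>" using eventually_happens by force
  then show ?thesis using that h_cont bounded_subset[OF bounded_cball h_support] by blast
qed

lemma L2c_approx_bounded:
  fixes w :: "'a::euclidean_space \<Rightarrow> 'b::euclidean_space"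
  assumes w: "L2c w" and \<eta>: "\<eta> > 0"
  obtains v C where "L2c v" "\<And>x. norm (v x) \<le> C" "L2sq lborel (\<lambda>x. v x - w x) < \<eta>"
proof -
  define v where "v i x = closest_point (cball 0 (real i)) (w x)" for i x
  have v_meas: "v i \<in> borel_measurable borel" for i
    unfolding v_def[abs_def]
    by (intro measurable_compose[OF L2cD(2)[OF w] borel_measurable_continuous_onI] continuous_on_closest_point) auto
  have dist_le: "norm (v i x - w x) \<le> 1 * norm (w x)" for i x
    using closest_point_le[of "cball 0 (real i)" 0 "w x"] by (simp add: v_def dist_norm norm_minus_commute)
  have lim: "(\<lambda>i. v i x - w x) \<longlonglongrightarrow> 0" for x
  proof (rule tendsto_eventually)
    obtain N :: nat where "norm (w x) \<le> real N" using real_arch_simple by metis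
    then show "\<forall>\<^sub>F i in sequentially. v i x - w x = 0"
      by (intro eventually_sequentiallyI[of N]) (simp add: v_def closest_point_self)
  qed
  have "(\<lambda>i. \<integral>x. (norm (v i x - w x))\<^sup>2 \<partial>lborel) \<longlonglongrightarrow> (\<integral>x. 0 \<partial>(lborel :: 'a measure))"
  proof (rule integral_dominated_convergence[where w="\<lambda>x. (norm (w x))\<^sup>2"])
    show "(\<lambda>x. (norm (v i x - w x))\<^sup>2) \<in> borel_measurable lborel" for i
      using v_meas L2cD(2)[OF w] by measurable
    show "AE x in lborel. norm ((norm (v i x - w x))\<^sup>2) \<le> (norm (w x))\<^sup>2" for i
      using dist_le by (simp add: power_mono)
    show "AE x in lborel. (\<lambda>i. (norm (v i x - w x))\<^sup>2) \<longlonglongrightarrow> 0"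
      using tendsto_power[OF tendsto_norm_zero[OF lim], where n=2] by simp
  qed (use square_integrableD[OF L2cD(1)[OF w]] in auto)
  then have "\<forall>\<^sub>F i in sequentially. L2sq lborel (\<lambda>x. v i x - w x) < \<eta>"
    unfolding L2sq_def using \<eta> by (intro order_tendstoD) auto
  then obtain i where "L2sq lborel (\<lambda>x. v i x - w x) < \<eta>" using eventually_happens by force
  moreover have "norm (v i x) \<le> real i" for x
    using closest_point_in_set[of "cball 0 (real i)" "w x"] by (simp add: v_def)
  moreover have "L2c (v i)"
  proof -
    have "L2c (\<lambda>x. v i x - w x)"
      using v_meas L2cD(2)[OF w] by (intro L2c_dominated(1)[OF w _ dist_le]) auto
    from L2c_add[OF this w] show ?thesis by simp
  qed
  ultimately show ?thesis using that by blast
qed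

theorem L2c_approx_continuous:
  fixes w :: "'a::euclidean_space \<Rightarrow> 'b::euclidean_space"
  assumes w: "L2c w" and \<eta>: "\<eta> > 0"
  obtains g where "continuous_on UNIV g" "bounded {x. g x \<noteq> 0}" "L2sq lborel (\<lambda>x. g x - w x) < \<eta>"
proof -
  have \<eta>4: "\<eta> / 4 > 0" using \<eta> by simp
  obtain v C where v: "L2c v" "\<And>x. norm (v x) \<le> C" "L2sq lborel (\<lambda>x. v x - w x) < \<eta> / 4"
    using L2c_approx_bounded[OF w \<eta>4] by metis
  obtain g where g: "continuous_on UNIV g" "bounded {x. g x \<noteq> 0}" "L2sq lborel (\<lambda>x. g x - v x) < \<eta> / 4"
    by (rule L2c_bounded_approx_continuous[OF v(1,2) \<eta>4])
  have "L2c g" by (rule continuous_compact_support_L2c[OF g(1,2)])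
  then have "L2sq lborel (\<lambda>x. (g x - v x) + (v x - w x))
      \<le> 2 * L2sq lborel (\<lambda>x. g x - v x) + 2 * L2sq lborel (\<lambda>x. v x - w x)"
    by (intro square_integrable_add L2cD(1) L2c_diff v(1) w)
  then show ?thesis using that g v(3) by simp
qed

section \<open>Convolution and mollification\<close>

subsection \<open>Convolution with a test function\<close>

definition conv :: "('a::euclidean_space \<Rightarrow> complex) \<Rightarrow> ('a \<Rightarrow> complex) \<Rightarrow> 'a \<Rightarrow> complex" where
  "conv k w x = (\<integral>y. k (x - y) * w y \<partial>lborel)"

lemma conv_integrable:
  assumes "test_fun UNIV k" "L2c w" shows "integrable lborel (\<lambda>y. k (x - y) * w y)"
proof -
  obtain B where B: "\<And>x. norm (k x) \<le> B" using test_fun_bounded[OF assms(1)] by metis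
  have "L2c (\<lambda>y. k (x - y) * w y)"
  proof (rule L2c_dominated(1)[OF assms(2)])
    show "(\<lambda>y. k (x - y) * w y) \<in> borel_measurable borel"
      using test_fun_measurable[OF assms(1)] L2cD(2)[OF assms(2)] by measurable
    show "norm (k (x - y) * w y) \<le> B * norm (w y)" for y
      unfolding norm_mult by (intro mult_right_mono B) simp
  qed
  then show ?thesis by (rule L2c_integrable)
qed

lemma conv_has_derivative:
  assumes k: "test_fun UNIV k" and w: "L2c w"
  shows "(conv k w has_derivative (\<lambda>h. \<Sum>i\<in>UNIV. h $ i *\<^sub>R conv (partial i k) w x)) (at x)"
proof -
  obtain L where L: "L > 0" "\<And>x h. norm (frechet_derivative k (at x) h) \<le> L * norm h"
    using test_fun_frechet_derivative_bounded[OF k] by metis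
  have int: "integrable lborel (\<lambda>y. partial i k (x - y) * w y)" for i x
    by (rule conv_integrable[OF test_fun_partial[OF k] w])
  have components: "frechet_derivative k (at (x - y)) h * w y
      = (\<Sum>i\<in>UNIV. h $ i *\<^sub>R (partial i k (x - y) * w y))" for x y h
    unfolding frechet_derivative_eq_sum_partial[OF test_fun_differentiable[OF k]] by (simp add: sum_distrib_right)
  have "((\<lambda>x. \<integral>y. k (x - y) * w y \<partial>lborel) has_derivative
      (\<lambda>h. \<integral>y. frechet_derivative k (at (x - y)) h * w y \<partial>lborel)) (at x)"
  proof (rule has_derivative_integral[where g="\<lambda>y. L * norm (w y)"])
    fix x y
    have "((\<lambda>x. k (-y + 1 *\<^sub>R x)) has_derivative (\<lambda>h. 1 *\<^sub>R frechet_derivative k (at (x - y)) h)) (at x)"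
      using test_fun_has_derivative[OF k, of "-y + 1 *\<^sub>R x"] by (intro has_derivative_affine_compose) simp
    then show "((\<lambda>x. k (x - y) * w y) has_derivative (\<lambda>h. frechet_derivative k (at (x - y)) h * w y)) (at x)"
      by (intro has_derivative_mult_left) simp
    fix h
    show "norm (frechet_derivative k (at (x - y)) h * w y) \<le> L * norm (w y) * norm h"
      using mult_right_mono[OF L(2)[of "x - y" h], of "norm (w y)"] by (simp add: norm_mult mult_ac)
    show "(\<lambda>y. frechet_derivative k (at (x - y)) h * w y) \<in> borel_measurable lborel"
      unfolding components
      by (intro borel_measurable_integrable Bochner_Integration.integrable_sum integrable_scaleR_right int)
  qed (use conv_integrable[OF k w] L2c_integrable[OF w] in auto)
  then show ?thesis
    unfolding components by (subst (asm) Bochner_Integration.integral_sum) (auto simp: int conv_def[abs_def])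
qed

lemma partial_conv:
  assumes "test_fun UNIV k" "L2c w"
  shows "partial i (conv k w) = conv (partial i k) w"
  using partial_eq_component[OF conv_has_derivative[OF assms]] by (rule ext)

lemma Ck_conv: "test_fun UNIV k \<Longrightarrow> L2c w \<Longrightarrow> Ck m UNIV (conv k w)"
proof (induction m arbitrary: k)
  case 0
  then show ?case
    by (auto intro!: continuous_at_imp_continuous_on has_derivative_continuous[OF conv_has_derivative])
next
  case (Suc m)
  show ?case
    by (rule Ck_SucI[OF open_UNIV conv_has_derivative[OF Suc.prems]])
       (intro Ck_sum Ck_bounded_linear_compose[OF bounded_linear_scaleR_right] Suc.IH test_fun_partial Suc.prems
           open_UNIV)
qed

lemma conv_nonzeroE:
  assumes "conv k w x \<noteq> 0" obtains y where "k (x - y) \<noteq> 0" "w y \<noteq> 0"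
proof (rule ccontr)
  assume "\<not> thesis"
  then have "(\<lambda>y. k (x - y) * w y) = (\<lambda>y. 0)" using that by (metis mult_eq_0_iff)
  then show False using assms by (simp add: conv_def)
qed

lemma test_fun_conv:
  assumes "test_fun UNIV k" "L2c w" shows "test_fun UNIV (conv k w)"
proof -
  have "bounded {x. k x \<noteq> 0}" using assms(1) by (simp add: test_fun_UNIV_iff)
  then obtain R where R: "{x. k x \<noteq> 0} \<subseteq> cball 0 R" by (rule bounded_support_cball)
  obtain R' where R': "{x. w x \<noteq> 0} \<subseteq> cball 0 R'" by (rule bounded_support_cball[OF L2cD(3)[OF assms(2)]])
  have "{x. conv k w x \<noteq> 0} \<subseteq> cball 0 (R + R')"
  proof
    fix x assume "x \<in> {x. conv k w x \<noteq> 0}"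
    then obtain y where "k (x - y) \<noteq> 0" "w y \<noteq> 0" using conv_nonzeroE by blast
    then have "norm (x - y) \<le> R" "norm y \<le> R'" using R R' by auto
    then show "x \<in> cball 0 (R + R')" using norm_triangle_ineq[of "x - y" y] by simp
  qed
  then show ?thesis
    unfolding test_fun_UNIV_iff smooth_on_def using Ck_conv[OF assms] bounded_subset bounded_cball by blast
qed

lemma conv_commute:
  assumes "test_fun UNIV k" "test_fun UNIV w"
  shows "conv k w = conv w k"
proof
  fix x
  note [measurable] = assms[THEN test_fun_measurable]
  have "conv w k x = (\<integral>y. (\<lambda>y. k y * w (x - y)) (x - y) \<partial>lborel)"
    unfolding conv_def by (subst integral_lborel_reflect) (auto simp: mult.commute)
  then show "conv k w x = conv w k x" by (simp add: conv_def)
qed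

lemma partial_conv_right:
  assumes "test_fun UNIV k" "test_fun UNIV w"
  shows "partial i (conv k w) = conv k (partial i w)"
  using conv_commute[OF assms] conv_commute[OF assms(1) test_fun_partial[OF assms(2)]]
    partial_conv[OF assms(2) test_fun_L2c[OF assms(1)]] by metis

lemma conv_add:
  assumes "test_fun UNIV k" "L2c v" "L2c w"
  shows "conv k (\<lambda>x. v x + w x) = (\<lambda>x. conv k v x + conv k w x)"
  using conv_integrable[OF assms(1,2)] conv_integrable[OF assms(1,3)]
  by (simp add: conv_def[abs_def] distrib_left)

lemma conv_diff:
  assumes "test_fun UNIV k" "L2c v" "L2c w"
  shows "conv k (\<lambda>x. v x - w x) = (\<lambda>x. conv k v x - conv k w x)"
  using conv_integrable[OF assms(1,2)] conv_integrable[OF assms(1,3)]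
  by (simp add: conv_def[abs_def] right_diff_distrib)

lemma nn_integral_kernel_square_le:
  fixes u :: "'a \<Rightarrow> ennreal"
  assumes [measurable]: "\<kappa> \<in> borel_measurable M" "u \<in> borel_measurable M"
  shows "(\<integral>\<^sup>+y. \<kappa> y * u y \<partial>M)\<^sup>2 \<le> (\<integral>\<^sup>+y. \<kappa> y \<partial>M) * (\<integral>\<^sup>+y. \<kappa> y * (u y)\<^sup>2 \<partial>M)"
  using Cauchy_Schwarz_nn_integral[of "\<lambda>_. 1" "density M \<kappa>" u]
  by (simp add: nn_integral_density emeasure_density flip: nn_integral_indicator cong: nn_integral_cong)

theorem Schur_L2_bound:
  fixes w :: "'a::euclidean_space \<Rightarrow> 'b::{second_countable_topology,real_normed_vector}"
    and v :: "'a \<Rightarrow> 'c::{second_countable_topology,real_normed_vector}"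
  assumes [measurable]: "\<kappa> \<in> borel_measurable borel" and kernel_bound: "(\<integral>\<^sup>+z. \<kappa> z \<partial>lborel) \<le> ennreal A" "A \<ge> 0"
    and w: "square_integrable lborel w" and [measurable]: "v \<in> borel_measurable borel"
    and dominated: "\<And>x. ennreal (norm (v x)) \<le> (\<integral>\<^sup>+y. \<kappa> (x - y) * ennreal (norm (w y)) \<partial>lborel)"
  shows "L2sq lborel v \<le> A\<^sup>2 * L2sq lborel w"
proof -
  have [measurable]: "w \<in> borel_measurable borel" using square_integrableD(1)[OF w] by simp
  let ?w2 = "\<lambda>y. ennreal ((norm (w y))\<^sup>2)"
  have mass: "(\<integral>\<^sup>+y. \<kappa> (x - y) \<partial>lborel) \<le> ennreal A" "(\<integral>\<^sup>+x. \<kappa> (x - y) \<partial>lborel) \<le> ennreal A" for x y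
    using kernel_bound nn_integral_lborel_affine[of \<kappa> "-1" x] nn_integral_lborel_affine[of \<kappa> 1 "-y"] by simp_all
  have pointwise: "ennreal ((norm (v x))\<^sup>2) \<le> ennreal A * (\<integral>\<^sup>+y. \<kappa> (x - y) * ?w2 y \<partial>lborel)" for x
  proof -
    have "ennreal ((norm (v x))\<^sup>2) \<le> (\<integral>\<^sup>+y. \<kappa> (x - y) * ennreal (norm (w y)) \<partial>lborel)\<^sup>2"
      using power_mono[OF dominated[of x], of 2] by (simp add: ennreal_power)
    also have "\<dots> \<le> (\<integral>\<^sup>+y. \<kappa> (x - y) \<partial>lborel) * (\<integral>\<^sup>+y. \<kappa> (x - y) * (ennreal (norm (w y)))\<^sup>2 \<partial>lborel)"
      by (rule nn_integral_kernel_square_le) measurable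
    also have "\<dots> \<le> ennreal A * (\<integral>\<^sup>+y. \<kappa> (x - y) * ?w2 y \<partial>lborel)"
      by (simp add: ennreal_power mult_right_mono mass)
    finally show ?thesis .
  qed
  have "(\<integral>\<^sup>+x. ennreal ((norm (v x))\<^sup>2) \<partial>lborel) \<le> (\<integral>\<^sup>+x. ennreal A * (\<integral>\<^sup>+y. \<kappa> (x - y) * ?w2 y \<partial>lborel) \<partial>lborel)"
    by (intro nn_integral_mono pointwise)
  also have "\<dots> = ennreal A * (\<integral>\<^sup>+x. (\<integral>\<^sup>+y. \<kappa> (x - y) * ?w2 y \<partial>lborel) \<partial>lborel)"
    by (intro nn_integral_cmult) measurable
  also have "(\<integral>\<^sup>+x. (\<integral>\<^sup>+y. \<kappa> (x - y) * ?w2 y \<partial>lborel) \<partial>lborel) = (\<integral>\<^sup>+y. (\<integral>\<^sup>+x. \<kappa> (x - y) * ?w2 y \<partial>lborel) \<partial>lborel)"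
    by (rule lborel_pair.Fubini'[symmetric]) measurable
  also have "\<dots> = (\<integral>\<^sup>+y. (\<integral>\<^sup>+x. \<kappa> (x - y) \<partial>lborel) * ?w2 y \<partial>lborel)"
    by (intro nn_integral_cong nn_integral_multc) measurable
  also have "\<dots> \<le> (\<integral>\<^sup>+y. ennreal A * ?w2 y \<partial>lborel)"
    by (intro nn_integral_mono mult_right_mono mass) auto
  also have "\<dots> = ennreal A * ennreal (L2sq lborel w)"
    using square_integrableD(2)[OF w] by (subst nn_integral_cmult) (auto simp: L2sq_def nn_integral_eq_integral)
  finally have "(\<integral>\<^sup>+x. ennreal ((norm (v x))\<^sup>2) \<partial>lborel) \<le> ennreal (A\<^sup>2 * L2sq lborel w)"
    using kernel_bound(2) by (simp add: mult_left_mono ennreal_mult[symmetric] power2_eq_square mult.assoc)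
  then show ?thesis
    by (simp add: L2sq_def integral_eq_nn_integral enn2real_leI)
qed

lemma L2sq_conv_le:
  assumes k: "test_fun UNIV k" and w: "L2c w"
  shows "L2sq lborel (conv k w) \<le> (\<integral>z. norm (k z) \<partial>lborel)\<^sup>2 * L2sq lborel w"
proof (rule Schur_L2_bound[where \<kappa>="\<lambda>z. ennreal (norm (k z))", OF _ _ _ L2cD(1)[OF w]])
  show "(\<lambda>z. ennreal (norm (k z))) \<in> borel_measurable borel" "conv k w \<in> borel_measurable borel"
    using test_fun_measurable[OF k] test_fun_measurable[OF test_fun_conv[OF k w]] by measurable
  show "(\<integral>\<^sup>+z. ennreal (norm (k z)) \<partial>lborel) \<le> ennreal (\<integral>z. norm (k z) \<partial>lborel)"
    using test_fun_integrable[OF k] by (simp add: nn_integral_eq_integral)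
  show "ennreal (norm (conv k w x)) \<le> (\<integral>\<^sup>+y. ennreal (norm (k (x - y))) * ennreal (norm (w y)) \<partial>lborel)" for x
    unfolding conv_def using integral_norm_bound_ennreal[OF conv_integrable[OF k w]]
    by (simp add: norm_mult ennreal_mult)
qed simp

subsection \<open>Integration by parts\<close>

text \<open>Near the origin, \<open>f * w\<close> is the constant \<open>\<integral>f\<close> if \<open>w\<close> is the indicator of a large ball; hence its
  derivative \<open>\<integral>\<partial>\<^sub>i f\<close> at the origin vanishes.\<close>
lemma integral_partial_eq_0:
  fixes f :: "real^'n::finite \<Rightarrow> complex"
  assumes f: "test_fun UNIV f" shows "(\<integral>x. partial i f x \<partial>lborel) = 0"
proof -
  have "bounded {x. f x \<noteq> 0}" using f by (simp add: test_fun_UNIV_iff)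
  then obtain R where R: "{x. f x \<noteq> 0} \<subseteq> cball 0 R" by (rule bounded_support_cball)
  define w :: "real^'n \<Rightarrow> complex" where "w = indicator (cball 0 (R + 1))"
  have w: "L2c w" unfolding w_def
    by (intro L2c_of_bounded(1)[where B=1 and A="cball 0 (R + 1)"]
        borel_measurable_indicator) (auto simp: indicator_def)
  have conv_eq: "conv g w x = (\<integral>y. g y \<partial>lborel)"
    if g: "test_fun UNIV g" "{x. g x \<noteq> 0} \<subseteq> cball 0 R" and x: "norm x < 1" for g x
  proof -
    have "g (x - y) * w y = g (x - y)" for y
    proof (cases "g (x - y) = 0")
      case False
      then have "norm (x - y) \<le> R" using g(2) by auto
      then have "norm y \<le> R + 1" using x norm_triangle_ineq4[of x "x - y"] by simp
      then show ?thesis by (simp add: w_def)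
    qed simp
    then show ?thesis
      unfolding conv_def using integral_lborel_reflect[OF test_fun_measurable[OF g(1)]] by (simp only:)
  qed
  have "partial i (conv f w) 0 = partial i (\<lambda>x. \<integral>y. f y \<partial>lborel) 0"
    by (rule partial_cong_open[of _ _ "ball 0 1"])
       (auto simp: conv_eq[OF f R] intro: differentiableI[OF conv_has_derivative[OF f w]])
  moreover have "partial i (conv f w) 0 = (\<integral>x. partial i f x \<partial>lborel)"
    unfolding partial_conv[OF f w]
    using support_partial closure_minimal[OF R] by (intro conv_eq test_fun_partial f) (auto intro: order_trans)
  ultimately show ?thesis by simp
qed

theorem integral_by_parts:
  assumes f: "test_fun UNIV f" and g: "test_fun UNIV g"
  shows "(\<integral>x. partial i f x * g x \<partial>lborel) = - (\<integral>x. f x * partial i g x \<partial>lborel)"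
proof -
  have int: "integrable lborel (\<lambda>x. partial i f x * g x)" "integrable lborel (\<lambda>x. f x * partial i g x)"
    using f g by (auto intro!: test_fun_integrable test_fun_mult test_fun_partial)
  have "(\<integral>x. partial i f x * g x + f x * partial i g x \<partial>lborel) = 0"
    using integral_partial_eq_0[OF test_fun_mult[OF f g], of i] by (simp add: partial_mult_test_fun[OF f g])
  then show ?thesis using int by (simp add: eq_neg_iff_add_eq_0)
qed

subsection \<open>The standard mollifier\<close>

definition mollifier :: "real \<Rightarrow> 'a::euclidean_space \<Rightarrow> complex" where
  "mollifier e z = of_real (bump ((1/e) *\<^sub>R z) / (e ^ DIM('a) * (\<integral>x. bump (x::'a) \<partial>lborel)))"

lemma integrable_bump: "integrable lborel (bump :: 'a::euclidean_space \<Rightarrow> real)"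
proof -
  have "{x::'a. bump x \<noteq> 0} = ball 0 1" by auto
  then show ?thesis
    by (intro L2c_integrable continuous_compact_support_L2c smooth_on_continuous_on smooth_on_bump) simp
qed

lemma integral_bump_pos: "(\<integral>x. bump (x::'a::euclidean_space) \<partial>lborel) > 0"
proof -
  have "(\<integral>x. bump (x::'a) \<partial>lborel) \<noteq> 0"
  proof
    assume "(\<integral>x. bump (x::'a) \<partial>lborel) = 0"
    then have "AE x in lborel. bump (x::'a) = 0"
      using integral_nonneg_eq_0_iff_AE[OF integrable_bump] by auto
    from AE_completion[OF this] have "bump (0::'a) = 0"
      using smooth_on_continuous_on[OF smooth_on_bump]
      by (intro continuous_on_AE_eq_imp_eq[of UNIV bump "\<lambda>_. 0"]) auto
    then show False by simp
  qed
  moreover have "(\<integral>x. bump (x::'a) \<partial>lborel) \<ge> 0" by (intro integral_nonneg_AE) auto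
  ultimately show ?thesis by linarith
qed

lemma test_fun_mollifier: "e > 0 \<Longrightarrow> test_fun UNIV (mollifier e :: real^'n::finite \<Rightarrow> complex)"
  using test_fun_cmult[OF test_fun_affine[OF test_fun_bump, of "1/e" 0],
      of "of_real (1 / (e ^ DIM(real^'n) * (\<integral>x. bump (x::real^'n) \<partial>lborel)))"]
  unfolding mollifier_def[abs_def] by (simp add: field_simps)

lemma mollifier_support: "e > 0 \<Longrightarrow> mollifier e z \<noteq> 0 \<Longrightarrow> norm z < e"
  by (auto simp: mollifier_def not_le)

lemma of_real_norm_mollifier: "e > 0 \<Longrightarrow> of_real (norm (mollifier e (z::'a::euclidean_space))) = mollifier e z"
  using integral_bump_pos[where 'a='a] by (simp add: mollifier_def norm_divide norm_mult norm_power)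

lemma integral_mollifier:
  assumes e: "e > 0" shows "(\<integral>z. mollifier e (z::'a::euclidean_space) \<partial>lborel) = 1"
proof -
  have "bump \<in> borel_measurable (borel :: 'a measure)"
    using borel_measurable_integrable[OF integrable_bump] by simp
  then have "(\<integral>z. bump ((1/e) *\<^sub>R (z::'a)) \<partial>lborel) = e ^ DIM('a) * (\<integral>z. bump (z::'a) \<partial>lborel)"
    using integral_lborel_affine[of bump "1/e" "0::'a"] e by (simp add: field_simps power_divide)
  then have "(\<integral>z. bump ((1/e) *\<^sub>R (z::'a)) / (e ^ DIM('a) * (\<integral>x. bump (x::'a) \<partial>lborel)) \<partial>lborel) = 1"
    using e integral_bump_pos[where 'a='a] by simp
  then show ?thesis by (simp only: mollifier_def integral_complex_of_real of_real_1)
qed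

lemma integral_norm_mollifier:
  assumes e: "e > 0" shows "(\<integral>z. norm (mollifier e (z::'a::euclidean_space)) \<partial>lborel) = 1"
proof -
  have "complex_of_real (\<integral>z. norm (mollifier e (z::'a)) \<partial>lborel) = (\<integral>z. mollifier e (z::'a) \<partial>lborel)"
    by (simp only: integral_complex_of_real[symmetric] of_real_norm_mollifier[OF e])
  then show ?thesis using integral_mollifier[OF e, where 'a='a] by (metis of_real_eq_1_iff)
qed

lemma L2sq_conv_mollifier_le:
  assumes "e > 0" "L2c w"
  shows "L2sq lborel (conv (mollifier e) w) \<le> L2sq lborel (w :: real^'n::finite \<Rightarrow> complex)"
  using L2sq_conv_le[OF test_fun_mollifier[OF assms(1)] assms(2)]
      integral_norm_mollifier[OF assms(1), where 'a="real^'n"]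
  by simp

lemma support_conv_mollifier:
  assumes "e > 0" "{x. w x \<noteq> 0} \<subseteq> K"
  shows "{x. conv (mollifier e) w x \<noteq> 0} \<subseteq> {x + y |x y. x \<in> K \<and> y \<in> cball 0 e}"
proof
  fix x assume "x \<in> {x. conv (mollifier e) w x \<noteq> 0}"
  then obtain y where y: "mollifier e (x - y) \<noteq> 0" "w y \<noteq> 0" using conv_nonzeroE by blast
  then have "x - y \<in> cball 0 e" "y \<in> K" using mollifier_support[OF assms(1) y(1)] assms(2) by auto
  then show "x \<in> {x + y |x y. x \<in> K \<and> y \<in> cball 0 e}" by (intro CollectI exI[of _ y] exI[of _ "x - y"]) simp
qed

lemma compact_thickening_subset:
  fixes K :: "'a::real_normed_vector set"
  assumes "compact K" "open \<Omega>" "K \<subseteq> \<Omega>"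
  obtains \<delta> where "\<delta> > 0" "\<And>e. e < \<delta> \<Longrightarrow> {x + y |x y. x \<in> K \<and> y \<in> cball 0 e} \<subseteq> \<Omega>"
proof -
  obtain \<delta> where \<delta>: "\<delta> > 0" "(\<Union>x\<in>K. ball x \<delta>) \<subseteq> \<Omega>"
    using compact_subset_open_imp_ball_epsilon_subset[OF assms] by auto
  have "x + y \<in> \<Omega>" if "e < \<delta>" "x \<in> K" "y \<in> cball 0 e" for e x y
    using that by (intro subsetD[OF \<delta>(2)] UN_I[of x]) (auto simp: dist_norm)
  then show ?thesis using that[OF \<delta>(1)] by blast
qed

lemma eventually_test_fun_conv_mollifier:
  fixes \<psi> :: "real^'n::finite \<Rightarrow> complex"
  assumes \<psi>: "test_fun \<Omega> \<psi>" and "open \<Omega>"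
  shows "\<forall>\<^sub>F e in at_right 0. \<forall>u. L2c (\<lambda>x. \<psi> x * u x) \<longrightarrow> test_fun \<Omega> (conv (mollifier e) (\<lambda>x. \<psi> x * u x))"
proof -
  let ?K = "closure {x. \<psi> x \<noteq> 0}"
  have K: "compact ?K" "?K \<subseteq> \<Omega>" using \<psi> by (auto simp: test_fun_def)
  obtain \<delta> where \<delta>: "\<delta> > 0" "\<And>e. e < \<delta> \<Longrightarrow> {x + y |x y. x \<in> ?K \<and> y \<in> cball 0 e} \<subseteq> \<Omega>"
    by (rule compact_thickening_subset[OF K(1) assms(2) K(2)]) blast
  have "test_fun \<Omega> (conv (mollifier e) (\<lambda>x. \<psi> x * u x))" if e: "0 < e" "e < \<delta>" and u: "L2c (\<lambda>x. \<psi> x * u x)" for e u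
  proof (rule test_funI)
    show "smooth_on UNIV (conv (mollifier e) (\<lambda>x. \<psi> x * u x))"
      by (rule test_fun_smooth_on[OF test_fun_conv[OF test_fun_mollifier[OF e(1)] u]])
    show "{x. conv (mollifier e) (\<lambda>x. \<psi> x * u x) x \<noteq> 0} \<subseteq> {x + y |x y. x \<in> ?K \<and> y \<in> cball 0 e}"
      using in_closure_support[of \<psi>] by (intro support_conv_mollifier e) auto
    show "compact {x + y |x y. x \<in> ?K \<and> y \<in> cball 0 e}" by (intro compact_sums K compact_cball)
  qed (rule \<delta>(2)[OF e(2)])
  moreover have "\<forall>\<^sub>F e in at_right 0. e \<in> {0<..<\<delta>}" by (rule eventually_at_right_real[OF \<delta>(1)])
  ultimately show ?thesis by (auto elim: eventually_mono)
qed

lemma cutoff_exists: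
  fixes K :: "(real^'n::finite) set"
  assumes "compact K" "open \<Omega>" "K \<subseteq> \<Omega>"
  obtains \<eta> where "test_fun \<Omega> \<eta>" "\<And>x. x \<in> K \<Longrightarrow> \<eta> x = 1"
proof -
  obtain \<delta> where \<delta>: "\<delta> > 0" "\<And>e. e < \<delta> \<Longrightarrow> {x + y |x y. x \<in> K \<and> y \<in> cball 0 e} \<subseteq> \<Omega>"
    by (rule compact_thickening_subset[OF assms]) blast
  define e where "e = \<delta> / 3"
  have e: "e > 0" "e + e < \<delta>" using \<delta>(1) by (auto simp: e_def)
  define C where "C = {x + y |x y. x \<in> K \<and> y \<in> cball 0 e}"
  have C: "compact C" unfolding C_def by (intro compact_sums assms compact_cball)
  define w :: "real^'n \<Rightarrow> complex" where "w = indicator C"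
  have w: "L2c w"
    unfolding w_def using compact_imp_bounded[OF C] compact_imp_closed[OF C]
    by (intro L2c_of_bounded(1)[where B=1 and A=C] borel_measurable_indicator) (auto simp: indicator_def)
  note mollifier = test_fun_mollifier[OF e(1), where 'n='n]
  have "test_fun \<Omega> (conv (mollifier e) w)"
  proof (rule test_funI)
    show "smooth_on UNIV (conv (mollifier e) w)" by (rule test_fun_smooth_on[OF test_fun_conv[OF mollifier w]])
    show "{x. conv (mollifier e) w x \<noteq> 0} \<subseteq> {x + y |x y. x \<in> C \<and> y \<in> cball 0 e}"
      by (intro support_conv_mollifier e) (auto simp: w_def indicator_def)
    show "compact {x + y |x y. x \<in> C \<and> y \<in> cball 0 e}" by (intro compact_sums C compact_cball)
    have "x + y + z \<in> {x + y |x y. x \<in> K \<and> y \<in> cball 0 (e + e)}" if "x \<in> K" "norm y \<le> e" "norm z \<le> e" for x y z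
      using that norm_triangle_mono[OF that(2,3)]
      by (intro CollectI exI[of _ x] exI[of _ "y + z"]) (simp add: add.assoc)
    then show "{x + y |x y. x \<in> C \<and> y \<in> cball 0 e} \<subseteq> \<Omega>"
      using \<delta>(2)[OF e(2)] unfolding C_def by fastforce
  qed
  moreover have "conv (mollifier e) w x = 1" if "x \<in> K" for x
  proof -
    have "mollifier e (x - y) * w y = mollifier e (x - y)" for y
    proof (cases "mollifier e (x - y) = 0")
      case False
      then have "norm (y - x) \<le> e" using mollifier_support[OF e(1)] by (force simp: norm_minus_commute)
      then have "y \<in> C" unfolding C_def using that by (intro CollectI exI[of _ x] exI[of _ "y - x"]) simp
      then show ?thesis by (simp add: w_def)
    qed simp
    then show ?thesis
      unfolding conv_def
      using integral_lborel_reflect[OF test_fun_measurable[OF mollifier]]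
          integral_mollifier[OF e(1), where 'a="real^'n"] by (simp only:)
  qed
  ultimately show ?thesis using that by blast
qed

subsection \<open>Convergence of mollifications\<close>

lemma norm_conv_mollifier_diff_le:
  fixes g :: "real^'n::finite \<Rightarrow> complex"
  assumes e: "e > 0" and g: "L2c g" and near: "\<And>y. norm (x - y) < e \<Longrightarrow> norm (g y - g x) \<le> q"
  shows "norm (conv (mollifier e) g x - g x) \<le> q"
proof -
  note mollifier = test_fun_mollifier[OF e, where 'n='n]
  have int: "integrable lborel (\<lambda>y. mollifier e (x - y))"
    by (rule integrable_lborel_reflect[OF test_fun_integrable[OF mollifier]])
  then have int_diff: "integrable lborel (\<lambda>y. mollifier e (x - y) * (g y - g x))"
    using conv_integrable[OF mollifier g] by (simp add: right_diff_distrib)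
  have "(\<integral>y. mollifier e (x - y) * g x \<partial>lborel) = g x"
    using integral_mollifier[OF e, where 'a="real^'n"] integral_lborel_reflect[OF test_fun_measurable[OF mollifier]]
    by simp
  then have "conv (mollifier e) g x - g x = (\<integral>y. mollifier e (x - y) * g y \<partial>lborel)
      - (\<integral>y. mollifier e (x - y) * g x \<partial>lborel)"
    by (simp add: conv_def)
  also have "\<dots> = (\<integral>y. mollifier e (x - y) * (g y - g x) \<partial>lborel)"
    using int conv_integrable[OF mollifier g] by (simp add: right_diff_distrib)
  finally have "norm (conv (mollifier e) g x - g x) \<le> (\<integral>y. norm (mollifier e (x - y) * (g y - g x)) \<partial>lborel)"
    using integral_norm_bound by metis
  also have "\<dots> \<le> (\<integral>y. norm (mollifier e (x - y)) * q \<partial>lborel)"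
  proof (rule integral_mono)
    show "integrable lborel (\<lambda>y. norm (mollifier e (x - y) * (g y - g x)))" using int_diff by (rule integrable_norm)
    show "integrable lborel (\<lambda>y. norm (mollifier e (x - y)) * q)" using int by simp
    show "norm (mollifier e (x - y) * (g y - g x)) \<le> norm (mollifier e (x - y)) * q" for y
      using near[of y] mollifier_support[OF e, of "x - y"]
      by (cases "mollifier e (x - y) = 0") (auto simp: norm_mult intro!: mult_left_mono)
  qed
  also have "\<dots> = q"
    using integral_norm_mollifier[OF e, where 'a="real^'n"] test_fun_measurable[OF mollifier]
      integral_lborel_reflect[of "\<lambda>z. norm (mollifier e (z::real^'n))" x] by simp
  finally show ?thesis .
qed

lemma compact_support_uniformly_continuous:
  fixes g :: "'a::euclidean_space \<Rightarrow> 'b::real_normed_vector"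
  assumes g: "continuous_on UNIV g" "bounded {x. g x \<noteq> 0}"
  shows "uniformly_continuous_on UNIV g"
  unfolding uniformly_continuous_on_def
proof (intro allI impI)
  fix q :: real assume q: "q > 0"
  obtain R where R: "{x. g x \<noteq> 0} \<subseteq> cball 0 R" using bounded_support_cball[OF g(2)] by metis
  have "uniformly_continuous_on (cball 0 (R + 1)) g"
    by (intro compact_uniformly_continuous continuous_on_subset[OF g(1)]) auto
  then obtain d where d: "d > 0"
    "\<And>x y. x \<in> cball 0 (R + 1) \<Longrightarrow> y \<in> cball 0 (R + 1) \<Longrightarrow> dist y x < d \<Longrightarrow> dist (g y) (g x) < q"
    unfolding uniformly_continuous_on_def using q by metis
  have "dist (g y) (g x) < q" if "dist y x < min d 1" for x y
  proof (cases "norm x \<le> R + 1 \<and> norm y \<le> R + 1")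
    case False
    then have "R < norm x \<and> R < norm y"
      using that norm_triangle_ineq[of x "y - x"] norm_triangle_ineq[of y "x - y"]
      by (auto simp: dist_norm norm_minus_commute)
    then have "g x = 0" "g y = 0" using R by auto
    then show ?thesis using q by simp
  qed (use d(2) that in auto)
  then show "\<exists>d>0. \<forall>x\<in>UNIV. \<forall>x'\<in>UNIV. dist x' x < d \<longrightarrow> dist (g x') (g x) < q"
    using d(1) by (intro exI[of _ "min d 1"]) auto
qed

lemma uniform_limit_conv_mollifier:
  fixes g :: "real^'n::finite \<Rightarrow> complex"
  assumes g: "continuous_on UNIV g" "bounded {x. g x \<noteq> 0}"
  shows "uniform_limit UNIV (\<lambda>e. conv (mollifier e) g) g (at_right 0)"
  unfolding uniform_limit_iff
proof (intro allI impI)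
  fix q :: real assume q: "q > 0"
  then obtain d where d: "d > 0" "\<And>x y. norm (x - y) < d \<Longrightarrow> norm (g y - g x) \<le> q / 2"
    using compact_support_uniformly_continuous[OF g] unfolding uniformly_continuous_on_def
    by (metis UNIV_I dist_norm half_gt_zero less_imp_le norm_minus_commute)
  have "\<forall>\<^sub>F e in at_right 0. e \<in> {0<..<d}" by (rule eventually_at_right_real[OF d(1)])
  then show "\<forall>\<^sub>F e in at_right 0. \<forall>x\<in>UNIV. dist (conv (mollifier e) g x) (g x) < q"
  proof eventually_elim
    case (elim e)
    have "norm (conv (mollifier e) g x - g x) \<le> q / 2" for x
      using elim d(2) by (intro norm_conv_mollifier_diff_le continuous_compact_support_L2c g) auto
    moreover have "q / 2 < q" using q by simp
    ultimately have "norm (conv (mollifier e) g x - g x) < q" for x by (rule le_less_trans)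
    then show ?case by (simp add: dist_norm)
  qed
qed

lemma L2_tendsto_conv_mollifier_continuous:
  fixes g :: "real^'n::finite \<Rightarrow> complex"
  assumes g: "continuous_on UNIV g" "bounded {x. g x \<noteq> 0}"
  shows "((\<lambda>e. L2sq lborel (\<lambda>x. conv (mollifier e) g x - g x)) \<longlongrightarrow> 0) (at_right 0)"
proof (rule tendstoI)
  fix \<eta> :: real assume \<eta>: "\<eta> > 0"
  obtain R where R: "{x. g x \<noteq> 0} \<subseteq> cball 0 R" using bounded_support_cball[OF g(2)] by metis
  define V where "V = measure lborel (cball (0::real^'n) (R + 1))"
  define q where "q = sqrt (\<eta> / (V + 1))"
  have "V \<ge> 0" by (simp add: V_def)
  then have q: "q > 0" "q\<^sup>2 * V < \<eta>" using \<eta> by (auto simp: q_def field_simps)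
  have L2c_g: "L2c g" by (rule continuous_compact_support_L2c[OF g])
  have "\<forall>\<^sub>F e in at_right 0. e \<in> {0<..<1::real}" by (rule eventually_at_right_real) simp
  moreover have "\<forall>\<^sub>F e in at_right 0. \<forall>x. dist (conv (mollifier e) g x) (g x) < q"
    using uniform_limit_conv_mollifier[OF g] q(1) by (simp add: uniform_limit_iff)
  ultimately show "\<forall>\<^sub>F e in at_right 0. dist (L2sq lborel (\<lambda>x. conv (mollifier e) g x - g x)) 0 < \<eta>"
  proof eventually_elim
    case (elim e)
    then have e: "e > 0" "e < 1" by auto
    have "L2sq lborel (\<lambda>x. conv (mollifier e) g x - g x) \<le> q\<^sup>2 * V"
      unfolding V_def
    proof (rule L2c_of_bounded(2))
      show "(\<lambda>x. conv (mollifier e) g x - g x) \<in> borel_measurable borel"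
        by (intro borel_measurable_diff L2cD(2) L2c_g
            test_fun_L2c[OF test_fun_conv[OF test_fun_mollifier[OF e(1)] L2c_g]])
      show "norm (conv (mollifier e) g x - g x) \<le> q" for x
        using elim(2) by (simp add: dist_norm less_imp_le)
      have "{x. conv (mollifier e) g x \<noteq> 0} \<subseteq> {x + y |x y. x \<in> cball 0 R \<and> y \<in> cball 0 e}"
        by (rule support_conv_mollifier[OF e(1) R])
      also have "\<dots> \<subseteq> cball 0 (R + 1)" using norm_triangle_mono e(2) by force
      finally have "{x. conv (mollifier e) g x \<noteq> 0} \<subseteq> cball 0 (R + 1)" .
      moreover have "{x. g x \<noteq> 0} \<subseteq> cball 0 (R + 1)" using R by auto
      moreover have "{x. conv (mollifier e) g x - g x \<noteq> 0} \<subseteq> {x. conv (mollifier e) g x \<noteq> 0} \<union> {x. g x \<noteq> 0}" by auto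
      ultimately show "{x. conv (mollifier e) g x - g x \<noteq> 0} \<subseteq> cball 0 (R + 1)" by blast
    qed auto
    then show ?case using q(2) by simp
  qed
qed

theorem L2_tendsto_conv_mollifier:
  fixes w :: "real^'n::finite \<Rightarrow> complex"
  assumes w: "L2c w"
  shows "((\<lambda>e. L2sq lborel (\<lambda>x. conv (mollifier e) w x - w x)) \<longlongrightarrow> 0) (at_right 0)"
proof (rule tendstoI)
  fix \<eta> :: real assume \<eta>: "\<eta> > 0"
  then have "\<eta> / 12 > 0" by simp
  from L2c_approx_continuous[OF w this] obtain g
    where g: "continuous_on UNIV g" "bounded {x. g x \<noteq> 0}" "L2sq lborel (\<lambda>x. g x - w x) < \<eta> / 12" by blast
  have L2c_g: "L2c g" by (rule continuous_compact_support_L2c[OF g(1,2)])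
  have "\<forall>\<^sub>F e in at_right 0. L2sq lborel (\<lambda>x. conv (mollifier e) g x - g x) < \<eta> / 8"
    using L2_tendsto_conv_mollifier_continuous[OF g(1,2)] \<eta> by (intro order_tendstoD) auto
  moreover have "\<forall>\<^sub>F e in at_right (0::real). e > 0" by (rule eventually_at_right_less)
  ultimately show "\<forall>\<^sub>F e in at_right 0. dist (L2sq lborel (\<lambda>x. conv (mollifier e) w x - w x)) 0 < \<eta>"
  proof eventually_elim
    case (elim e)
    note mollifier = test_fun_mollifier[OF elim(2), where 'n='n]
    let ?v = "\<lambda>x. w x - g x" and ?r = "\<lambda>x. (conv (mollifier e) g x - g x) + (g x - w x)"
    note L2c_conv = test_fun_L2c[OF test_fun_conv[OF mollifier]]
    have "L2sq lborel (conv (mollifier e) ?v) \<le> L2sq lborel ?v"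
      by (intro L2sq_conv_mollifier_le elim L2c_diff w L2c_g)
    then have v: "L2sq lborel (conv (mollifier e) ?v) < \<eta> / 12" using g(3) by (simp add: L2sq_minus_commute[of _ w])
    have "L2sq lborel ?r \<le> 2 * L2sq lborel (\<lambda>x. conv (mollifier e) g x - g x) + 2 * L2sq lborel (\<lambda>x. g x - w x)"
      by (intro square_integrable_add L2cD(1) L2c_diff L2c_conv L2c_g w)
    moreover have "L2sq lborel (\<lambda>x. conv (mollifier e) ?v x + ?r x)
        \<le> 2 * L2sq lborel (conv (mollifier e) ?v) + 2 * L2sq lborel ?r"
      by (intro square_integrable_add L2cD(1) L2c_add L2c_diff L2c_conv L2c_g w)
    moreover have "(\<lambda>x. conv (mollifier e) ?v x + ?r x) = (\<lambda>x. conv (mollifier e) w x - w x)"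
      by (simp add: conv_diff[OF mollifier w L2c_g])
    ultimately have "L2sq lborel (\<lambda>x. conv (mollifier e) w x - w x) < \<eta>" using v g(3) elim(1) by simp
    then show ?case by simp
  qed
qed

text \<open>Both orders of differentiation of \<open>k * f\<close> give \<open>\<partial>\<^sub>i k * \<partial>\<^sub>j f\<close>; let \<open>k\<close> run through the mollifiers.\<close>
theorem partial_commute:
  fixes f :: "real^'n::finite \<Rightarrow> complex"
  assumes f: "test_fun UNIV f"
  shows "partial i (partial j f) = partial j (partial i f)"
proof
  fix x
  let ?g = "\<lambda>x. partial i (partial j f) x - partial j (partial i f) x"
  have partials: "test_fun UNIV (partial i f)" "test_fun UNIV (partial j f)"
    "test_fun UNIV (partial i (partial j f))" "test_fun UNIV (partial j (partial i f))"
    by (intro test_fun_partial f)+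
  have g: "test_fun UNIV ?g" by (intro test_fun_diff partials)
  have conv_0: "conv k ?g = (\<lambda>x. 0)" if k: "test_fun UNIV k" for k
  proof -
    have "conv k (partial i (partial j f)) = conv (partial i k) (partial j f)"
      using partial_conv_right[OF k partials(2), of i] partial_conv[OF k test_fun_L2c[OF partials(2)], of i] by simp
    moreover have "conv k (partial j (partial i f)) = partial j (conv (partial i k) f)"
      using partial_conv_right[OF k partials(1), of j] partial_conv_right[OF k f, of i]
          partial_conv[OF k test_fun_L2c[OF f], of i]
      by simp
    moreover have "partial j (conv (partial i k) f) = conv (partial i k) (partial j f)"
      by (rule partial_conv_right[OF test_fun_partial[OF k] f])
    ultimately show ?thesis by (simp add: conv_diff[OF k test_fun_L2c[OF partials(3)] test_fun_L2c[OF partials(4)]])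
  qed
  have "uniform_limit UNIV (\<lambda>e. conv (mollifier e) ?g) ?g (at_right 0)"
    using g by (intro uniform_limit_conv_mollifier test_fun_continuous_on[OF g]) (simp add: test_fun_UNIV_iff)
  then have "((\<lambda>e. conv (mollifier e) ?g x) \<longlongrightarrow> ?g x) (at_right 0)" by (rule tendsto_uniform_limitI) simp
  moreover have "\<forall>\<^sub>F e in at_right 0. conv (mollifier e) ?g x = 0"
    using eventually_at_right_less[of "0::real"] by eventually_elim (simp add: conv_0[OF test_fun_mollifier])
  ultimately have "?g x = 0"
    by (rule tendsto_unique[OF trivial_limit_at_right_real _ tendsto_eventually])
  then show "partial i (partial j f) x = partial j (partial i f) x" by simp
qed

section \<open>Sobolev norms and Friedrichs commutators\<close>

subsection \<open>Sobolev norms of test functions\<close>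

fun sobolev_sq :: "nat \<Rightarrow> (real^'n::finite \<Rightarrow> complex) \<Rightarrow> real" where
  "sobolev_sq 0 v = L2sq lborel v"
| "sobolev_sq (Suc s) v = L2sq lborel v + (\<Sum>i\<in>UNIV. sobolev_sq s (partial i v))"

lemma sobolev_sq_nonneg [simp]: "0 \<le> sobolev_sq s v"
  by (induction s arbitrary: v) (auto intro!: add_nonneg_nonneg sum_nonneg)

lemma L2sq_le_sobolev_sq: "L2sq lborel v \<le> sobolev_sq s v"
  by (cases s) (auto intro: sum_nonneg)

lemma sobolev_sq_le_Suc: "sobolev_sq s v \<le> sobolev_sq (Suc s) v"
proof (induction s arbitrary: v)
  case 0
  then show ?case using L2sq_le_sobolev_sq[of v "Suc 0"] by simp
next
  case (Suc s)
  have "(\<Sum>i\<in>UNIV. sobolev_sq s (partial i v)) \<le> (\<Sum>i\<in>UNIV. sobolev_sq (Suc s) (partial i v))"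
    by (intro sum_mono Suc.IH)
  then show ?case by (simp only: sobolev_sq.simps add_le_cancel_left)
qed

lemma sobolev_sq_mono: "s \<le> t \<Longrightarrow> sobolev_sq s v \<le> sobolev_sq t v"
  using lift_Suc_mono_le[of "\<lambda>s. sobolev_sq s v", OF sobolev_sq_le_Suc] .

lemma sum_sobolev_sq_partial_le: "(\<Sum>i\<in>UNIV. sobolev_sq s (partial i v)) \<le> sobolev_sq (Suc s) v"
  by simp

lemma sobolev_sq_partial_le: "sobolev_sq s (partial i v) \<le> sobolev_sq (Suc s) v"
  using member_le_sum[of i UNIV "\<lambda>i. sobolev_sq s (partial i v)"] sum_sobolev_sq_partial_le[of s v]
  by (simp del: sobolev_sq.simps)

lemma sobolev_sq_add_le:
  "test_fun UNIV f \<Longrightarrow> test_fun UNIV g \<Longrightarrow> sobolev_sq s (\<lambda>x. f x + g x) \<le> 2 * sobolev_sq s f + 2 * sobolev_sq s g"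
proof (induction s arbitrary: f g)
  case 0
  then show ?case by (simp add: square_integrable_add L2cD(1)[OF test_fun_L2c])
next
  case (Suc s)
  have "(\<Sum>i\<in>UNIV. sobolev_sq s (partial i (\<lambda>x. f x + g x)))
      \<le> (\<Sum>i\<in>UNIV. 2 * sobolev_sq s (partial i f) + 2 * sobolev_sq s (partial i g))"
    unfolding partial_add_test_fun[OF Suc.prems] by (intro sum_mono Suc.IH test_fun_partial Suc.prems)
  then show ?case
    using square_integrable_add(2)[OF Suc.prems[THEN test_fun_L2c, THEN L2cD(1)]]
    by (simp add: sum.distrib sum_distrib_left[symmetric])
qed

lemma sobolev_sq_cmult:
  "test_fun UNIV f \<Longrightarrow> sobolev_sq s (\<lambda>x. c * f x) = (norm c)\<^sup>2 * sobolev_sq s f"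
proof (induction s arbitrary: f)
  case 0
  then show ?case by (simp add: L2sq_cmult)
next
  case (Suc s)
  then show ?case
    by (simp add: partial_cmult_test_fun test_fun_partial L2sq_cmult distrib_left sum_distrib_left)
qed

lemma sobolev_sq_diff_le:
  "test_fun UNIV f \<Longrightarrow> test_fun UNIV g \<Longrightarrow> sobolev_sq s (\<lambda>x. f x - g x) \<le> 2 * sobolev_sq s f + 2 * sobolev_sq s g"
  using sobolev_sq_add_le[of f "\<lambda>x. -1 * g x" s] sobolev_sq_cmult[of g s "-1"] test_fun_cmult[of UNIV g "-1"]
  by simp

lemma sobolev_sq_zero [simp]: "sobolev_sq s (\<lambda>x. 0) = 0"
  using sobolev_sq_cmult[OF test_fun_zero, of s 0] by simp

lemma sobolev_sq_sum_le:
  assumes "finite I" "\<And>i. i \<in> I \<Longrightarrow> test_fun UNIV (f i)"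
  shows "sobolev_sq s (\<lambda>x. \<Sum>i\<in>I. f i x) \<le> 2 ^ card I * (\<Sum>i\<in>I. sobolev_sq s (f i))"
  using assms
proof (induction I rule: finite_induct)
  case (insert a I)
  have "sobolev_sq s (\<lambda>x. f a x + (\<Sum>i\<in>I. f i x)) \<le> 2 * sobolev_sq s (f a) + 2 * sobolev_sq s (\<lambda>x. \<Sum>i\<in>I. f i x)"
    using insert.prems by (intro sobolev_sq_add_le test_fun_sum) auto
  also have "\<dots> \<le> 2 ^ Suc (card I) * sobolev_sq s (f a) + 2 * (2 ^ card I * (\<Sum>i\<in>I. sobolev_sq s (f i)))"
    using insert by (intro add_mono mult_right_mono mult_left_mono) auto
  also have "\<dots> = 2 ^ Suc (card I) * (sobolev_sq s (f a) + (\<Sum>i\<in>I. sobolev_sq s (f i)))"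
    by (simp add: distrib_left)
  finally show ?case using insert by simp
qed simp

subsection \<open>Operators bounded in Sobolev norms\<close>

definition sobolev_bound :: "((real^'n::finite \<Rightarrow> complex) \<Rightarrow> bool) \<Rightarrow> ((real^'n \<Rightarrow> complex) \<Rightarrow> real) \<Rightarrow> nat \<Rightarrow> real
    \<Rightarrow> ((real^'n \<Rightarrow> complex) \<Rightarrow> real^'n \<Rightarrow> complex) \<Rightarrow> bool" where
  "sobolev_bound X N s C T \<longleftrightarrow> C \<ge> 0 \<and> (\<forall>v. X v \<longrightarrow> test_fun UNIV (T v) \<and> sobolev_sq s (T v) \<le> C * N v)"

lemma sobolev_boundD:
  assumes "sobolev_bound X N s C T"
  shows "C \<ge> 0" "X v \<Longrightarrow> test_fun UNIV (T v)" "X v \<Longrightarrow> sobolev_sq s (T v) \<le> C * N v"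
  using assms by (auto simp: sobolev_bound_def)

lemma sobolev_bound_add:
  assumes "sobolev_bound X N s C T" "sobolev_bound X N s D U"
  shows "sobolev_bound X N s (2 * C + 2 * D) (\<lambda>v x. T v x + U v x)"
  unfolding sobolev_bound_def
proof (intro conjI allI impI)
  show "0 \<le> 2 * C + 2 * D" using assms[THEN sobolev_boundD(1)] by simp
  fix v assume v: "X v"
  note test_fun = assms[THEN sobolev_boundD(2), OF v] and bound = assms[THEN sobolev_boundD(3), OF v]
  show "test_fun UNIV (\<lambda>x. T v x + U v x)" by (rule test_fun_add[OF test_fun])
  have "sobolev_sq s (\<lambda>x. T v x + U v x) \<le> 2 * sobolev_sq s (T v) + 2 * sobolev_sq s (U v)"
    by (rule sobolev_sq_add_le[OF test_fun])
  also have "\<dots> \<le> 2 * (C * N v) + 2 * (D * N v)" using bound by simp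
  finally show "sobolev_sq s (\<lambda>x. T v x + U v x) \<le> (2 * C + 2 * D) * N v" by (simp add: algebra_simps)
qed

lemma sobolev_bound_compose:
  assumes "sobolev_bound X N s C T" "sobolev_bound (test_fun UNIV) (sobolev_sq s) t D U"
  shows "sobolev_bound X N t (D * C) (\<lambda>v. U (T v))"
  unfolding sobolev_bound_def
proof (intro conjI allI impI)
  show "0 \<le> D * C" using sobolev_boundD(1)[OF assms(1)] sobolev_boundD(1)[OF assms(2)] by simp
  fix v assume "X v"
  note T = sobolev_boundD(2,3)[OF assms(1) this]
  show "test_fun UNIV (U (T v))" by (rule sobolev_boundD(2)[OF assms(2) T(1)])
  show "sobolev_sq t (U (T v)) \<le> D * C * N v"
    using sobolev_boundD(3)[OF assms(2) T(1)] mult_left_mono[OF T(2) sobolev_boundD(1)[OF assms(2)]] by simp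
qed

lemma sobolev_bound_cmult:
  "sobolev_bound (test_fun UNIV) (sobolev_sq s) s ((norm c)\<^sup>2) (\<lambda>v x. c * v x)"
  by (simp add: sobolev_bound_def test_fun_cmult sobolev_sq_cmult)

lemma sobolev_bound_diff:
  assumes "sobolev_bound X N s C T" "sobolev_bound X N s D U"
  shows "sobolev_bound X N s (2 * C + 2 * D) (\<lambda>v x. T v x - U v x)"
  using sobolev_bound_add[OF assms(1) sobolev_bound_compose[OF assms(2) sobolev_bound_cmult[of s "-1"]]] by simp

lemma sobolev_bound_sum:
  assumes "finite I" "\<And>i. i \<in> I \<Longrightarrow> sobolev_bound X N s (C i) (T i)"
  shows "sobolev_bound X N s (2 ^ card I * (\<Sum>i\<in>I. C i)) (\<lambda>v x. \<Sum>i\<in>I. T i v x)"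
  unfolding sobolev_bound_def
proof (intro conjI allI impI)
  show "0 \<le> 2 ^ card I * (\<Sum>i\<in>I. C i)"
    using assms(2)[THEN sobolev_boundD(1)] by (intro mult_nonneg_nonneg sum_nonneg) auto
  fix v assume v: "X v"
  note T = assms(2)[THEN sobolev_boundD(2), OF _ v]
  show "test_fun UNIV (\<lambda>x. \<Sum>i\<in>I. T i v x)" by (rule test_fun_sum[OF T])
  have "sobolev_sq s (\<lambda>x. \<Sum>i\<in>I. T i v x) \<le> 2 ^ card I * (\<Sum>i\<in>I. sobolev_sq s (T i v))"
    by (rule sobolev_sq_sum_le[OF assms(1) T])
  also have "\<dots> \<le> 2 ^ card I * (\<Sum>i\<in>I. C i * N v)"
    using assms(2)[THEN sobolev_boundD(3), OF _ v] by (intro mult_left_mono sum_mono) auto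
  finally show "sobolev_sq s (\<lambda>x. \<Sum>i\<in>I. T i v x) \<le> 2 ^ card I * (\<Sum>i\<in>I. C i) * N v"
    by (simp add: sum_distrib_right mult.assoc)
qed

lemma sobolev_bound_L2c_imp_test_fun:
  "sobolev_bound L2c (L2sq lborel) s C T \<Longrightarrow> sobolev_bound (test_fun UNIV) (sobolev_sq 0) s C T"
  by (simp add: sobolev_bound_def test_fun_L2c)

lemma sobolev_bound_Suc:
  fixes T :: "(real^'n::finite \<Rightarrow> complex) \<Rightarrow> real^'n \<Rightarrow> complex"
  assumes "sobolev_bound (test_fun UNIV) (sobolev_sq 0) 0 C\<^sub>0 T"
    and "sobolev_bound (test_fun UNIV) (sobolev_sq s) s C T"
    and "\<And>i. sobolev_bound (test_fun UNIV) (sobolev_sq s) s (D i) (T' i)"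
    and leibniz: "\<And>i v. test_fun UNIV v \<Longrightarrow> partial i (T v) = (\<lambda>x. T' i v x + T (partial i v) x)"
  shows "sobolev_bound (test_fun UNIV) (sobolev_sq (Suc s)) (Suc s) (C\<^sub>0 + 2 * (\<Sum>i\<in>UNIV. D i) + 2 * C) T"
  unfolding sobolev_bound_def
proof (intro conjI allI impI)
  note nonneg = assms(1,2,3)[THEN sobolev_boundD(1)]
  show "0 \<le> C\<^sub>0 + 2 * (\<Sum>i\<in>UNIV. D i) + 2 * C" using nonneg by (simp add: sum_nonneg)
  fix v :: "real^'n \<Rightarrow> complex" assume v: "test_fun UNIV v"
  show "test_fun UNIV (T v)" by (rule sobolev_boundD(2)[OF assms(2) v])
  let ?S = "sobolev_sq (Suc s) v"
  have partial_le: "sobolev_sq s (partial i (T v))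
      \<le> 2 * (D i * sobolev_sq s v) + 2 * (C * sobolev_sq s (partial i v))" for i
  proof -
    have "sobolev_sq s (partial i (T v)) \<le> 2 * sobolev_sq s (T' i v) + 2 * sobolev_sq s (T (partial i v))"
      unfolding leibniz[OF v]
      by (intro sobolev_sq_add_le sobolev_boundD(2)[OF assms(2)] sobolev_boundD(2)[OF assms(3)] test_fun_partial v)
    also have "\<dots> \<le> 2 * (D i * sobolev_sq s v) + 2 * (C * sobolev_sq s (partial i v))"
      by (intro add_mono mult_left_mono sobolev_boundD(3)[OF assms(2)] sobolev_boundD(3)[OF assms(3)]
          test_fun_partial v)
        simp_all
    finally show ?thesis .
  qed
  have "(\<Sum>i\<in>UNIV. sobolev_sq s (partial i (T v)))
      \<le> (\<Sum>i\<in>UNIV. 2 * (D i * sobolev_sq s v) + 2 * (C * sobolev_sq s (partial i v)))"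
    by (intro sum_mono partial_le)
  also have "\<dots> = 2 * ((\<Sum>i\<in>UNIV. D i) * sobolev_sq s v) + 2 * (C * (\<Sum>i\<in>UNIV. sobolev_sq s (partial i v)))"
    by (simp add: sum.distrib sum_distrib_left sum_distrib_right)
  also have "\<dots> \<le> 2 * ((\<Sum>i\<in>UNIV. D i) * ?S) + 2 * (C * ?S)"
    by (intro add_mono mult_left_mono sobolev_sq_le_Suc sum_sobolev_sq_partial_le sum_nonneg nonneg) simp_all
  finally have "(\<Sum>i\<in>UNIV. sobolev_sq s (partial i (T v))) \<le> (2 * (\<Sum>i\<in>UNIV. D i) + 2 * C) * ?S"
    by (simp only: distrib_right mult.assoc)
  moreover have "L2sq lborel (T v) \<le> C\<^sub>0 * ?S"
    using order_trans[OF sobolev_boundD(3)[OF assms(1) v]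
        mult_left_mono[OF sobolev_sq_mono[of 0 "Suc s" v] nonneg(1)]]
    by (simp del: sobolev_sq.simps(2))
  ultimately have "L2sq lborel (T v) + (\<Sum>i\<in>UNIV. sobolev_sq s (partial i (T v)))
      \<le> C\<^sub>0 * ?S + (2 * (\<Sum>i\<in>UNIV. D i) + 2 * C) * ?S"
    by (rule add_mono[rotated])
  then show "sobolev_sq (Suc s) (T v) \<le> (C\<^sub>0 + 2 * (\<Sum>i\<in>UNIV. D i) + 2 * C) * ?S"
    by (simp only: sobolev_sq.simps(2)[of s "T v"] distrib_right add.assoc)
qed

declare sobolev_sq.simps(2) [simp del]

lemma sobolev_bound_partial: "sobolev_bound (test_fun UNIV) (sobolev_sq (Suc s)) s 1 (partial i)"
  by (simp add: sobolev_bound_def test_fun_partial sobolev_sq_partial_le)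

lemma sobolev_bound_0_mult:
  assumes "test_fun UNIV a"
  shows "\<exists>C. sobolev_bound (test_fun UNIV) (sobolev_sq 0) 0 C (\<lambda>v x. a x * v x)"
proof -
  obtain C where "C \<ge> 0" "\<And>w. L2c w \<Longrightarrow> L2sq lborel (\<lambda>x. a x * w x) \<le> C * L2sq lborel w"
    using L2sq_test_fun_mult[OF assms] by metis
  then have "sobolev_bound (test_fun UNIV) (sobolev_sq 0) 0 C (\<lambda>v x. a x * v x)"
    using test_fun_mult[OF assms] test_fun_L2c by (auto simp: sobolev_bound_def)
  then show ?thesis by blast
qed

lemma sobolev_bound_mult:
  "test_fun UNIV a \<Longrightarrow> \<exists>C. sobolev_bound (test_fun UNIV) (sobolev_sq s) s C (\<lambda>v x. a x * v x)"
proof (induction s arbitrary: a)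
  case 0
  then show ?case by (rule sobolev_bound_0_mult)
next
  case (Suc s)
  obtain C\<^sub>0 where "sobolev_bound (test_fun UNIV) (sobolev_sq 0) 0 C\<^sub>0 (\<lambda>v x. a x * v x)"
    using sobolev_bound_0_mult[OF Suc.prems] by blast
  moreover obtain C where "sobolev_bound (test_fun UNIV) (sobolev_sq s) s C (\<lambda>v x. a x * v x)"
    using Suc.IH[OF Suc.prems] by blast
  moreover obtain D where "\<And>i. sobolev_bound (test_fun UNIV) (sobolev_sq s) s (D i) (\<lambda>v x. partial i a x * v x)"
    using Suc.IH[OF test_fun_partial[OF Suc.prems]] by metis
  ultimately show ?case
    by (intro exI[of _ "C\<^sub>0 + 2 * (\<Sum>i\<in>UNIV. D i) + 2 * C"]
        sobolev_bound_Suc[OF _ _ _ partial_mult_test_fun[OF Suc.prems]])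
qed

lemma sobolev_bound_first_order:
  fixes b :: "'n::finite \<Rightarrow> real^'n \<Rightarrow> complex"
  assumes "\<And>\<nu>. test_fun UNIV (b \<nu>)"
  shows "\<exists>D. sobolev_bound (test_fun UNIV) (sobolev_sq (Suc s)) s D (\<lambda>v x. \<Sum>\<nu>\<in>UNIV. b \<nu> x * partial \<nu> v x)"
proof -
  obtain C where C: "\<And>\<nu>. sobolev_bound (test_fun UNIV) (sobolev_sq s) s (C \<nu>) (\<lambda>v x. b \<nu> x * v x)"
    using sobolev_bound_mult[OF assms] by metis
  show ?thesis
    by (rule exI, rule sobolev_bound_sum[OF finite]) (rule sobolev_bound_compose[OF sobolev_bound_partial C])
qed

lemma sobolev_bound_conv:
  "test_fun UNIV k \<Longrightarrow> \<exists>C. sobolev_bound L2c (L2sq lborel) s C (conv k)"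
proof (induction s arbitrary: k)
  case 0
  then show ?case
    using L2sq_conv_le test_fun_conv by (intro exI[of _ "(\<integral>z. norm (k z) \<partial>lborel)\<^sup>2"]) (auto simp: sobolev_bound_def)
next
  case (Suc s)
  obtain D where D: "\<And>i. sobolev_bound L2c (L2sq lborel) s (D i) (conv (partial i k))"
    using Suc.IH[OF test_fun_partial[OF Suc.prems]] by metis
  let ?C = "(\<integral>z. norm (k z) \<partial>lborel)\<^sup>2"
  have "sobolev_sq (Suc s) (conv k w) \<le> (?C + (\<Sum>i\<in>UNIV. D i)) * L2sq lborel w" if w: "L2c w" for w
  proof -
    have "(\<Sum>i\<in>UNIV. sobolev_sq s (partial i (conv k w))) \<le> (\<Sum>i\<in>UNIV. D i * L2sq lborel w)"
      unfolding partial_conv[OF Suc.prems w] by (intro sum_mono sobolev_boundD(3)[OF D] w)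
    then show ?thesis
      using L2sq_conv_le[OF Suc.prems w] by (simp add: sobolev_sq.simps(2) distrib_right sum_distrib_right)
  qed
  moreover have "?C + (\<Sum>i\<in>UNIV. D i) \<ge> 0" using sobolev_boundD(1)[OF D] by (simp add: sum_nonneg)
  ultimately have "sobolev_bound L2c (L2sq lborel) (Suc s) (?C + (\<Sum>i\<in>UNIV. D i)) (conv k)"
    using test_fun_conv[OF Suc.prems] by (simp add: sobolev_bound_def)
  then show ?case by blast
qed

lemma sobolev_bound_precompose_mult:
  assumes T: "sobolev_bound L2c (L2sq lborel) s C T" and a: "test_fun UNIV a"
  shows "\<exists>D. sobolev_bound L2c (L2sq lborel) s D (\<lambda>w. T (\<lambda>y. a y * w y))"
proof -
  obtain A where A: "A \<ge> 0" "\<And>w. L2c w \<Longrightarrow> L2sq lborel (\<lambda>x. a x * w x) \<le> A * L2sq lborel w"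
    using L2sq_test_fun_mult[OF a] by metis
  have "sobolev_bound L2c (L2sq lborel) s (C * A) (\<lambda>w. T (\<lambda>y. a y * w y))"
    unfolding sobolev_bound_def
  proof (intro conjI allI impI)
    show "0 \<le> C * A" using A(1) sobolev_boundD(1)[OF T] by simp
    fix w :: "real^'a \<Rightarrow> complex" assume w: "L2c w"
    note aw = L2c_test_fun_mult[OF a w]
    show "test_fun UNIV (T (\<lambda>y. a y * w y))" by (rule sobolev_boundD(2)[OF T aw])
    show "sobolev_sq s (T (\<lambda>y. a y * w y)) \<le> C * A * L2sq lborel w"
      using sobolev_boundD(3)[OF T aw] mult_left_mono[OF A(2)[OF w] sobolev_boundD(1)[OF T]] by simp
  qed
  then show ?thesis by blast
qed

subsection \<open>Friedrichs commutators\<close>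

text \<open>The commutator of multiplication by \<open>a\<close> with convolution by \<open>k\<close>, applied to the distributional
  derivative \<open>\<partial>\<^sub>\<nu> w\<close>; the derivative is moved to \<open>k\<close> and \<open>a\<close> so that \<open>w\<close> may be merely square integrable.\<close>
definition friedrichs_commutator :: "(real^'n::finite \<Rightarrow> complex) \<Rightarrow> (real^'n \<Rightarrow> complex) \<Rightarrow> 'n
    \<Rightarrow> (real^'n \<Rightarrow> complex) \<Rightarrow> real^'n \<Rightarrow> complex" where
  "friedrichs_commutator k a \<nu> w x = (a x * conv (partial \<nu> k) w x - conv (partial \<nu> k) (\<lambda>y. a y * w y) x)
      + conv k (\<lambda>y. partial \<nu> a y * w y) x"

lemma test_fun_friedrichs_commutator:
  assumes "test_fun UNIV k" "test_fun UNIV a" "L2c w" shows "test_fun UNIV (friedrichs_commutator k a \<nu> w)"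
  unfolding friedrichs_commutator_def[abs_def]
  by (intro test_fun_add test_fun_diff test_fun_mult test_fun_conv test_fun_partial L2c_test_fun_mult assms)

lemma friedrichs_commutator_add:
  assumes "test_fun UNIV k" "test_fun UNIV a" "L2c v" "L2c w"
  shows "friedrichs_commutator k a \<nu> (\<lambda>x. v x + w x)
      = (\<lambda>x. friedrichs_commutator k a \<nu> v x + friedrichs_commutator k a \<nu> w x)"
proof -
  have distrib: "(\<lambda>y. b y * (v y + w y)) = (\<lambda>y. b y * v y + b y * w y)" for b
    by (simp add: distrib_left)
  note partials = assms(1,2)[THEN test_fun_partial]
  have conv_product: "conv k' (\<lambda>y. b y * v y + b y * w y)
      = (\<lambda>x. conv k' (\<lambda>y. b y * v y) x + conv k' (\<lambda>y. b y * w y) x)"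
    if "test_fun UNIV k'" "test_fun UNIV b" for k' b
    by (intro conv_add that L2c_test_fun_mult[OF that(2)] assms)
  show ?thesis
    unfolding friedrichs_commutator_def[abs_def] distrib conv_add[OF partials(1) assms(3,4)]
      conv_product[OF partials(1) assms(2)] conv_product[OF assms(1) partials(2)]
    by (simp only: algebra_simps)
qed

lemma partial_mollifier:
  fixes z :: "real^'n::finite"
  assumes e: "e > 0"
  shows "partial i (mollifier e) z = of_real ((1/e) ^ CARD('n) * (1/e)) * partial i (mollifier 1) (0 + (1/e) *\<^sub>R z)"
proof -
  let ?c = "complex_of_real ((1/e) ^ CARD('n))"
  have mollifier_1: "test_fun UNIV (mollifier 1 :: real^'n \<Rightarrow> complex)" by (rule test_fun_mollifier) simp
  have "mollifier e = (\<lambda>z::real^'n. ?c * mollifier 1 (0 + (1/e) *\<^sub>R z))"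
    by (auto simp: mollifier_def power_divide)
  then have "partial i (mollifier e) z = ?c * partial i (\<lambda>z. mollifier 1 (0 + (1/e) *\<^sub>R z)) z"
    using partial_cmult_test_fun[OF test_fun_affine[OF mollifier_1, of "1/e" 0], of i ?c] e by simp
  also have "\<dots> = ?c * ((1/e) *\<^sub>R partial i (mollifier 1) (0 + (1/e) *\<^sub>R z))"
    by (simp only: partial_affine[OF mollifier_1])
  finally show ?thesis by (simp add: scaleR_conv_of_real[of _ "_::complex"])
qed

lemma integrable_norm_times_test_fun:
  assumes "test_fun UNIV f" shows "integrable lborel (\<lambda>z. norm z * norm (f z))"
proof -
  obtain R where R: "R > 0" "{x. f x \<noteq> 0} \<subseteq> cball 0 R"
    by (rule bounded_support_cball) (use assms in \<open>auto simp: test_fun_UNIV_iff\<close>)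
  have int: "integrable lborel (\<lambda>z. R * norm (f z))" using test_fun_integrable[OF assms] by simp
  have meas: "(\<lambda>z. norm z * norm (f z)) \<in> borel_measurable lborel"
    using test_fun_measurable[OF assms] by measurable
  show ?thesis
  proof (rule Bochner_Integration.integrable_bound[OF int meas AE_I2])
    show "norm (norm z * norm (f z)) \<le> norm (R * norm (f z))" for z
      using R by (cases "f z = 0") (auto simp: abs_mult intro!: mult_right_mono)
  qed
qed

lemma integral_norm_partial_mollifier:
  assumes e: "e > 0"
  shows "(\<integral>z. norm z * norm (partial i (mollifier e) (z::real^'n::finite)) \<partial>lborel)
       = (\<integral>z. norm z * norm (partial i (mollifier 1) (z::real^'n)) \<partial>lborel)"
proof -
  let ?q = "\<lambda>z::real^'n. norm z * norm (partial i (mollifier 1) z)"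
  have [measurable]: "partial i (mollifier 1) \<in> borel_measurable (borel :: (real^'n) measure)"
    by (rule test_fun_measurable[OF test_fun_partial[OF test_fun_mollifier]]) simp
  have "norm z * norm (partial i (mollifier e) z) = (1/e) ^ CARD('n) *\<^sub>R ?q (0 + (1/e) *\<^sub>R z)" for z :: "real^'n"
    using e by (subst partial_mollifier[OF e]) (simp add: norm_mult norm_divide norm_power power_divide)
  then show ?thesis using integral_lborel_affine[of ?q "1/e" 0] e by simp
qed

lemma norm_friedrichs_commutator_le:
  fixes a :: "real^'n::finite \<Rightarrow> complex"
  assumes k: "test_fun UNIV k" and a: "test_fun UNIV a" and w: "L2c w"
    and L: "\<And>x y. norm (a x - a y) \<le> L * norm (x - y)" and B: "\<And>x. norm (partial \<nu> a x) \<le> B"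
  shows "ennreal (norm (friedrichs_commutator k a \<nu> w x))
    \<le> (\<integral>\<^sup>+y. ennreal (L * (norm (x - y) * norm (partial \<nu> k (x - y))) + B * norm (k (x - y))) *
        ennreal (norm (w y)) \<partial>lborel)"
proof -
  let ?\<kappa> = "\<lambda>z. L * (norm z * norm (partial \<nu> k z)) + B * norm (k z)"
  let ?f = "\<lambda>y. a x * (partial \<nu> k (x - y) * w y)" and ?g = "\<lambda>y. partial \<nu> k (x - y) * (a y * w y)"
    and ?h = "\<lambda>y. k (x - y) * (partial \<nu> a y * w y)"
  have int: "integrable lborel ?f" "integrable lborel ?g" "integrable lborel ?h"
    by (auto intro!: integrable_mult_right conv_integrable k w L2c_test_fun_mult a test_fun_partial)
  have "friedrichs_commutator k a \<nu> w x = (\<integral>y. (?f y - ?g y) + ?h y \<partial>lborel)"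
    unfolding friedrichs_commutator_def conv_def
    by (simp only: Bochner_Integration.integral_add[OF Bochner_Integration.integrable_diff[OF int(1,2)] int(3)]
        Bochner_Integration.integral_diff[OF int(1,2)] integral_mult_right_zero)
  then have "ennreal (norm (friedrichs_commutator k a \<nu> w x)) \<le> (\<integral>\<^sup>+y. norm ((?f y - ?g y) + ?h y) \<partial>lborel)"
    using integral_norm_bound_ennreal
      [OF Bochner_Integration.integrable_add[OF Bochner_Integration.integrable_diff[OF int(1,2)] int(3)]]
    by (simp only:)
  also have "\<dots> \<le> (\<integral>\<^sup>+y. ennreal (?\<kappa> (x - y)) * ennreal (norm (w y)) \<partial>lborel)"
  proof (rule nn_integral_mono)
    fix y
    have "(?f y - ?g y) + ?h y = ((a x - a y) * partial \<nu> k (x - y) + k (x - y) * partial \<nu> a y) * w y"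
      by (simp add: algebra_simps)
    then have "norm ((?f y - ?g y) + ?h y)
        = norm ((a x - a y) * partial \<nu> k (x - y) + k (x - y) * partial \<nu> a y) * norm (w y)"
      by (simp only: norm_mult)
    also have "\<dots> \<le> ?\<kappa> (x - y) * norm (w y)"
    proof (intro mult_right_mono norm_triangle_mono)
      show "norm ((a x - a y) * partial \<nu> k (x - y)) \<le> L * (norm (x - y) * norm (partial \<nu> k (x - y)))"
        using mult_right_mono[OF L[of x y], of "norm (partial \<nu> k (x - y))"] by (simp add: norm_mult mult.assoc)
      show "norm (k (x - y) * partial \<nu> a y) \<le> B * norm (k (x - y))"
        using mult_right_mono[OF B[of y], of "norm (k (x - y))"] by (simp add: norm_mult mult.commute)
    qed simp
    finally show "ennreal (norm ((?f y - ?g y) + ?h y)) \<le> ennreal (?\<kappa> (x - y)) * ennreal (norm (w y))"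
      by (simp add: ennreal_mult''[symmetric] ennreal_leI)
  qed
  finally show ?thesis .
qed

lemma friedrichs_commutator_L2_bound:
  fixes a :: "real^'n::finite \<Rightarrow> complex"
  assumes a: "test_fun UNIV a"
  shows "\<exists>C. \<forall>e>0. sobolev_bound L2c (L2sq lborel) 0 C (friedrichs_commutator (mollifier e) a \<nu>)"
proof -
  obtain L where L: "L > 0" "\<And>x y. norm (a x - a y) \<le> L * norm (x - y)" using test_fun_lipschitz[OF a] by metis
  obtain B where B: "B > 0" "\<And>x. norm (partial \<nu> a x) \<le> B" using test_fun_bounded[OF test_fun_partial[OF a]]
    by metis
  define A where "A = L * (\<integral>z. norm z * norm (partial \<nu> (mollifier 1) (z::real^'n)) \<partial>lborel) + B"
  have "A \<ge> 0" using L(1) B(1) by (simp add: A_def)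
  have "sobolev_bound L2c (L2sq lborel) 0 (A\<^sup>2) (friedrichs_commutator (mollifier e) a \<nu>)" if e: "e > 0" for e
    unfolding sobolev_bound_def sobolev_sq.simps(1)
  proof (intro conjI allI impI)
    fix w :: "real^'n \<Rightarrow> complex" assume w: "L2c w"
    let ?k = "mollifier e :: real^'n \<Rightarrow> complex"
    let ?\<kappa> = "\<lambda>z. L * (norm z * norm (partial \<nu> ?k z)) + B * norm (?k z)"
    have k: "test_fun UNIV ?k" "test_fun UNIV (partial \<nu> ?k)" using test_fun_mollifier[OF e] test_fun_partial
      by blast+
    show test_fun: "test_fun UNIV (friedrichs_commutator ?k a \<nu> w)" by (rule test_fun_friedrichs_commutator[OF k(1) a w])
    show "L2sq lborel (friedrichs_commutator ?k a \<nu> w) \<le> A\<^sup>2 * L2sq lborel w"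
    proof (rule Schur_L2_bound[where \<kappa>="\<lambda>z. ennreal (?\<kappa> z)", OF _ _ \<open>A \<ge> 0\<close> L2cD(1)[OF w]])
      show "(\<lambda>z. ennreal (?\<kappa> z)) \<in> borel_measurable borel"
        using k[THEN test_fun_measurable] by measurable
      have int: "integrable lborel (\<lambda>z. norm z * norm (partial \<nu> ?k z))" "integrable lborel (\<lambda>z. norm (?k z))"
        using integrable_norm_times_test_fun[OF k(2)] test_fun_integrable[OF k(1)] by auto
      then have "(\<integral>z. ?\<kappa> z \<partial>lborel) = A"
        using integral_norm_partial_mollifier[OF e, of \<nu>] integral_norm_mollifier[OF e, where 'a="real^'n"]
        by (simp add: A_def)
      then show "(\<integral>\<^sup>+z. ennreal (?\<kappa> z) \<partial>lborel) \<le> ennreal A"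
        using int L(1) B(1) by (subst nn_integral_eq_integral) auto
      show "friedrichs_commutator ?k a \<nu> w \<in> borel_measurable borel" by (rule test_fun_measurable[OF test_fun])
      show "ennreal (norm (friedrichs_commutator ?k a \<nu> w x))
          \<le> (\<integral>\<^sup>+y. ennreal (?\<kappa> (x - y)) * ennreal (norm (w y)) \<partial>lborel)" for x
        by (rule norm_friedrichs_commutator_le[OF k(1) a w L(2) B(2)])
    qed
  qed simp
  then show ?thesis by blast
qed

lemma partial_friedrichs_commutator:
  assumes k: "test_fun UNIV k" and a: "test_fun UNIV a" and w: "test_fun UNIV w"
  shows "partial i (friedrichs_commutator k a \<nu> w)
    = (\<lambda>x. friedrichs_commutator k (partial i a) \<nu> w x + friedrichs_commutator k a \<nu> (partial i w) x)"
proof -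
  have product: "test_fun UNIV (\<lambda>y. b y * w y)" if "test_fun UNIV b" for b by (intro test_fun_mult that w)
  have conv_product: "partial i (conv k' (\<lambda>y. b y * w y))
     = (\<lambda>x. conv k' (\<lambda>y. partial i b y * w y) x + conv k' (\<lambda>y. b y * partial i w y) x)"
    if k': "test_fun UNIV k'" and b: "test_fun UNIV b" for k' b
    unfolding partial_conv_right[OF k' product[OF b]] partial_mult_test_fun[OF b w]
    by (intro conv_add[OF k'] test_fun_L2c test_fun_mult test_fun_partial b w)
  note partials = test_fun_partial[OF k, of \<nu>] test_fun_partial[OF a, of \<nu>]
  have first: "partial i (\<lambda>x. a x * conv (partial \<nu> k) w x)
     = (\<lambda>x. partial i a x * conv (partial \<nu> k) w x + a x * conv (partial \<nu> k) (partial i w) x)"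
    by (simp only: partial_mult_test_fun[OF a test_fun_conv[OF partials(1) test_fun_L2c[OF w]]]
        partial_conv_right[OF partials(1) w])
  have terms: "test_fun UNIV (\<lambda>x. a x * conv (partial \<nu> k) w x)"
      "test_fun UNIV (conv (partial \<nu> k) (\<lambda>y. a y * w y))"
    "test_fun UNIV (conv k (\<lambda>y. partial \<nu> a y * w y))"
    by (intro test_fun_mult a test_fun_conv[OF partials(1)] test_fun_conv[OF k] test_fun_L2c product w partials)+
  have "partial i (friedrichs_commutator k a \<nu> w) = (\<lambda>x. (partial i (\<lambda>x. a x * conv (partial \<nu> k) w x) x
      - partial i (conv (partial \<nu> k) (\<lambda>y. a y * w y)) x) + partial i (conv k (\<lambda>y. partial \<nu> a y * w y)) x)"
    unfolding friedrichs_commutator_def[abs_def]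
    by (simp only: partial_add_test_fun[OF test_fun_diff[OF terms(1,2)] terms(3)]
        partial_diff_test_fun[OF terms(1,2)])
  then show ?thesis
    unfolding first conv_product[OF partials(1) a] conv_product[OF k partials(2)] friedrichs_commutator_def
      partial_commute[OF a, of i \<nu>]
    by (simp add: fun_eq_iff algebra_simps)
qed

lemma friedrichs_commutator_sobolev_bound:
  fixes a :: "real^'n::finite \<Rightarrow> complex"
  shows "test_fun UNIV a \<Longrightarrow>
    \<exists>C. \<forall>e>0. sobolev_bound (test_fun UNIV) (sobolev_sq s) s C (friedrichs_commutator (mollifier e) a \<nu>)"
proof (induction s arbitrary: a)
  case 0
  then show ?case
    using friedrichs_commutator_L2_bound sobolev_bound_L2c_imp_test_fun by metis
next
  case (Suc s)
  obtain C\<^sub>0 where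
      "\<And>e. e > 0 \<Longrightarrow> sobolev_bound (test_fun UNIV) (sobolev_sq 0) 0 C\<^sub>0 (friedrichs_commutator (mollifier e) a \<nu>)"
    using friedrichs_commutator_L2_bound[OF Suc.prems] sobolev_bound_L2c_imp_test_fun by metis
  moreover obtain C where
      "\<And>e. e > 0 \<Longrightarrow> sobolev_bound (test_fun UNIV) (sobolev_sq s) s C (friedrichs_commutator (mollifier e) a \<nu>)"
    using Suc.IH[OF Suc.prems] by metis
  moreover obtain D where
      "\<And>i e. e > 0 \<Longrightarrow> sobolev_bound (test_fun UNIV) (sobolev_sq s) s (D i)
        (friedrichs_commutator (mollifier e) (partial i a) \<nu>)"
    using Suc.IH[OF test_fun_partial[OF Suc.prems]] by metis
  ultimately have "sobolev_bound (test_fun UNIV) (sobolev_sq (Suc s)) (Suc s) (C\<^sub>0 + 2 * (\<Sum>i\<in>UNIV. D i) + 2 * C)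
      (friedrichs_commutator (mollifier e) a \<nu>)" if "e > 0" for e
    using that by (intro sobolev_bound_Suc[OF _ _ _ partial_friedrichs_commutator[OF test_fun_mollifier Suc.prems]])
  then show ?case by blast
qed

lemma friedrichs_commutator_smoothing_bound:
  assumes k: "test_fun UNIV k" and a: "test_fun UNIV a"
  shows "\<exists>C. sobolev_bound L2c (L2sq lborel) s C (friedrichs_commutator k a \<nu>)"
proof -
  note partials = test_fun_partial[OF k, of \<nu>] test_fun_partial[OF a, of \<nu>]
  obtain C\<^sub>1 where conv_partial: "sobolev_bound L2c (L2sq lborel) s C\<^sub>1 (conv (partial \<nu> k))"
    using sobolev_bound_conv[OF partials(1)] by blast
  obtain C\<^sub>2 where "sobolev_bound L2c (L2sq lborel) s C\<^sub>2 (\<lambda>w. conv (partial \<nu> k) (\<lambda>y. a y * w y))"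
    using sobolev_bound_precompose_mult[OF conv_partial a] by blast
  moreover obtain C\<^sub>3 where "sobolev_bound L2c (L2sq lborel) s C\<^sub>3 (\<lambda>w. conv k (\<lambda>y. partial \<nu> a y * w y))"
    using sobolev_bound_conv[OF k] sobolev_bound_precompose_mult partials(2) by blast
  moreover obtain C\<^sub>4 where "sobolev_bound L2c (L2sq lborel) s C\<^sub>4 (\<lambda>w x. a x * conv (partial \<nu> k) w x)"
    using sobolev_bound_compose[OF conv_partial] sobolev_bound_mult[OF a] by blast
  ultimately have "sobolev_bound L2c (L2sq lborel) s (2 * (2 * C\<^sub>4 + 2 * C\<^sub>2) + 2 * C\<^sub>3) (friedrichs_commutator k a \<nu>)"
    unfolding friedrichs_commutator_def[abs_def] by (intro sobolev_bound_add sobolev_bound_diff)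
  then show ?thesis by blast
qed

theorem friedrichs_commutator_bounded:
  fixes a :: "real^'n::finite \<Rightarrow> complex"
  assumes a: "test_fun UNIV a"
  obtains C where "C \<ge> 0"
    "\<And>w M e. L2c w \<Longrightarrow> e > 0 \<Longrightarrow> \<forall>\<^sub>F d in at_right 0. sobolev_sq s (conv (mollifier d) w) \<le> M \<Longrightarrow>
      sobolev_sq s (friedrichs_commutator (mollifier e) a \<nu> w) \<le> C * M"
proof -
  obtain C where C: "\<And>e. e > 0 \<Longrightarrow> sobolev_bound (test_fun UNIV) (sobolev_sq s) s C (friedrichs_commutator (mollifier e) a \<nu>)"
    using friedrichs_commutator_sobolev_bound[OF a] by metis
  have "C \<ge> 0" using sobolev_boundD(1)[OF C[of 1]] by simp
  have "sobolev_sq s (friedrichs_commutator (mollifier e) a \<nu> w) \<le> (2 * C) * M"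
    if w: "L2c w" and e: "e > 0" and M: "\<forall>\<^sub>F d in at_right 0. sobolev_sq s (conv (mollifier d) w) \<le> M" for w M e
  proof -
    let ?R = "friedrichs_commutator (mollifier e) a \<nu>"
    note mollifier_e = test_fun_mollifier[OF e, where 'n='n]
    obtain C' where C': "sobolev_bound L2c (L2sq lborel) s C' ?R"
      using friedrichs_commutator_smoothing_bound[OF mollifier_e a] by blast
    have "\<forall>\<^sub>F d in at_right (0::real). d > 0" by (rule eventually_at_right_less)
    with M have "\<forall>\<^sub>F d in at_right 0. sobolev_sq s (?R w)
        \<le> 2 * (C * M) + 2 * (C' * L2sq lborel (\<lambda>x. conv (mollifier d) w x - w x))"
    proof eventually_elim
      case (elim d)
      let ?v = "conv (mollifier d) w" and ?r = "\<lambda>x. w x - conv (mollifier d) w x"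
      have v: "test_fun UNIV ?v" by (rule test_fun_conv[OF test_fun_mollifier[OF elim(2)] w])
      have r: "L2c ?r" by (intro L2c_diff w test_fun_L2c[OF v])
      have "?R w = (\<lambda>x. ?R ?v x + ?R ?r x)"
        using friedrichs_commutator_add[OF mollifier_e a test_fun_L2c[OF v] r, of \<nu>] by simp
      then have "sobolev_sq s (?R w) \<le> 2 * sobolev_sq s (?R ?v) + 2 * sobolev_sq s (?R ?r)"
        using sobolev_sq_add_le[OF sobolev_boundD(2)[OF C[OF e] v] sobolev_boundD(2)[OF C' r]] by simp
      also have "\<dots> \<le> 2 * (C * M) + 2 * (C' * L2sq lborel ?r)"
        using sobolev_boundD(3)[OF C[OF e] v] mult_left_mono[OF elim(1) \<open>C \<ge> 0\<close>] sobolev_boundD(3)[OF C' r] by simp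
      finally show ?case by (simp add: L2sq_minus_commute[of _ w])
    qed
    moreover have "((\<lambda>d. 2 * (C * M) + 2 * (C' * L2sq lborel (\<lambda>x. conv (mollifier d) w x - w x)))
        \<longlongrightarrow> 2 * (C * M) + 2 * (C' * 0)) (at_right 0)"
      by (intro tendsto_intros L2_tendsto_conv_mollifier w)
    ultimately have "sobolev_sq s (?R w) \<le> 2 * (C * M) + 2 * (C' * 0)"
      by (intro tendsto_lowerbound[where F="at_right (0::real)"]) simp_all
    then show ?thesis by simp
  qed
  then show ?thesis using that[of "2 * C"] \<open>C \<ge> 0\<close> by simp
qed

section \<open>Interior regularity\<close>

subsection \<open>Divergence\<close>

definition divergence :: "('n::finite \<Rightarrow> real^'n \<Rightarrow> complex) \<Rightarrow> real^'n \<Rightarrow> complex" where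
  "divergence G x = (\<Sum>\<mu>\<in>UNIV. partial \<mu> (G \<mu>) x)"

lemma test_fun_divergence:
  "(\<And>\<mu>. test_fun \<Omega> (G \<mu>)) \<Longrightarrow> test_fun \<Omega> (divergence G)"
  unfolding divergence_def[abs_def] by (intro test_fun_sum test_fun_partial)

lemma divergence_add:
  assumes "\<And>\<mu>. test_fun UNIV (G \<mu>)" "\<And>\<mu>. test_fun UNIV (H \<mu>)"
  shows "divergence (\<lambda>\<mu> x. G \<mu> x + H \<mu> x) = (\<lambda>x. divergence G x + divergence H x)"
  unfolding divergence_def[abs_def] partial_add_test_fun[OF assms] by (simp only: sum.distrib)

lemma divergence_diff:
  assumes "\<And>\<mu>. test_fun UNIV (G \<mu>)" "\<And>\<mu>. test_fun UNIV (H \<mu>)"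
  shows "divergence (\<lambda>\<mu> x. G \<mu> x - H \<mu> x) = (\<lambda>x. divergence G x - divergence H x)"
  unfolding divergence_def[abs_def] partial_diff_test_fun[OF assms] by (simp only: sum_subtractf)

lemma divergence_mult:
  assumes "test_fun UNIV f" "\<And>\<mu>. test_fun UNIV (G \<mu>)"
  shows "divergence (\<lambda>\<mu> x. f x * G \<mu> x) = (\<lambda>x. (\<Sum>\<mu>\<in>UNIV. partial \<mu> f x * G \<mu> x) + f x * divergence G x)"
  unfolding divergence_def[abs_def] partial_mult_test_fun[OF assms] by (simp only: sum.distrib sum_distrib_left)

lemma divergence_axis:
  "divergence (\<lambda>\<mu> x. if \<mu> = i then f x else 0) = partial i f"
proof
  fix x
  have "partial \<mu> (\<lambda>x. if \<mu> = i then f x else 0) x = (if \<mu> = i then partial i f x else 0)" for \<mu>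
    by (cases "\<mu> = i") auto
  then show "divergence (\<lambda>\<mu> x. if \<mu> = i then f x else 0) x = partial i f x" by (simp add: divergence_def)
qed

lemma partial_divergence:
  assumes "\<And>\<mu>. test_fun UNIV (G \<mu>)"
  shows "partial i (divergence G) = divergence (\<lambda>\<mu>. partial i (G \<mu>))"
  unfolding divergence_def[abs_def] partial_sum_test_fun[OF test_fun_partial[OF assms]]
  by (simp only: partial_commute[OF assms, of i])

lemma integral_divergence_mult:
  assumes G: "\<And>\<mu>. test_fun UNIV (G \<mu>)" and f: "test_fun UNIV f"
  shows "(\<integral>x. divergence G x * f x \<partial>lborel) = - (\<Sum>\<mu>\<in>UNIV. \<integral>x. G \<mu> x * partial \<mu> f x \<partial>lborel)"
proof -
  have "integrable lborel (\<lambda>x. partial \<mu> (G \<mu>) x * f x)" for \<mu>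
    by (intro test_fun_integrable test_fun_mult test_fun_partial G f)
  then show ?thesis
    unfolding divergence_def sum_distrib_right
    by (simp add: integral_by_parts[OF G f] sum_negf)
qed

subsection \<open>The elliptic estimate for test functions\<close>

locale elliptic =
  fixes a :: "'n::finite \<Rightarrow> 'n \<Rightarrow> real^'n \<Rightarrow> complex" and U :: "(real^'n) set" and c :: real
  assumes test_fun_coeff: "\<And>\<mu> \<nu>. test_fun UNIV (a \<mu> \<nu>)" and c_pos: "c > 0" and open_U: "open U"
    and ellipticity: "\<And>x \<xi>. x \<in> U \<Longrightarrow> c * (\<Sum>\<mu>\<in>UNIV. (cmod (\<xi> $ \<mu>))\<^sup>2)
       \<le> Re (\<Sum>\<mu>\<in>UNIV. \<Sum>\<nu>\<in>UNIV. a \<mu> \<nu> x * cnj (\<xi> $ \<mu>) * \<xi> $ \<nu>)"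
begin

definition flux :: "(real^'n \<Rightarrow> complex) \<Rightarrow> 'n \<Rightarrow> real^'n \<Rightarrow> complex" where
  "flux v \<mu> x = (\<Sum>\<nu>\<in>UNIV. a \<mu> \<nu> x * partial \<nu> v x)"

lemma test_fun_flux: "test_fun \<Omega> v \<Longrightarrow> test_fun \<Omega> (flux v \<mu>)"
  unfolding flux_def[abs_def]
  by (intro test_fun_sum test_fun_mult_smooth[OF test_fun_partial test_fun_smooth_on[OF test_fun_coeff]])

lemma partial_flux:
  assumes v: "test_fun UNIV v"
  shows "partial i (flux v \<mu>) = (\<lambda>x. (\<Sum>\<nu>\<in>UNIV. partial i (a \<mu> \<nu>) x * partial \<nu> v x) + flux (partial i v) \<mu> x)"
proof -
  have "partial i (flux v \<mu>) = (\<lambda>x. \<Sum>\<nu>\<in>UNIV. partial i (\<lambda>x. a \<mu> \<nu> x * partial \<nu> v x) x)"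
    unfolding flux_def[abs_def]
    by (rule partial_sum_test_fun[OF test_fun_mult[OF test_fun_coeff test_fun_partial[OF v]]])
  also have "\<dots> = (\<lambda>x. \<Sum>\<nu>\<in>UNIV. partial i (a \<mu> \<nu>) x * partial \<nu> v x + a \<mu> \<nu> x * partial \<nu> (partial i v) x)"
    by (simp only: partial_mult_test_fun[OF test_fun_coeff test_fun_partial[OF v]] partial_commute[OF v, of i])
  finally show ?thesis by (simp only: sum.distrib flux_def)
qed

lemma garding:
  assumes v: "test_fun U v"
  shows "c * (\<Sum>\<mu>\<in>UNIV. L2sq lborel (partial \<mu> v)) \<le> Re (\<Sum>\<mu>\<in>UNIV. \<integral>x. flux v \<mu> x * cnj (partial \<mu> v x) \<partial>lborel)"
proof -
  have v': "test_fun UNIV v" using v by (rule test_fun_UNIV)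
  have int_sq: "integrable lborel (\<lambda>x. (norm (partial \<mu> v x))\<^sup>2)" for \<mu>
    by (intro square_integrableD L2cD test_fun_L2c test_fun_partial v')
  have int: "integrable lborel (\<lambda>x. flux v \<mu> x * cnj (partial \<mu> v x))" for \<mu>
    by (intro test_fun_integrable test_fun_mult test_fun_flux test_fun_cnj test_fun_partial v')
  have pointwise: "c * (\<Sum>\<mu>\<in>UNIV. (norm (partial \<mu> v x))\<^sup>2) \<le> Re (\<Sum>\<mu>\<in>UNIV. flux v \<mu> x * cnj (partial \<mu> v x))" for x
  proof (cases "x \<in> U")
    case True
    have "(\<Sum>\<mu>\<in>UNIV. flux v \<mu> x * cnj (partial \<mu> v x))
        = (\<Sum>\<mu>\<in>UNIV. \<Sum>\<nu>\<in>UNIV. a \<mu> \<nu> x * cnj ((\<chi> \<mu>. partial \<mu> v x) $ \<mu>) * (\<chi> \<mu>. partial \<mu> v x) $ \<nu>)"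
      unfolding flux_def sum_distrib_right by (intro sum.cong refl) (simp add: mult_ac)
    then show ?thesis using ellipticity[OF True, of "\<chi> \<mu>. partial \<mu> v x"] by simp
  next
    case False
    then show ?thesis using test_fun_outside[OF test_fun_partial[OF v]] by simp
  qed
  have "c * (\<Sum>\<mu>\<in>UNIV. L2sq lborel (partial \<mu> v)) = (\<integral>x. c * (\<Sum>\<mu>\<in>UNIV. (norm (partial \<mu> v x))\<^sup>2) \<partial>lborel)"
    unfolding L2sq_def by (subst Bochner_Integration.integral_sum[symmetric]) (auto simp: int_sq)
  also have "\<dots> \<le> (\<integral>x. Re (\<Sum>\<mu>\<in>UNIV. flux v \<mu> x * cnj (partial \<mu> v x)) \<partial>lborel)"
    by (intro integral_mono pointwise integrable_mult_right integrable_Re Bochner_Integration.integrable_sum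
        int_sq int)
  also have "\<dots> = Re (\<Sum>\<mu>\<in>UNIV. \<integral>x. flux v \<mu> x * cnj (partial \<mu> v x) \<partial>lborel)"
    by (simp only: integral_Re[OF Bochner_Integration.integrable_sum[OF int]]
        Bochner_Integration.integral_sum[OF int])
  finally show ?thesis .
qed

lemma energy_identity:
  assumes v: "test_fun UNIV v" and G0: "test_fun UNIV G0" and G: "\<And>\<mu>. test_fun UNIV (G \<mu>)"
    and equation: "divergence (flux v) = (\<lambda>x. G0 x + divergence G x)"
  shows "(\<Sum>\<mu>\<in>UNIV. \<integral>x. flux v \<mu> x * cnj (partial \<mu> v x) \<partial>lborel)
    = (\<Sum>\<mu>\<in>UNIV. \<integral>x. G \<mu> x * cnj (partial \<mu> v x) \<partial>lborel) - (\<integral>x. G0 x * cnj (v x) \<partial>lborel)"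
proof -
  note conj_v = test_fun_cnj[OF v]
  have parts: "(\<Sum>\<mu>\<in>UNIV. \<integral>x. H \<mu> x * cnj (partial \<mu> v x) \<partial>lborel) = - (\<integral>x. divergence H x * cnj (v x) \<partial>lborel)"
    if "\<And>\<mu>. test_fun UNIV (H \<mu>)" for H
    using integral_divergence_mult[OF that conj_v] by (simp add: partial_cnj[OF v])
  have "integrable lborel (\<lambda>x. G0 x * cnj (v x))" "integrable lborel (\<lambda>x. divergence G x * cnj (v x))"
    by (intro test_fun_integrable test_fun_mult test_fun_divergence G0 G conj_v)+
  then have "(\<integral>x. divergence (flux v) x * cnj (v x) \<partial>lborel)
      = (\<integral>x. G0 x * cnj (v x) \<partial>lborel) + (\<integral>x. divergence G x * cnj (v x) \<partial>lborel)"
    unfolding equation by (simp add: distrib_right)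
  then show ?thesis unfolding parts[OF test_fun_flux[OF v]] parts[OF G] by simp
qed

lemma energy_estimate:
  assumes v: "test_fun U v" and G0: "test_fun UNIV G0" and G: "\<And>\<mu>. test_fun UNIV (G \<mu>)"
    and equation: "divergence (flux v) = (\<lambda>x. G0 x + divergence G x)"
  shows "sobolev_sq (Suc 0) v \<le> (1 + 1 / c + 1 / c\<^sup>2)
      * (L2sq lborel G0 + (\<Sum>\<mu>\<in>UNIV. L2sq lborel (G \<mu>)) + L2sq lborel v)"
proof -
  have v': "test_fun UNIV v" using v by (rule test_fun_UNIV)
  let ?P = "\<Sum>\<mu>\<in>UNIV. L2sq lborel (partial \<mu> v)" and ?Q = "\<Sum>\<mu>\<in>UNIV. L2sq lborel (G \<mu>)"
    and ?V = "L2sq lborel G0 + L2sq lborel v"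
  note L2 = L2cD(1)[OF test_fun_L2c]
  have pairing: "norm (\<integral>x. f x * cnj (g x) \<partial>lborel) \<le> 1 / (2 * t) * L2sq lborel f + t / 2 * L2sq lborel g"
    if "test_fun UNIV f" "test_fun UNIV g" "t > 0" for f g :: "real^'n \<Rightarrow> complex" and t
    using L2_weighted_Cauchy_Schwarz[OF L2[OF that(1)] L2[OF test_fun_cnj[OF that(2)]] that(3)] by simp
  have "norm (\<Sum>\<mu>\<in>UNIV. \<integral>x. G \<mu> x * cnj (partial \<mu> v x) \<partial>lborel)
      \<le> (\<Sum>\<mu>\<in>UNIV. 1 / (2 * c) * L2sq lborel (G \<mu>) + c / 2 * L2sq lborel (partial \<mu> v))"
    by (intro sum_norm_le pairing test_fun_partial v' G c_pos)
  then have G_le: "norm (\<Sum>\<mu>\<in>UNIV. \<integral>x. G \<mu> x * cnj (partial \<mu> v x) \<partial>lborel) \<le> 1 / (2 * c) * ?Q + c / 2 * ?P"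
    by (simp only: sum.distrib sum_distrib_left)
  have G0_le: "norm (\<integral>x. G0 x * cnj (v x) \<partial>lborel) \<le> 1 / 2 * ?V"
    using pairing[OF G0 v', of 1] by simp
  have "c * ?P \<le> norm ((\<Sum>\<mu>\<in>UNIV. \<integral>x. G \<mu> x * cnj (partial \<mu> v x) \<partial>lborel) - (\<integral>x. G0 x * cnj (v x) \<partial>lborel))"
    using garding[OF v] complex_Re_le_cmod unfolding energy_identity[OF v' G0 G equation] by (rule order_trans)
  also have "\<dots> \<le> (1 / (2 * c) * ?Q + c / 2 * ?P) + 1 / 2 * ?V"
    by (rule norm_triangle_le_diff[OF add_mono[OF G_le G0_le]])
  also have "c * ?P = c / 2 * ?P + c / 2 * ?P" by simp
  finally have "c / 2 * ?P \<le> 1 / (2 * c) * ?Q + 1 / 2 * ?V" by linarith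
  then have "2 / c * (c / 2 * ?P) \<le> 2 / c * (1 / (2 * c) * ?Q + 1 / 2 * ?V)"
    using c_pos by (intro mult_left_mono) auto
  moreover have "2 / c * (c / 2 * ?P) = ?P" "2 / c * (1 / (2 * c) * ?Q + 1 / 2 * ?V) = 1 / c\<^sup>2 * ?Q + 1 / c * ?V"
    using c_pos by (simp_all add: field_simps power2_eq_square)
  ultimately have "?P \<le> 1 / c\<^sup>2 * ?Q + 1 / c * ?V" by (simp only:)
  moreover have "0 \<le> ?Q" by (intro sum_nonneg) simp
  then have "0 \<le> 1 / c * ?Q" "0 \<le> 1 / c\<^sup>2 * ?V" "0 \<le> ?Q" using c_pos by simp_all
  moreover have "(1 + 1 / c + 1 / c\<^sup>2) * (L2sq lborel G0 + ?Q + L2sq lborel v)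
      = (?V + (1 / c\<^sup>2 * ?Q + 1 / c * ?V)) + (?Q + 1 / c * ?Q + 1 / c\<^sup>2 * ?V)"
    by (simp only: distrib_left distrib_right mult_1 ac_simps)
  ultimately have "L2sq lborel v + ?P \<le> (1 + 1 / c + 1 / c\<^sup>2) * (L2sq lborel G0 + ?Q + L2sq lborel v)"
    using L2sq_nonneg[of lborel G0] by linarith
  then show ?thesis by (simp add: sobolev_sq.simps(2))
qed

definition differentiated_source :: "'n \<Rightarrow> (real^'n \<Rightarrow> complex) \<Rightarrow> (real^'n \<Rightarrow> complex) \<Rightarrow> ('n \<Rightarrow> real^'n \<Rightarrow> complex)
    \<Rightarrow> 'n \<Rightarrow> real^'n \<Rightarrow> complex" where
  "differentiated_source i v G0 G \<mu> x = (if \<mu> = i then G0 x else 0)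
     + (partial i (G \<mu>) x - (\<Sum>\<nu>\<in>UNIV. partial i (a \<mu> \<nu>) x * partial \<nu> v x))"

lemma test_fun_differentiated_source:
  assumes "test_fun UNIV v" "test_fun UNIV G0" "\<And>\<mu>. test_fun UNIV (G \<mu>)"
  shows "test_fun UNIV (differentiated_source i v G0 G \<mu>)"
  unfolding differentiated_source_def[abs_def]
  using assms
  by (cases "\<mu> = i") (auto intro!: test_fun_add test_fun_diff test_fun_sum test_fun_mult test_fun_partial
      test_fun_coeff)

lemma differentiated_equation:
  assumes v: "test_fun UNIV v" and G0: "test_fun UNIV G0" and G: "\<And>\<mu>. test_fun UNIV (G \<mu>)"
    and equation: "divergence (flux v) = (\<lambda>x. G0 x + divergence G x)"
  shows "divergence (flux (partial i v)) = divergence (differentiated_source i v G0 G)"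
proof -
  let ?H = "\<lambda>\<mu> x. if \<mu> = i then G0 x else 0" and ?K = "\<lambda>\<mu> x. \<Sum>\<nu>\<in>UNIV. partial i (a \<mu> \<nu>) x * partial \<nu> v x"
  have tests: "test_fun UNIV (?H \<mu>)" "test_fun UNIV (partial i (G \<mu>))" "test_fun UNIV (?K \<mu>)" for \<mu>
    using G0 by (cases "\<mu> = i") (auto intro!: test_fun_sum test_fun_mult test_fun_partial test_fun_coeff v G)
  have "(\<lambda>x. divergence ?K x + divergence (flux (partial i v)) x) = partial i (divergence (flux v))"
    unfolding partial_divergence[OF test_fun_flux[OF v]] partial_flux[OF v]
    by (rule divergence_add[OF tests(3) test_fun_flux[OF test_fun_partial[OF v]], symmetric])
  also have "\<dots> = (\<lambda>x. partial i G0 x + divergence (\<lambda>\<mu>. partial i (G \<mu>)) x)"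
    unfolding equation partial_add_test_fun[OF G0 test_fun_divergence[OF G]] partial_divergence[OF G] ..
  finally have "divergence ?K x + divergence (flux (partial i v)) x
      = partial i G0 x + divergence (\<lambda>\<mu>. partial i (G \<mu>)) x" for x
    by (rule fun_cong)
  then have "divergence (flux (partial i v)) x = partial i G0 x
      + (divergence (\<lambda>\<mu>. partial i (G \<mu>)) x - divergence ?K x)" for x
    by (simp only: add_diff_eq) (simp add: eq_diff_eq add.commute)
  then show ?thesis
    unfolding differentiated_source_def[abs_def] divergence_add[OF tests(1) test_fun_diff[OF tests(2,3)]]
      divergence_diff[OF tests(2,3)] divergence_axis
    by (rule ext)
qed

lemma sobolev_sq_differentiated_source_le:
  obtains D where "D \<ge> 0" "\<And>v G0 G. test_fun UNIV v \<Longrightarrow> test_fun UNIV G0 \<Longrightarrow> (\<And>\<mu>. test_fun UNIV (G \<mu>)) \<Longrightarrow>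
    (\<Sum>\<mu>\<in>UNIV. sobolev_sq s (differentiated_source i v G0 G \<mu>))
      \<le> D * (sobolev_sq s G0 + (\<Sum>\<mu>\<in>UNIV. sobolev_sq (Suc s) (G \<mu>)) + sobolev_sq (Suc s) v)"
proof -
  let ?K = "\<lambda>v \<mu> x. \<Sum>\<nu>\<in>UNIV. partial i (a \<mu> \<nu>) x * partial \<nu> v x"
    and ?H = "\<lambda>G0 \<mu> x. if \<mu> = i then G0 x else (0::complex)"
  have "\<forall>\<mu>. \<exists>D. sobolev_bound (test_fun UNIV) (sobolev_sq (Suc s)) s D (\<lambda>v. ?K v \<mu>)"
    by (intro allI sobolev_bound_first_order test_fun_partial test_fun_coeff)
  from choice[OF this] obtain D where D:
      "\<And>\<mu>. sobolev_bound (test_fun UNIV) (sobolev_sq (Suc s)) s (D \<mu>) (\<lambda>v. ?K v \<mu>)" by blast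
  note D_nonneg = sobolev_boundD(1)[OF D]
  define E where "E = 2 * real CARD('n) + 4 + 4 * (\<Sum>\<mu>\<in>UNIV. D \<mu>)"
  have E: "2 * real CARD('n) \<le> E" "4 \<le> E" "4 * (\<Sum>\<mu>\<in>UNIV. D \<mu>) \<le> E" "0 \<le> E"
    using sum_nonneg[of UNIV D, OF D_nonneg] by (auto simp: E_def)
  show thesis
  proof (rule that[OF E(4)])
    fix v G0 :: "real^'n \<Rightarrow> complex" and G :: "'n \<Rightarrow> real^'n \<Rightarrow> complex"
    assume v: "test_fun UNIV v" and G0: "test_fun UNIV G0" and G: "\<And>\<mu>. test_fun UNIV (G \<mu>)"
    have tests: "test_fun UNIV (?H G0 \<mu>)" "test_fun UNIV (partial i (G \<mu>))" "test_fun UNIV (?K v \<mu>)" for \<mu>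
      using G0 by (cases "\<mu> = i") (auto intro!: test_fun_sum test_fun_mult test_fun_partial test_fun_coeff v G)
    have "sobolev_sq s (differentiated_source i v G0 G \<mu>)
        \<le> 2 * sobolev_sq s G0 + 4 * sobolev_sq (Suc s) (G \<mu>) + 4 * D \<mu> * sobolev_sq (Suc s) v" for \<mu>
    proof -
      have "sobolev_sq s (?H G0 \<mu>) \<le> sobolev_sq s G0" by (cases "\<mu> = i") auto
      then show ?thesis
        using sobolev_sq_add_le[OF tests(1) test_fun_diff[OF tests(2,3)], of s \<mu> \<mu> \<mu>]
            sobolev_sq_diff_le[OF tests(2,3), of s \<mu> \<mu>]
          sobolev_sq_partial_le[of s i "G \<mu>"] sobolev_boundD(3)[OF D v, of \<mu>]
        unfolding differentiated_source_def[abs_def] by linarith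
    qed
    then have "(\<Sum>\<mu>\<in>UNIV. sobolev_sq s (differentiated_source i v G0 G \<mu>))
        \<le> (\<Sum>\<mu>\<in>UNIV. 2 * sobolev_sq s G0 + 4 * sobolev_sq (Suc s) (G \<mu>) + 4 * D \<mu> * sobolev_sq (Suc s) v)"
      by (rule sum_mono)
    also have "\<dots> = 2 * real CARD('n) * sobolev_sq s G0 + 4 * (\<Sum>\<mu>\<in>UNIV. sobolev_sq (Suc s) (G \<mu>))
        + 4 * (\<Sum>\<mu>\<in>UNIV. D \<mu>) * sobolev_sq (Suc s) v"
      by (simp add: sum.distrib sum_distrib_left sum_distrib_right)
    also have "\<dots> \<le> E * sobolev_sq s G0 + E * (\<Sum>\<mu>\<in>UNIV. sobolev_sq (Suc s) (G \<mu>)) + E * sobolev_sq (Suc s) v"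
      by (intro add_mono mult_right_mono E sum_nonneg sobolev_sq_nonneg)
    finally show "(\<Sum>\<mu>\<in>UNIV. sobolev_sq s (differentiated_source i v G0 G \<mu>))
        \<le> E * (sobolev_sq s G0 + (\<Sum>\<mu>\<in>UNIV. sobolev_sq (Suc s) (G \<mu>)) + sobolev_sq (Suc s) v)"
      by (simp only: distrib_left)
  qed
qed

text \<open>For \<open>s = 0\<close> the truncated difference \<open>s - 1\<close> is \<open>0\<close>: the source \<open>G0\<close> is then measured in \<open>L\<^sup>2\<close>.\<close>
definition elliptic_bound :: "((real^'n \<Rightarrow> complex) \<Rightarrow> real^'n \<Rightarrow> complex) \<Rightarrow> nat \<Rightarrow> nat \<Rightarrow> real \<Rightarrow> bool" where
  "elliptic_bound T t s C \<longleftrightarrow> C \<ge> 0 \<and> (\<forall>v G0 G. test_fun U v \<longrightarrow> test_fun UNIV G0 \<longrightarrow> (\<forall>\<mu>. test_fun UNIV (G \<mu>)) \<longrightarrow>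
     divergence (flux v) = (\<lambda>x. G0 x + divergence G x) \<longrightarrow>
     sobolev_sq t (T v) \<le> C * (sobolev_sq (s - 1) G0 + (\<Sum>\<mu>\<in>UNIV. sobolev_sq s (G \<mu>)) + L2sq lborel v))"

lemma elliptic_boundD:
  assumes "elliptic_bound T t s C"
  shows "C \<ge> 0" "\<lbrakk>test_fun U v; test_fun UNIV G0; \<And>\<mu>. test_fun UNIV (G \<mu>);
      divergence (flux v) = (\<lambda>x. G0 x + divergence G x)\<rbrakk> \<Longrightarrow>
    sobolev_sq t (T v) \<le> C * (sobolev_sq (s - 1) G0 + (\<Sum>\<mu>\<in>UNIV. sobolev_sq s (G \<mu>)) + L2sq lborel v)"
  using assms by (auto simp: elliptic_bound_def)

lemma elliptic_bound_partial:
  assumes C: "elliptic_bound (\<lambda>v. v) (Suc s) s C"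
  shows "\<exists>E. elliptic_bound (partial i) (Suc s) (Suc s) E"
proof -
  obtain D where D: "D \<ge> 0" "\<And>v G0 G. test_fun UNIV v \<Longrightarrow> test_fun UNIV G0 \<Longrightarrow> (\<And>\<mu>. test_fun UNIV (G \<mu>)) \<Longrightarrow>
    (\<Sum>\<mu>\<in>UNIV. sobolev_sq s (differentiated_source i v G0 G \<mu>))
      \<le> D * (sobolev_sq s G0 + (\<Sum>\<mu>\<in>UNIV. sobolev_sq (Suc s) (G \<mu>)) + sobolev_sq (Suc s) v)"
    by (rule sobolev_sq_differentiated_source_le[of s i]) blast
  note C_nonneg = elliptic_boundD(1)[OF C]
  have "sobolev_sq (Suc s) (partial i v) \<le> C * (D * (1 + C) + C)
      * (sobolev_sq s G0 + (\<Sum>\<mu>\<in>UNIV. sobolev_sq (Suc s) (G \<mu>)) + L2sq lborel v)"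
    if v: "test_fun U v" and G0: "test_fun UNIV G0" and G: "\<And>\<mu>. test_fun UNIV (G \<mu>)"
      and equation: "divergence (flux v) = (\<lambda>x. G0 x + divergence G x)" for v G0 G
  proof -
    have v': "test_fun UNIV v" using v by (rule test_fun_UNIV)
    let ?X = "sobolev_sq s G0 + (\<Sum>\<mu>\<in>UNIV. sobolev_sq (Suc s) (G \<mu>)) + L2sq lborel v"
    have v_le: "sobolev_sq (Suc s) v \<le> C * ?X"
      by (rule order_trans[OF elliptic_boundD(2)[OF C v G0 G equation]])
         (intro mult_left_mono add_mono sum_mono sobolev_sq_mono sobolev_sq_le_Suc C_nonneg, auto)
    then have "sobolev_sq s G0 + (\<Sum>\<mu>\<in>UNIV. sobolev_sq (Suc s) (G \<mu>)) + sobolev_sq (Suc s) v \<le> ?X + C * ?X"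
      using L2sq_nonneg[of lborel v] by linarith
    from order_trans[OF D(2)[OF v' G0 G] mult_left_mono[OF this D(1)]]
    have source_le: "(\<Sum>\<mu>\<in>UNIV. sobolev_sq s (differentiated_source i v G0 G \<mu>)) \<le> D * (?X + C * ?X)" .
    have L2_le: "L2sq lborel (partial i v) \<le> C * ?X"
      using L2sq_le_sobolev_sq[of "partial i v" s] sobolev_sq_partial_le[of s i v] v_le by linarith
    have "sobolev_sq (Suc s) (partial i v) \<le> C * (sobolev_sq (s - 1) (\<lambda>x::real^'n. 0)
        + (\<Sum>\<mu>\<in>UNIV. sobolev_sq s (differentiated_source i v G0 G \<mu>)) + L2sq lborel (partial i v))"
      by (rule elliptic_boundD(2)[OF C test_fun_partial[OF v] test_fun_zero
          test_fun_differentiated_source[OF v' G0 G]])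
         (simp add: differentiated_equation[OF v' G0 G equation])
    also have "\<dots> \<le> C * (0 + D * (?X + C * ?X) + C * ?X)"
      by (intro mult_left_mono add_mono C_nonneg source_le L2_le) simp
    finally show ?thesis by (simp add: algebra_simps)
  qed
  then have "elliptic_bound (partial i) (Suc s) (Suc s) (C * (D * (1 + C) + C))"
    using C_nonneg D(1) by (simp add: elliptic_bound_def)
  then show ?thesis by blast
qed

theorem elliptic_estimate: "\<exists>C. elliptic_bound (\<lambda>v. v) (Suc s) s C"
proof (induction s)
  case 0
  have "elliptic_bound (\<lambda>v. v) (Suc 0) 0 (1 + 1 / c + 1 / c\<^sup>2)"
    unfolding elliptic_bound_def using energy_estimate c_pos by simp
  then show ?case by blast
next
  case (Suc s)
  then have "\<forall>i. \<exists>E. elliptic_bound (partial i) (Suc s) (Suc s) E" using elliptic_bound_partial by blast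
  from choice[OF this] obtain E where E: "\<And>i. elliptic_bound (partial i) (Suc s) (Suc s) (E i)" by blast
  have "elliptic_bound (\<lambda>v. v) (Suc (Suc s)) (Suc s) (1 + (\<Sum>i\<in>UNIV. E i))"
    unfolding elliptic_bound_def
  proof (intro conjI allI impI)
    show "0 \<le> 1 + (\<Sum>i\<in>UNIV. E i)" using elliptic_boundD(1)[OF E] by (simp add: sum_nonneg)
    fix v G0 and G :: "'n \<Rightarrow> real^'n \<Rightarrow> complex"
    assume hyps: "test_fun U v" "test_fun UNIV G0" "\<forall>\<mu>. test_fun UNIV (G \<mu>)"
      "divergence (flux v) = (\<lambda>x. G0 x + divergence G x)"
    let ?X = "sobolev_sq s G0 + (\<Sum>\<mu>\<in>UNIV. sobolev_sq (Suc s) (G \<mu>)) + L2sq lborel v"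
    have "L2sq lborel v \<le> 1 * ?X"
      using sum_nonneg[of UNIV "\<lambda>\<mu>. sobolev_sq (Suc s) (G \<mu>)"] by simp
    moreover have "(\<Sum>i\<in>UNIV. sobolev_sq (Suc s) (partial i v)) \<le> (\<Sum>i\<in>UNIV. E i) * ?X"
      unfolding sum_distrib_right using elliptic_boundD(2)[OF E hyps(1,2) spec[OF hyps(3)] hyps(4)]
      by (intro sum_mono) simp
    ultimately have "L2sq lborel v + (\<Sum>i\<in>UNIV. sobolev_sq (Suc s) (partial i v)) \<le> 1 * ?X + (\<Sum>i\<in>UNIV. E i) * ?X"
      by (rule add_mono)
    then show "sobolev_sq (Suc (Suc s)) v \<le> (1 + (\<Sum>i\<in>UNIV. E i))
        * (sobolev_sq (Suc s - 1) G0 + (\<Sum>\<mu>\<in>UNIV. sobolev_sq (Suc s) (G \<mu>)) + L2sq lborel v)"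
      by (simp only: sobolev_sq.simps(2)[of "Suc s"] distrib_right[symmetric] diff_Suc_1)
  qed
  then show ?case by blast
qed

end

subsection \<open>Interior regularity of weak solutions\<close>

lemma L2c_mult_test_fun_integrable: "test_fun UNIV f \<Longrightarrow> L2c w \<Longrightarrow> integrable lborel (\<lambda>x. w x * f x)"
  using L2c_integrable[OF L2c_test_fun_mult] by (simp add: mult.commute)

lemma test_fun_reflect: "test_fun UNIV k \<Longrightarrow> test_fun UNIV (\<lambda>y. k (x - y))"
  using test_fun_affine[of k "-1" x] by simp

lemma partial_reflect: "test_fun UNIV k \<Longrightarrow> partial i (\<lambda>y. k (x - y)) = (\<lambda>y. - partial i k (x - y))"
  using partial_affine[of UNIV k i x "-1"] by auto

context elliptic
begin

definition dual_flux :: "(real^'n \<Rightarrow> complex) \<Rightarrow> 'n \<Rightarrow> real^'n \<Rightarrow> complex" where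
  "dual_flux \<phi> \<nu> x = (\<Sum>\<mu>\<in>UNIV. a \<mu> \<nu> x * partial \<mu> \<phi> x)"

definition formal_transpose :: "(real^'n \<Rightarrow> complex) \<Rightarrow> real^'n \<Rightarrow> complex" where
  "formal_transpose \<phi> = divergence (dual_flux \<phi>)"

definition drift :: "(real^'n \<Rightarrow> complex) \<Rightarrow> 'n \<Rightarrow> real^'n \<Rightarrow> complex" where
  "drift \<psi> \<mu> x = flux \<psi> \<mu> x + dual_flux \<psi> \<mu> x"

lemma test_fun_dual_flux: "test_fun \<Omega> \<phi> \<Longrightarrow> test_fun \<Omega> (dual_flux \<phi> \<nu>)"
  unfolding dual_flux_def[abs_def]
  by (intro test_fun_sum test_fun_mult_smooth[OF test_fun_partial test_fun_smooth_on[OF test_fun_coeff]])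

lemma test_fun_formal_transpose: "test_fun \<Omega> \<phi> \<Longrightarrow> test_fun \<Omega> (formal_transpose \<phi>)"
  unfolding formal_transpose_def by (intro test_fun_divergence test_fun_dual_flux)

lemma test_fun_drift: "test_fun \<Omega> \<psi> \<Longrightarrow> test_fun \<Omega> (drift \<psi> \<mu>)"
  unfolding drift_def[abs_def] by (intro test_fun_add test_fun_flux test_fun_dual_flux)

lemma dual_flux_mult:
  assumes "test_fun UNIV \<psi>" "test_fun UNIV \<phi>"
  shows "dual_flux (\<lambda>x. \<psi> x * \<phi> x) = (\<lambda>\<nu> x. \<phi> x * dual_flux \<psi> \<nu> x + \<psi> x * dual_flux \<phi> \<nu> x)"
  unfolding dual_flux_def partial_mult_test_fun[OF assms] sum_distrib_left sum.distrib[symmetric]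
  by (intro ext sum.cong refl) (simp add: algebra_simps)

lemma sum_partial_mult_dual_flux:
  "(\<Sum>\<nu>\<in>UNIV. partial \<nu> \<psi> x * dual_flux \<phi> \<nu> x) = (\<Sum>\<mu>\<in>UNIV. flux \<psi> \<mu> x * partial \<mu> \<phi> x)"
  unfolding dual_flux_def flux_def sum_distrib_left sum_distrib_right
  by (subst sum.swap) (simp add: mult_ac)

lemma formal_transpose_mult:
  assumes \<psi>: "test_fun UNIV \<psi>" and \<phi>: "test_fun UNIV \<phi>"
  shows "formal_transpose (\<lambda>x. \<psi> x * \<phi> x) x
    = \<psi> x * formal_transpose \<phi> x + formal_transpose \<psi> x * \<phi> x + (\<Sum>\<mu>\<in>UNIV. drift \<psi> \<mu> x * partial \<mu> \<phi> x)"
proof -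
  note fluxes = test_fun_dual_flux[OF \<psi>] test_fun_dual_flux[OF \<phi>]
  have products: "test_fun UNIV (\<lambda>x. \<phi> x * dual_flux \<psi> \<mu> x)" "test_fun UNIV (\<lambda>x. \<psi> x * dual_flux \<phi> \<mu> x)" for \<mu>
    by (intro test_fun_mult \<psi> \<phi> fluxes)+
  have "formal_transpose (\<lambda>x. \<psi> x * \<phi> x) x
      = ((\<Sum>\<mu>\<in>UNIV. partial \<mu> \<phi> x * dual_flux \<psi> \<mu> x) + \<phi> x * formal_transpose \<psi> x)
      + ((\<Sum>\<mu>\<in>UNIV. flux \<psi> \<mu> x * partial \<mu> \<phi> x) + \<psi> x * formal_transpose \<phi> x)"
    unfolding formal_transpose_def dual_flux_mult[OF \<psi> \<phi>] divergence_add[OF products]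
      divergence_mult[OF \<phi> fluxes(1)] divergence_mult[OF \<psi> fluxes(2)] sum_partial_mult_dual_flux ..
  moreover have "(\<Sum>\<mu>\<in>UNIV. drift \<psi> \<mu> x * partial \<mu> \<phi> x)
      = (\<Sum>\<mu>\<in>UNIV. flux \<psi> \<mu> x * partial \<mu> \<phi> x) + (\<Sum>\<mu>\<in>UNIV. partial \<mu> \<phi> x * dual_flux \<psi> \<mu> x)"
    by (simp only: drift_def distrib_right sum.distrib mult.commute[of "partial _ \<phi> x"])
  ultimately show ?thesis by (simp only: add_ac mult.commute[of "\<phi> x"])
qed

text \<open>Here \<open>\<beta>\<close> plays the role of \<open>1 / b\<close>: the test function in the weak form of \<open>Lbar u = g\<close> is taken to be
  \<open>\<beta> * \<phi>\<close>.\<close>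
definition weak_solution :: "(real^'n \<Rightarrow> complex) \<Rightarrow> (real^'n \<Rightarrow> complex) \<Rightarrow> (real^'n \<Rightarrow> complex) \<Rightarrow> bool" where
  "weak_solution \<beta> u g \<longleftrightarrow> (\<forall>\<phi>. test_fun U \<phi> \<longrightarrow>
     (\<integral>x. g x * (\<beta> x * \<phi> x) \<partial>lborel) = (\<integral>x. u x * formal_transpose \<phi> x \<partial>lborel))"

lemma localized_equation:
  assumes \<psi>: "test_fun U \<psi>" and \<phi>: "test_fun UNIV \<phi>" and \<beta>: "test_fun UNIV \<beta>" and u: "L2c u" and g: "L2c g"
    and weak: "weak_solution \<beta> u g"
  shows "(\<integral>x. \<psi> x * u x * formal_transpose \<phi> x \<partial>lborel)
     = (\<integral>x. (\<psi> x * \<beta> x * g x - formal_transpose \<psi> x * u x) * \<phi> x \<partial>lborel)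
       - (\<Sum>\<mu>\<in>UNIV. \<integral>x. drift \<psi> \<mu> x * u x * partial \<mu> \<phi> x \<partial>lborel)"
proof -
  have \<psi>': "test_fun UNIV \<psi>" using \<psi> by (rule test_fun_UNIV)
  let ?product = "\<lambda>x. u x * formal_transpose (\<lambda>x. \<psi> x * \<phi> x) x" and ?source = "\<lambda>x. g x * (\<beta> x * (\<psi> x * \<phi> x))"
    and ?zeroth = "\<lambda>x. u x * (formal_transpose \<psi> x * \<phi> x)" and ?first = "\<lambda>\<mu> x. u x * (drift \<psi> \<mu> x * partial \<mu> \<phi> x)"
  have int: "integrable lborel ?product" "integrable lborel ?source" "integrable lborel ?zeroth"
      "integrable lborel (?first \<mu>)" for \<mu>
    by (intro L2c_mult_test_fun_integrable test_fun_mult test_fun_formal_transpose test_fun_drift test_fun_partial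
        \<psi>' \<phi> \<beta> u g)+
  have "\<psi> x * u x * formal_transpose \<phi> x = ?product x - ?zeroth x - (\<Sum>\<mu>\<in>UNIV. ?first \<mu> x)" for x
    unfolding formal_transpose_mult[OF \<psi>' \<phi>] by (simp add: algebra_simps sum_distrib_left)
  then have "(\<integral>x. \<psi> x * u x * formal_transpose \<phi> x \<partial>lborel)
      = (\<integral>x. ?product x \<partial>lborel) - (\<integral>x. ?zeroth x \<partial>lborel) - (\<Sum>\<mu>\<in>UNIV. \<integral>x. ?first \<mu> x \<partial>lborel)"
    by (simp add: int)
  also have "(\<integral>x. ?product x \<partial>lborel) = (\<integral>x. ?source x \<partial>lborel)"
    using weak test_fun_mult[OF \<psi> \<phi>] by (simp add: weak_solution_def)
  also have "(\<integral>x. ?source x \<partial>lborel) - (\<integral>x. ?zeroth x \<partial>lborel)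
      = (\<integral>x. (\<psi> x * \<beta> x * g x - formal_transpose \<psi> x * u x) * \<phi> x \<partial>lborel)"
    by (subst Bochner_Integration.integral_diff[OF int(2,3), symmetric]) (simp add: algebra_simps)
  finally show ?thesis by (simp add: mult_ac)
qed

lemma formal_transpose_reflect:
  assumes k: "test_fun UNIV k"
  shows "formal_transpose (\<lambda>y. k (x - y)) y
    = (\<Sum>\<nu>\<in>UNIV. \<Sum>\<mu>\<in>UNIV. partial \<mu> (partial \<nu> k) (x - y) * a \<mu> \<nu> y - partial \<mu> k (x - y) * partial \<nu> (a \<mu> \<nu>) y)"
proof -
  have dk: "test_fun UNIV (\<lambda>y. - 1 * partial \<mu> k (x - y))" for \<mu>
    by (intro test_fun_cmult test_fun_reflect test_fun_partial k)
  have ddk: "partial \<nu> (\<lambda>y. - 1 * partial \<mu> k (x - y)) = (\<lambda>y. partial \<mu> (partial \<nu> k) (x - y))" for \<mu> \<nu>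
    unfolding partial_cmult_test_fun[OF test_fun_reflect[OF test_fun_partial[OF k]]]
      partial_reflect[OF test_fun_partial[OF k]] partial_commute[OF k, of \<nu>] by simp
  have flux: "dual_flux (\<lambda>y. k (x - y)) \<nu> = (\<lambda>y. \<Sum>\<mu>\<in>UNIV. a \<mu> \<nu> y * (- 1 * partial \<mu> k (x - y)))" for \<nu>
    unfolding dual_flux_def[abs_def] partial_reflect[OF k] by simp
  show ?thesis
    unfolding formal_transpose_def divergence_def flux partial_sum_test_fun[OF test_fun_mult[OF test_fun_coeff dk]]
      partial_mult_test_fun[OF test_fun_coeff dk] ddk
    by (simp add: mult_ac)
qed

lemma integral_formal_transpose_reflect:
  assumes k: "test_fun UNIV k" and w: "L2c w"
  shows "(\<integral>y. w y * formal_transpose (\<lambda>y. k (x - y)) y \<partial>lborel)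
    = divergence (\<lambda>\<mu> y. \<Sum>\<nu>\<in>UNIV. conv (partial \<nu> k) (\<lambda>y. a \<mu> \<nu> y * w y) y
        - conv k (\<lambda>y. partial \<nu> (a \<mu> \<nu>) y * w y) y) x"
proof -
  note partials = test_fun_partial[OF k]
  note products = L2c_test_fun_mult[OF test_fun_coeff w] L2c_test_fun_mult[OF test_fun_partial[OF test_fun_coeff] w]
  note convs = test_fun_conv[OF partials products(1)] test_fun_conv[OF k products(2)]
  have int: "integrable lborel (\<lambda>y. partial \<mu> (partial \<nu> k) (x - y) * (a \<mu> \<nu> y * w y))"
    "integrable lborel (\<lambda>y. partial \<mu> k (x - y) * (partial \<nu> (a \<mu> \<nu>) y * w y))" for \<mu> \<nu>
    by (intro conv_integrable test_fun_partial k products)+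
  have "w y * formal_transpose (\<lambda>y. k (x - y)) y = (\<Sum>\<nu>\<in>UNIV. \<Sum>\<mu>\<in>UNIV.
      partial \<mu> (partial \<nu> k) (x - y) * (a \<mu> \<nu> y * w y) - partial \<mu> k (x - y) * (partial \<nu> (a \<mu> \<nu>) y * w y))" for y
    unfolding formal_transpose_reflect[OF k] sum_distrib_left by (simp add: algebra_simps)
  then have "(\<integral>y. w y * formal_transpose (\<lambda>y. k (x - y)) y \<partial>lborel) = (\<Sum>\<nu>\<in>UNIV. \<Sum>\<mu>\<in>UNIV.
      conv (partial \<mu> (partial \<nu> k)) (\<lambda>y. a \<mu> \<nu> y * w y) x - conv (partial \<mu> k) (\<lambda>y. partial \<nu> (a \<mu> \<nu>) y * w y) x)"
    by (simp add: conv_def int)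
  also have "\<dots> = (\<Sum>\<mu>\<in>UNIV. \<Sum>\<nu>\<in>UNIV. partial \<mu>
      (\<lambda>y. conv (partial \<nu> k) (\<lambda>y. a \<mu> \<nu> y * w y) y - conv k (\<lambda>y. partial \<nu> (a \<mu> \<nu>) y * w y) y) x)"
    unfolding partial_diff_test_fun[OF convs] partial_conv[OF partials products(1)] partial_conv[OF k products(2)]
    by (rule sum.swap)
  finally show ?thesis
    unfolding divergence_def partial_sum_test_fun[OF test_fun_diff[OF convs]] .
qed

lemma mollified_equation:
  assumes k: "test_fun UNIV k" and w: "L2c w" and g: "\<And>\<mu>. L2c (g \<mu>)"
    and weak: "\<And>\<phi>. test_fun UNIV \<phi> \<Longrightarrow> (\<integral>x. w x * formal_transpose \<phi> x \<partial>lborel)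
       = (\<integral>x. g0 x * \<phi> x \<partial>lborel) - (\<Sum>\<mu>\<in>UNIV. \<integral>x. g \<mu> x * partial \<mu> \<phi> x \<partial>lborel)"
  shows "divergence (flux (conv k w)) = (\<lambda>x. conv k g0 x
    + divergence (\<lambda>\<mu> x. conv k (g \<mu>) x + (\<Sum>\<nu>\<in>UNIV. friedrichs_commutator k (a \<mu> \<nu>) \<nu> w x)) x)"
proof -
  let ?R = "\<lambda>\<mu> x. \<Sum>\<nu>\<in>UNIV. friedrichs_commutator k (a \<mu> \<nu>) \<nu> w x"
    and ?T = "\<lambda>\<mu> x. \<Sum>\<nu>\<in>UNIV. conv (partial \<nu> k) (\<lambda>y. a \<mu> \<nu> y * w y) x - conv k (\<lambda>y. partial \<nu> (a \<mu> \<nu>) y * w y) x"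
  have tests: "test_fun UNIV (?R \<mu>)" "test_fun UNIV (?T \<mu>)" "test_fun UNIV (conv k (g \<mu>))" for \<mu>
    by (intro test_fun_sum test_fun_friedrichs_commutator test_fun_diff test_fun_conv test_fun_partial
        L2c_test_fun_mult test_fun_coeff k w g)+
  have "flux (conv k w) = (\<lambda>\<mu> x. ?R \<mu> x + ?T \<mu> x)"
    unfolding flux_def[abs_def] partial_conv[OF k w] friedrichs_commutator_def sum.distrib[symmetric]
    by (intro ext sum.cong refl) simp
  then have "divergence (flux (conv k w)) x = divergence ?R x + divergence ?T x" for x
    by (simp only: divergence_add[OF tests(1,2)])
  moreover have "divergence ?T x = conv k g0 x + divergence (\<lambda>\<mu>. conv k (g \<mu>)) x" for x
    unfolding integral_formal_transpose_reflect[OF k w, symmetric] weak[OF test_fun_reflect[OF k]]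
        partial_reflect[OF k]
      divergence_def partial_conv[OF k g]
    by (simp add: conv_def mult.commute sum_negf)
  ultimately show ?thesis
    unfolding divergence_add[OF tests(3,1)] by (intro ext) simp
qed

end

definition uniformly_sobolev :: "nat \<Rightarrow> ('i \<Rightarrow> real^'n::finite \<Rightarrow> complex) \<Rightarrow> bool" where
  "uniformly_sobolev s w \<longleftrightarrow> (\<exists>M. \<forall>\<^sub>F e in at_right 0. \<forall>n. sobolev_sq s (conv (mollifier e) (w n)) \<le> M)"

definition locally_uniformly_sobolev :: "(real^'n::finite) set \<Rightarrow> nat \<Rightarrow> ('i \<Rightarrow> real^'n \<Rightarrow> complex) \<Rightarrow> bool" where
  "locally_uniformly_sobolev U s u \<longleftrightarrow> (\<forall>\<psi>. test_fun U \<psi> \<longrightarrow> uniformly_sobolev s (\<lambda>n x. \<psi> x * u n x))"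

lemma uniformly_sobolev_mono:
  assumes "s \<le> t" "uniformly_sobolev t w" shows "uniformly_sobolev s w"
proof -
  obtain M where "\<forall>\<^sub>F e in at_right 0. \<forall>n. sobolev_sq t (conv (mollifier e) (w n)) \<le> M"
    using assms(2) by (auto simp: uniformly_sobolev_def)
  then have "\<forall>\<^sub>F e in at_right 0. \<forall>n. sobolev_sq s (conv (mollifier e) (w n)) \<le> M"
    by (rule eventually_mono) (use order_trans[OF sobolev_sq_mono[OF assms(1)]] in blast)
  then show ?thesis by (auto simp: uniformly_sobolev_def)
qed

lemma locally_uniformly_sobolev_mono:
  "s \<le> t \<Longrightarrow> locally_uniformly_sobolev U t u \<Longrightarrow> locally_uniformly_sobolev U s u"
  using uniformly_sobolev_mono unfolding locally_uniformly_sobolev_def by blast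

lemma uniformly_sobolev_finite_family:
  fixes w :: "'j::finite \<Rightarrow> 'i \<Rightarrow> real^'n::finite \<Rightarrow> complex"
  assumes "\<And>j. uniformly_sobolev s (w j)"
  shows "uniformly_sobolev s (\<lambda>(j, n). w j n)"
proof -
  have "\<forall>j. \<exists>M. \<forall>\<^sub>F e in at_right 0. \<forall>n. sobolev_sq s (conv (mollifier e) (w j n)) \<le> M"
    using assms by (simp add: uniformly_sobolev_def)
  from choice[OF this] obtain M where
      M: "\<And>j. \<forall>\<^sub>F e in at_right 0. \<forall>n. sobolev_sq s (conv (mollifier e) (w j n)) \<le> M j"
    by blast
  have "\<forall>\<^sub>F e in at_right 0. \<forall>j n. sobolev_sq s (conv (mollifier e) (w j n)) \<le> M j"
    using M by (rule eventually_all_finite)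
  then have "\<forall>\<^sub>F e in at_right 0. \<forall>p. sobolev_sq s (conv (mollifier e) ((\<lambda>(j, n). w j n) p)) \<le> Max (range M)"
  proof (rule eventually_mono)
    fix e assume "\<forall>j n. sobolev_sq s (conv (mollifier e) (w j n)) \<le> M j"
    moreover have "M j \<le> Max (range M)" for j by simp
    ultimately show "\<forall>p. sobolev_sq s (conv (mollifier e) ((\<lambda>(j, n). w j n) p)) \<le> Max (range M)"
      using order_trans by fast
  qed
  then show ?thesis by (auto simp: uniformly_sobolev_def)
qed

lemma locally_uniformly_sobolev_0:
  assumes u: "\<And>n. L2c (u n)" and B: "\<And>n. L2sq lborel (u n) \<le> B"
  shows "locally_uniformly_sobolev U 0 u"
  unfolding locally_uniformly_sobolev_def
proof (intro allI impI)
  fix \<psi> assume "test_fun U \<psi>"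
  then have \<psi>: "test_fun UNIV \<psi>" by (rule test_fun_UNIV)
  obtain C where C: "C \<ge> 0" "\<And>w. L2c w \<Longrightarrow> L2sq lborel (\<lambda>x. \<psi> x * w x) \<le> C * L2sq lborel w"
    using L2sq_test_fun_mult[OF \<psi>] by metis
  have "L2sq lborel (conv (mollifier e) (\<lambda>x. \<psi> x * u n x)) \<le> C * B" if "e > 0" for n e
    using L2sq_conv_mollifier_le[OF that L2c_test_fun_mult[OF \<psi> u]] C(2)[OF u] mult_left_mono[OF B C(1)]
    by (meson order_trans)
  then have "\<forall>\<^sub>F e in at_right 0. \<forall>n. sobolev_sq 0 (conv (mollifier e) (\<lambda>x. \<psi> x * u n x)) \<le> C * B"
    using eventually_at_right_less[of "0::real"] by (auto elim: eventually_mono)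
  then show "uniformly_sobolev 0 (\<lambda>n x. \<psi> x * u n x)" by (auto simp: uniformly_sobolev_def)
qed

context elliptic
begin

lemma mollified_estimate:
  assumes C: "elliptic_bound (\<lambda>v. v) (Suc s) s C" and e: "e > 0"
    and \<psi>: "test_fun U \<psi>" and \<beta>: "test_fun UNIV \<beta>" and u: "L2c u" and g: "L2c g" and weak: "weak_solution \<beta> u g"
    and v: "test_fun U (conv (mollifier e) (\<lambda>x. \<psi> x * u x))"
    and v_le: "sobolev_sq s (conv (mollifier e) (\<lambda>x. \<psi> x * u x)) \<le> M"
    and source: "sobolev_sq (s - 1) (conv (mollifier e) (\<lambda>x. \<psi> x * \<beta> x * g x)) \<le> M\<^sub>g"
    and zeroth: "sobolev_sq (s - 1) (conv (mollifier e) (\<lambda>x. formal_transpose \<psi> x * u x)) \<le> M\<^sub>0"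
    and first: "\<And>\<mu>. sobolev_sq s (conv (mollifier e) (\<lambda>x. drift \<psi> \<mu> x * u x)) \<le> M\<^sub>1"
    and commutator: "\<And>\<mu> \<nu>. sobolev_sq s (friedrichs_commutator (mollifier e) (a \<mu> \<nu>) \<nu> (\<lambda>x. \<psi> x * u x)) \<le> K"
  shows "sobolev_sq (Suc s) (conv (mollifier e) (\<lambda>x. \<psi> x * u x))
    \<le> C * ((2 * M\<^sub>g + 2 * M\<^sub>0) + real CARD('n) * (2 * M\<^sub>1 + 2 * (2 ^ CARD('n) * (real CARD('n) * K))) + M)"
proof -
  let ?k = "mollifier e :: real^'n \<Rightarrow> complex" and ?w = "\<lambda>x. \<psi> x * u x"
  let ?h = "\<lambda>x. \<psi> x * \<beta> x * g x" and ?q = "\<lambda>x. formal_transpose \<psi> x * u x" and ?d = "\<lambda>\<mu> x. drift \<psi> \<mu> x * u x"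
  let ?R = "\<lambda>\<mu> x. \<Sum>\<nu>\<in>UNIV. friedrichs_commutator ?k (a \<mu> \<nu>) \<nu> ?w x"
  have \<psi>': "test_fun UNIV \<psi>" using \<psi> by (rule test_fun_UNIV)
  have k: "test_fun UNIV ?k" using e by (rule test_fun_mollifier)
  have L2c: "L2c ?w" "L2c ?h" "L2c ?q" "L2c (?d \<mu>)" for \<mu>
    by (intro L2c_test_fun_mult test_fun_mult test_fun_formal_transpose test_fun_drift \<psi>' \<beta> u g)+
  note convs = test_fun_conv[OF k L2c(2)] test_fun_conv[OF k L2c(3)] test_fun_conv[OF k L2c(4)]
  have R: "test_fun UNIV (friedrichs_commutator ?k (a \<mu> \<nu>) \<nu> ?w)" "test_fun UNIV (?R \<mu>)" for \<mu> \<nu>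
    by (intro test_fun_sum test_fun_friedrichs_commutator k test_fun_coeff L2c)+
  have "sobolev_sq (Suc s) (conv ?k ?w) \<le> C * (sobolev_sq (s - 1) (conv ?k (\<lambda>x. ?h x - ?q x))
      + (\<Sum>\<mu>\<in>UNIV. sobolev_sq s (\<lambda>x. conv ?k (?d \<mu>) x + ?R \<mu> x)) + L2sq lborel (conv ?k ?w))"
    by (rule elliptic_boundD(2)[OF C v test_fun_conv[OF k L2c_diff[OF L2c(2,3)]] test_fun_add[OF convs(3) R(2)]],
        rule mollified_equation[OF k L2c(1,4)],
        rule localized_equation[OF \<psi> _ \<beta> u g weak])
  also have "\<dots> \<le> C * ((2 * M\<^sub>g + 2 * M\<^sub>0) + real CARD('n) * (2 * M\<^sub>1 + 2 * (2 ^ CARD('n) * (real CARD('n) * K))) + M)"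
  proof (intro mult_left_mono add_mono elliptic_boundD(1)[OF C])
    show "sobolev_sq (s - 1) (conv ?k (\<lambda>x. ?h x - ?q x)) \<le> 2 * M\<^sub>g + 2 * M\<^sub>0"
      using sobolev_sq_diff_le[OF convs(1,2), of "s - 1"] source zeroth unfolding conv_diff[OF k L2c(2,3)]
      by linarith
    have "sobolev_sq s (\<lambda>x. conv ?k (?d \<mu>) x + ?R \<mu> x) \<le> 2 * M\<^sub>1 + 2 * (2 ^ CARD('n) * (real CARD('n) * K))" for \<mu>
    proof -
      have "sobolev_sq s (?R \<mu>) \<le> 2 ^ CARD('n) * (\<Sum>\<nu>\<in>UNIV. sobolev_sq s (friedrichs_commutator ?k (a \<mu> \<nu>) \<nu> ?w))"
        by (rule sobolev_sq_sum_le) (rule finite, rule R)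
      also have "\<dots> \<le> 2 ^ CARD('n) * (real CARD('n) * K)"
        by (intro mult_left_mono sum_bounded_above commutator) simp
      finally show ?thesis
        using sobolev_sq_add_le[OF convs(3) R(2), of s \<mu> \<mu>] first[of \<mu>] by linarith
    qed
    then show "(\<Sum>\<mu>\<in>UNIV. sobolev_sq s (\<lambda>x. conv ?k (?d \<mu>) x + ?R \<mu> x))
        \<le> real CARD('n) * (2 * M\<^sub>1 + 2 * (2 ^ CARD('n) * (real CARD('n) * K)))"
      by (intro sum_bounded_above)
    show "L2sq lborel (conv ?k ?w) \<le> M" using L2sq_le_sobolev_sq v_le by (rule order_trans)
  qed
  finally show ?thesis .
qed

lemma coeff_commutator_bounded:
  obtains C where "C \<ge> 0"
    "\<And>\<mu> \<nu> w M e. L2c w \<Longrightarrow> e > 0 \<Longrightarrow> \<forall>\<^sub>F d in at_right 0. sobolev_sq s (conv (mollifier d) w) \<le> M \<Longrightarrow>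
      sobolev_sq s (friedrichs_commutator (mollifier e) (a \<mu> \<nu>) \<nu> w) \<le> C * M"
proof -
  define bounded where "bounded C \<mu> \<nu> \<longleftrightarrow> C \<ge> 0 \<and> (\<forall>w M e. L2c w \<longrightarrow> e > 0 \<longrightarrow>
      (\<forall>\<^sub>F d in at_right 0. sobolev_sq s (conv (mollifier d) w) \<le> M) \<longrightarrow>
      sobolev_sq s (friedrichs_commutator (mollifier e) (a \<mu> \<nu>) \<nu> w) \<le> C * M)" for C \<mu> \<nu>
  have "\<exists>C. bounded C \<mu> \<nu>" for \<mu> \<nu>
    using friedrichs_commutator_bounded[OF test_fun_coeff[of \<mu> \<nu>], of s \<nu>] unfolding bounded_def by metis
  then have "\<forall>p. \<exists>C. bounded C (fst p) (snd p)" by blast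
  from choice[OF this] obtain C where C: "\<And>p. bounded (C p) (fst p) (snd p)" by blast
  show thesis
  proof (rule that[of "Max (range C)"])
    have Max: "C p \<le> Max (range C)" for p by (intro Max_ge) auto
    show "0 \<le> Max (range C)" using C[of undefined] order_trans[OF _ Max[of undefined], of 0]
      by (simp add: bounded_def)
    fix \<mu> \<nu> M and w :: "real^'n \<Rightarrow> complex" and e :: real
    assume w: "L2c w" and e: "e > 0" and M: "\<forall>\<^sub>F d in at_right 0. sobolev_sq s (conv (mollifier d) w) \<le> M"
    have "M \<ge> 0"
      using eventually_happens'[OF trivial_limit_at_right_real M] order_trans[OF sobolev_sq_nonneg] by blast
    then have "C (\<mu>, \<nu>) * M \<le> Max (range C) * M" by (intro mult_right_mono Max)
    then show "sobolev_sq s (friedrichs_commutator (mollifier e) (a \<mu> \<nu>) \<nu> w) \<le> Max (range C) * M"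
      using C[of "(\<mu>, \<nu>)"] w e M by (force simp: bounded_def)
  qed
qed

lemma regularity_step:
  assumes \<beta>: "test_fun UNIV \<beta>" and u: "\<And>n. L2c (u n)" and g: "\<And>n. L2c (g n)"
    and weak: "\<And>n. weak_solution \<beta> (u n) (g n)"
    and u_reg: "locally_uniformly_sobolev U s u" and g_reg: "locally_uniformly_sobolev U (s - 1) g"
  shows "locally_uniformly_sobolev U (Suc s) u"
  unfolding locally_uniformly_sobolev_def
proof (intro allI impI)
  fix \<psi> assume \<psi>: "test_fun U \<psi>"
  let ?w = "\<lambda>n x. \<psi> x * u n x"
  have \<psi>': "test_fun UNIV \<psi>" using \<psi> by (rule test_fun_UNIV)
  have w: "L2c (?w n)" for n by (intro L2c_test_fun_mult \<psi>' u)
  note u_reg' = u_reg[unfolded locally_uniformly_sobolev_def, rule_format]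
  have "\<exists>M. \<forall>\<^sub>F e in at_right 0. \<forall>n. sobolev_sq s (conv (mollifier e) (?w n)) \<le> M"
    using u_reg'[OF \<psi>] by (simp add: uniformly_sobolev_def)
  then obtain M where M: "\<forall>\<^sub>F e in at_right 0. \<forall>n. sobolev_sq s (conv (mollifier e) (?w n)) \<le> M" by blast
  obtain M\<^sub>g where M\<^sub>g: "\<forall>\<^sub>F e in at_right 0. \<forall>n. sobolev_sq (s - 1) (conv (mollifier e) (\<lambda>x. \<psi> x * \<beta> x * g n x)) \<le> M\<^sub>g"
    using g_reg test_fun_mult[OF \<psi> \<beta>] unfolding locally_uniformly_sobolev_def uniformly_sobolev_def by blast
  obtain M\<^sub>0 where M\<^sub>0: "\<forall>\<^sub>F e in at_right 0. \<forall>n.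
      sobolev_sq (s - 1) (conv (mollifier e) (\<lambda>x. formal_transpose \<psi> x * u n x)) \<le> M\<^sub>0"
    using uniformly_sobolev_mono[OF diff_le_self u_reg'[OF test_fun_formal_transpose[OF \<psi>]]]
    unfolding uniformly_sobolev_def by blast
  obtain M\<^sub>1 where M\<^sub>1: "\<forall>\<^sub>F e in at_right 0. \<forall>\<mu> n. sobolev_sq s (conv (mollifier e) (\<lambda>x. drift \<psi> \<mu> x * u n x)) \<le> M\<^sub>1"
    using uniformly_sobolev_finite_family[where w="\<lambda>\<mu> n x. drift \<psi> \<mu> x * u n x", OF u_reg'[OF test_fun_drift[OF \<psi>]]]
    by (auto simp: uniformly_sobolev_def)
  obtain C where C: "elliptic_bound (\<lambda>v. v) (Suc s) s C" using elliptic_estimate by blast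
  obtain D where D: "\<And>\<mu> \<nu> w M e. L2c w \<Longrightarrow> e > 0 \<Longrightarrow> \<forall>\<^sub>F d in at_right 0. sobolev_sq s (conv (mollifier d) w) \<le> M \<Longrightarrow>
      sobolev_sq s (friedrichs_commutator (mollifier e) (a \<mu> \<nu>) \<nu> w) \<le> D * M"
    by (rule coeff_commutator_bounded[of s]) blast
  have commutator: "sobolev_sq s (friedrichs_commutator (mollifier e) (a \<mu> \<nu>) \<nu> (?w n)) \<le> D * M"
    if "e > 0" for \<mu> \<nu> n e
    by (rule D[OF w that]) (use M in \<open>auto elim: eventually_mono\<close>)
  have "\<forall>\<^sub>F e in at_right 0. \<forall>n. test_fun U (conv (mollifier e) (?w n))"
    using eventually_test_fun_conv_mollifier[OF \<psi> open_U] w by (auto elim: eventually_mono)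
  then have "\<forall>\<^sub>F e in at_right 0. \<forall>n. sobolev_sq (Suc s) (conv (mollifier e) (?w n))
    \<le> C * ((2 * M\<^sub>g + 2 * M\<^sub>0) + real CARD('n) * (2 * M\<^sub>1 + 2 * (2 ^ CARD('n) * (real CARD('n) * (D * M)))) + M)"
    using M M\<^sub>g M\<^sub>0 M\<^sub>1 eventually_at_right_less
    by eventually_elim (intro allI mollified_estimate[OF C _ \<psi> \<beta> u g weak], auto intro: commutator)
  then show "uniformly_sobolev (Suc s) ?w" by (auto simp: uniformly_sobolev_def)
qed

text \<open>The function \<open>u k\<close> is merely in \<open>L\<^sup>2\<close>; each step down the chain gains two derivatives.\<close>
theorem regularity_chain:
  assumes \<beta>: "test_fun UNIV \<beta>" and u: "\<And>l n. l \<le> k \<Longrightarrow> L2c (u l n)" and B: "\<And>l n. l \<le> k \<Longrightarrow> L2sq lborel (u l n) \<le> B l"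
    and weak: "\<And>l n. l < k \<Longrightarrow> weak_solution \<beta> (u l n) (u (Suc l) n)"
  shows "j \<le> k \<Longrightarrow> locally_uniformly_sobolev U (2 * j) (u (k - j))"
proof (induction j)
  case 0
  have "locally_uniformly_sobolev U 0 (u k)" by (rule locally_uniformly_sobolev_0[OF u B]) simp_all
  then show ?case by simp
next
  case (Suc j)
  define l where "l = k - Suc j"
  have l: "Suc l = k - j" "l < k" using Suc.prems by (auto simp: l_def)
  have rhs: "locally_uniformly_sobolev U (2 * j) (u (Suc l))" using Suc by (simp add: l)
  have "t \<le> 2 * Suc j \<Longrightarrow> locally_uniformly_sobolev U t (u l)" for t
  proof (induction t)
    case 0
    show ?case by (rule locally_uniformly_sobolev_0[OF u B]) (use l in simp_all)
  next
    case (Suc t)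
    then have "locally_uniformly_sobolev U t (u l)" "locally_uniformly_sobolev U (t - 1) (u (Suc l))"
      using locally_uniformly_sobolev_mono[OF _ rhs] by simp_all
    then show ?case by (intro regularity_step[OF \<beta> u u weak[OF l(2)]]) (use l in simp_all)
  qed
  then show ?case by (simp add: l_def)
qed

end

section \<open>The Sobolev embedding\<close>

subsection \<open>Weighted means over dilations\<close>

text \<open>For a weight of integral \<open>1\<close>, \<open>mean \<psi> t v x\<close> interpolates between \<open>v x\<close> at \<open>t = 0\<close> and an average of \<open>v\<close>
  controlled by its \<open>L\<^sup>2\<close> norm; integrating the derivative in \<open>t\<close> trades powers of \<open>t\<close> for derivatives of \<open>v\<close>.\<close>
definition mean :: "(real^'n::finite \<Rightarrow> complex) \<Rightarrow> real \<Rightarrow> (real^'n \<Rightarrow> complex) \<Rightarrow> real^'n \<Rightarrow> complex" where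
  "mean \<psi> t v x = (\<integral>h. \<psi> h * v (x + t *\<^sub>R h) \<partial>lborel)"

lemma mean_integrable:
  assumes \<psi>: "L2c \<psi>" and v: "test_fun UNIV v"
  shows "integrable lborel (\<lambda>h. \<psi> h * v (x + t *\<^sub>R h))"
proof -
  obtain B where B: "\<And>x. norm (v x) \<le> B" using test_fun_bounded[OF v] by metis
  note [measurable] = test_fun_measurable[OF v] L2cD(2)[OF \<psi>]
  have "L2c (\<lambda>h. \<psi> h * v (x + t *\<^sub>R h))"
  proof (rule L2c_dominated(1)[OF \<psi>])
    show "norm (\<psi> h * v (x + t *\<^sub>R h)) \<le> B * norm (\<psi> h)" for h
      using mult_left_mono[OF B[of "x + t *\<^sub>R h"] norm_ge_zero[of "\<psi> h"]] by (simp add: norm_mult mult.commute)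
  qed measurable
  then show ?thesis by (rule L2c_integrable)
qed

lemma L2sq_affine:
  fixes v :: "real^'n::finite \<Rightarrow> complex"
  assumes v: "v \<in> borel_measurable borel" and t: "t > 0"
  shows "L2sq lborel (\<lambda>h. v (x + t *\<^sub>R h)) = (t powr (- (CARD('n) / 2)))\<^sup>2 * L2sq lborel v"
proof -
  have "L2sq lborel v = t ^ CARD('n) * L2sq lborel (\<lambda>h. v (x + t *\<^sub>R h))"
    unfolding L2sq_def using integral_lborel_affine[of "\<lambda>h. (norm (v h))\<^sup>2" t x] v t by simp
  then have "L2sq lborel (\<lambda>h. v (x + t *\<^sub>R h)) = t powr (- real CARD('n)) * L2sq lborel v"
    using t by (simp add: powr_minus powr_realpow field_simps)
  also have "t powr (- real CARD('n)) = (t powr (- (CARD('n) / 2)))\<^sup>2"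
    using t by (simp add: power2_eq_square powr_add[symmetric])
  finally show ?thesis .
qed

lemma mean_L2_bound:
  fixes v \<psi> :: "real^'n::finite \<Rightarrow> complex"
  assumes \<psi>: "L2c \<psi>" and v: "test_fun UNIV v" and t: "t > 0"
  shows "norm (mean \<psi> t v x) \<le> sqrt (L2sq lborel \<psi>) * (t powr (- (CARD('n) / 2)) * sqrt (L2sq lborel v))"
proof -
  have "test_fun UNIV (\<lambda>h. v (x + t *\<^sub>R h))" using test_fun_affine[OF v] t by simp
  from L2_Cauchy_Schwarz[OF L2cD(1)[OF \<psi>] L2cD(1)[OF test_fun_L2c[OF this]]] show ?thesis
    by (simp add: mean_def L2sq_affine[OF test_fun_measurable[OF v] t] real_sqrt_mult)
qed

lemma L2c_component_mult:
  fixes \<psi> :: "real^'n::finite \<Rightarrow> complex"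
  assumes \<psi>: "L2c \<psi>" shows "L2c (\<lambda>h. of_real (h $ i) * \<psi> h)"
proof -
  obtain R where R: "R > 0" "{x. \<psi> x \<noteq> 0} \<subseteq> cball 0 R" using bounded_support_cball[OF L2cD(3)[OF \<psi>]] by metis
  have [measurable]: "(\<lambda>h. h $ i) \<in> borel_measurable borel"
    by (intro borel_measurable_continuous_onI continuous_intros)
  note [measurable] = L2cD(2)[OF \<psi>]
  show ?thesis
  proof (rule L2c_dominated(1)[OF \<psi>])
    show "norm (of_real (h $ i) * \<psi> h) \<le> R * norm (\<psi> h)" for h
    proof (cases "\<psi> h = 0")
      case False
      then have "\<bar>h $ i\<bar> \<le> R" using R(2) component_le_norm_cart[of h i] by auto
      then show ?thesis by (simp add: norm_mult mult_right_mono)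
    qed simp
  qed measurable
qed

lemma mean_has_vector_derivative:
  assumes \<psi>: "L2c \<psi>" and v: "test_fun UNIV v"
  shows "((\<lambda>t. mean \<psi> t v x) has_vector_derivative
      (\<Sum>i\<in>UNIV. mean (\<lambda>h. of_real (h $ i) * \<psi> h) t (partial i v) x)) (at t)"
proof -
  obtain R where R: "R > 0" "{x. \<psi> x \<noteq> 0} \<subseteq> cball 0 R" using bounded_support_cball[OF L2cD(3)[OF \<psi>]] by metis
  obtain L where L: "L > 0" "\<And>x h. norm (frechet_derivative v (at x) h) \<le> L * norm h"
    using test_fun_frechet_derivative_bounded[OF v] by metis
  let ?f' = "\<lambda>t h s. \<psi> h * (s *\<^sub>R frechet_derivative v (at (x + t *\<^sub>R h)) h)"
  let ?summand = "\<lambda>t i h. of_real (h $ i) * \<psi> h * partial i v (x + t *\<^sub>R h)"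
  have int: "integrable lborel (?summand t i)" for t i
    by (rule mean_integrable[OF L2c_component_mult[OF \<psi>] test_fun_partial[OF v]])
  have f'_eq: "?f' t h s = s *\<^sub>R (\<Sum>i\<in>UNIV. ?summand t i h)" for t h s
    unfolding frechet_derivative_eq_sum_partial[OF test_fun_differentiable[OF v]]
    by (simp add: scaleR_conv_of_real sum_distrib_left mult_ac)
  have "((\<lambda>t. \<integral>h. \<psi> h * v (x + t *\<^sub>R h) \<partial>lborel) has_derivative (\<lambda>s. \<integral>h. ?f' t h s \<partial>lborel)) (at t)"
  proof (rule has_derivative_integral[where g="\<lambda>h. L * R * norm (\<psi> h)"])
    show "integrable lborel (\<lambda>h. \<psi> h * v (x + t *\<^sub>R h))" for t by (rule mean_integrable[OF \<psi> v])
    show "integrable lborel (\<lambda>h. L * R * norm (\<psi> h))" using L2c_integrable[OF \<psi>] by simp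
    fix t h s
    have "((\<lambda>t. x + t *\<^sub>R h) has_derivative (\<lambda>s. s *\<^sub>R h)) (at t)" by (auto intro!: derivative_eq_intros)
    from has_derivative_mult_right[OF has_derivative_compose[OF this test_fun_has_derivative[OF v]]]
    show "((\<lambda>t. \<psi> h * v (x + t *\<^sub>R h)) has_derivative ?f' t h) (at t)"
      by (simp add: linear_cmul[OF has_derivative_linear[OF test_fun_has_derivative[OF v]]])
    show "norm (?f' t h s) \<le> L * R * norm (\<psi> h) * norm s"
    proof (cases "\<psi> h = 0")
      case False
      then have "L * norm h \<le> L * R" using R(2) L(1) by auto
      from order_trans[OF L(2) this]
      have "norm (\<psi> h) * norm s * norm (frechet_derivative v (at (x + t *\<^sub>R h)) h) \<le> norm (\<psi> h) * norm s * (L * R)"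
        by (intro mult_left_mono) auto
      then show ?thesis by (simp add: norm_mult mult_ac)
    qed simp
    show "(\<lambda>h. ?f' t h s) \<in> borel_measurable lborel"
      unfolding f'_eq
      by (intro borel_measurable_integrable integrable_scaleR_right Bochner_Integration.integrable_sum int)
  qed
  then show ?thesis
    unfolding f'_eq has_vector_derivative_def mean_def by (simp add: int)
qed

definition mean_bound :: "real \<Rightarrow> nat \<Rightarrow> real \<Rightarrow> (real^'n::finite \<Rightarrow> complex) \<Rightarrow> bool" where
  "mean_bound \<gamma> s C \<psi> \<longleftrightarrow> C \<ge> 0 \<and> (\<forall>v x t. test_fun UNIV v \<longrightarrow> 0 < t \<longrightarrow> t \<le> 1 \<longrightarrow>
     norm (mean \<psi> t v x) \<le> C * t powr (- \<gamma>) * sqrt (sobolev_sq s v))"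

lemma mean_boundD:
  assumes "mean_bound \<gamma> s C \<psi>"
  shows "C \<ge> 0" "test_fun UNIV v \<Longrightarrow> 0 < t \<Longrightarrow> t \<le> 1 \<Longrightarrow>
    norm (mean \<psi> t v x) \<le> C * t powr (- \<gamma>) * sqrt (sobolev_sq s v)"
  using assms by (auto simp: mean_bound_def)

lemma has_vector_derivative_powr_primitive:
  assumes "\<gamma> \<noteq> 1" "x > 0"
  shows "((\<lambda>\<tau>. K * (\<tau> powr (1 - \<gamma>) / (1 - \<gamma>))) has_vector_derivative K * x powr (- \<gamma>)) (at x)"
proof -
  have "((\<lambda>\<tau>. K * (\<tau> powr (1 - \<gamma>) / (1 - \<gamma>))) has_real_derivative K * x powr (- \<gamma>)) (at x)"
    using DERIV_cmult[OF DERIV_cdivide[OF has_real_derivative_powr[OF assms(2), of "1 - \<gamma>"],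
        of "1 - \<gamma>"], of K] assms(1)
    by simp
  then show ?thesis by (simp add: has_real_derivative_iff_has_vector_derivative)
qed

lemma mean_diff_le:
  fixes v :: "real^'n::finite \<Rightarrow> complex"
  assumes \<psi>: "L2c \<psi>" and C: "\<And>i. mean_bound \<gamma> s (C i) (\<lambda>h. of_real (h $ i) * \<psi> h)" and v: "test_fun UNIV v"
    and \<gamma>: "\<gamma> \<noteq> 1" "r = 0 \<Longrightarrow> \<gamma> < 1" and t: "0 \<le> r" "r \<le> t" "t \<le> 1"
  shows "norm (mean \<psi> t v x - mean \<psi> r v x)
    \<le> (\<Sum>i\<in>UNIV. C i) * sqrt (sobolev_sq (Suc s) v) * ((t powr (1 - \<gamma>) - r powr (1 - \<gamma>)) / (1 - \<gamma>))"
proof (cases "r = t")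
  case False
  let ?K = "(\<Sum>i\<in>UNIV. C i) * sqrt (sobolev_sq (Suc s) v)"
  let ?primitive = "\<lambda>\<tau>. ?K * (\<tau> powr (1 - \<gamma>) / (1 - \<gamma>))"
  let ?derivative = "\<lambda>t. \<Sum>i\<in>UNIV. mean (\<lambda>h. of_real (h $ i) * \<psi> h) t (partial i v) x"
  note deriv = mean_has_vector_derivative[OF \<psi> v, of x]
  have "norm (mean \<psi> t v x - mean \<psi> r v x) \<le> ?primitive t - ?primitive r"
  proof (rule differentiable_bound_general[where f="\<lambda>t. mean \<psi> t v x" and f'="?derivative" and \<phi>="?primitive"
        and \<phi>'="\<lambda>\<tau>. ?K * \<tau> powr (- \<gamma>)"])
    show "r < t" using False t by simp
    show "continuous_on {r..t} (\<lambda>t. mean \<psi> t v x)"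
      by (intro continuous_at_imp_continuous_on ballI has_vector_derivative_continuous[OF deriv])
    show "continuous_on {r..t} ?primitive"
      using \<gamma> t
      by (intro continuous_on_mult continuous_on_divide continuous_on_const continuous_on_powr' continuous_on_id)
          auto
    fix \<tau> assume \<tau>: "r < \<tau>" "\<tau> < t"
    then show "(?primitive has_vector_derivative ?K * \<tau> powr (- \<gamma>)) (at \<tau>)"
      using t by (intro has_vector_derivative_powr_primitive \<gamma>) simp
    have "norm (?derivative \<tau>) \<le> (\<Sum>i\<in>UNIV. C i * (sqrt (sobolev_sq (Suc s) v) * \<tau> powr (- \<gamma>)))"
    proof (rule sum_norm_le)
      fix i
      have "norm (mean (\<lambda>h. of_real (h $ i) * \<psi> h) \<tau> (partial i v) x)
          \<le> C i * \<tau> powr (- \<gamma>) * sqrt (sobolev_sq s (partial i v))"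
        using \<tau> t by (intro mean_boundD(2)[OF C test_fun_partial[OF v]]) auto
      also have "\<dots> \<le> C i * \<tau> powr (- \<gamma>) * sqrt (sobolev_sq (Suc s) v)"
        by (intro mult_left_mono real_sqrt_le_mono sobolev_sq_partial_le mult_nonneg_nonneg mean_boundD(1)[OF C])
            simp
      finally show "norm (mean (\<lambda>h. of_real (h $ i) * \<psi> h) \<tau> (partial i v) x)
          \<le> C i * (sqrt (sobolev_sq (Suc s) v) * \<tau> powr (- \<gamma>))"
        by (simp only: mult_ac)
    qed
    then show "norm (?derivative \<tau>) \<le> ?K * \<tau> powr (- \<gamma>)" by (simp only: sum_distrib_right mult.assoc)
  qed (rule deriv)
  then show ?thesis by (simp add: right_diff_distrib diff_divide_distrib)
qed simp

lemma mean_bound_0: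
  fixes \<psi> :: "real^'n::finite \<Rightarrow> complex"
  assumes \<psi>: "L2c \<psi>" and \<gamma>: "\<gamma> \<ge> CARD('n) / 2"
  shows "mean_bound \<gamma> 0 (sqrt (L2sq lborel \<psi>)) \<psi>"
  unfolding mean_bound_def
proof (intro conjI allI impI)
  fix v :: "real^'n \<Rightarrow> complex" and x and t :: real
  assume v: "test_fun UNIV v" and t: "0 < t" "t \<le> 1"
  have "t powr (- (CARD('n) / 2)) \<le> t powr (- \<gamma>)" using t \<gamma> by (intro powr_mono') auto
  then have "sqrt (L2sq lborel \<psi>) * (t powr (- (CARD('n) / 2)) * sqrt (L2sq lborel v))
      \<le> sqrt (L2sq lborel \<psi>) * (t powr (- \<gamma>) * sqrt (L2sq lborel v))"
    by (intro mult_left_mono mult_right_mono) auto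
  then show "norm (mean \<psi> t v x) \<le> sqrt (L2sq lborel \<psi>) * t powr (- \<gamma>) * sqrt (sobolev_sq 0 v)"
    using mean_L2_bound[OF \<psi> v t(1), of x] by (simp add: mult.assoc)
qed simp

lemma mean_bound_Suc:
  fixes \<psi> :: "real^'n::finite \<Rightarrow> complex"
  assumes \<psi>: "L2c \<psi>" and C: "\<And>i. mean_bound \<gamma>' s (C i) (\<lambda>h. of_real (h $ i) * \<psi> h)"
    and \<gamma>: "\<gamma> > 0 \<and> \<gamma>' = \<gamma> + 1 \<or> \<gamma> = 0 \<and> \<gamma>' < 1"
  shows "mean_bound \<gamma> (Suc s) (sqrt (L2sq lborel \<psi>) + (\<Sum>i\<in>UNIV. C i) / \<bar>1 - \<gamma>'\<bar>) \<psi>"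
  unfolding mean_bound_def
proof (intro conjI allI impI)
  let ?K = "\<Sum>i\<in>UNIV. C i"
  have K_nonneg: "0 \<le> ?K" by (intro sum_nonneg mean_boundD(1)[OF C])
  then show "0 \<le> sqrt (L2sq lborel \<psi>) + ?K / \<bar>1 - \<gamma>'\<bar>" by simp
  fix v :: "real^'n \<Rightarrow> complex" and x and t :: real
  assume v: "test_fun UNIV v" and t: "0 < t" "t \<le> 1"
  let ?N = "sqrt (sobolev_sq (Suc s) v)"
  have powr_ge: "1 \<le> t powr (- \<gamma>)" using powr_mono'[of "- \<gamma>" 0 t] t \<gamma> by auto
  have "(1 - t powr (1 - \<gamma>')) / (1 - \<gamma>') \<le> t powr (- \<gamma>) / \<bar>1 - \<gamma>'\<bar>"
    using \<gamma>
  proof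
    assume "\<gamma> = 0 \<and> \<gamma>' < 1"
    then show ?thesis using t by (simp add: divide_right_mono)
  next
    assume "\<gamma> > 0 \<and> \<gamma>' = \<gamma> + 1"
    then show ?thesis by (simp add: field_simps)
  qed
  then have "?K * ?N * ((1 powr (1 - \<gamma>') - t powr (1 - \<gamma>')) / (1 - \<gamma>')) \<le> ?K * ?N * (t powr (- \<gamma>) / \<bar>1 - \<gamma>'\<bar>)"
    using K_nonneg by (intro mult_left_mono) auto
  moreover have "norm (mean \<psi> 1 v x - mean \<psi> t v x) \<le> ?K * ?N * ((1 powr (1 - \<gamma>') - t powr (1 - \<gamma>')) / (1 - \<gamma>'))"
    using \<gamma> t by (intro mean_diff_le[OF \<psi> C v]) auto
  moreover have "norm (mean \<psi> 1 v x) \<le> sqrt (L2sq lborel \<psi>) * (?N * t powr (- \<gamma>))"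
  proof -
    have "norm (mean \<psi> 1 v x) \<le> sqrt (L2sq lborel \<psi>) * (sqrt (L2sq lborel v) * 1)"
      using mean_L2_bound[OF \<psi> v, of 1 x] by simp
    also have "\<dots> \<le> sqrt (L2sq lborel \<psi>) * (?N * t powr (- \<gamma>))"
      by (intro mult_left_mono mult_mono real_sqrt_le_mono L2sq_le_sobolev_sq powr_ge) auto
    finally show ?thesis .
  qed
  moreover have "norm (mean \<psi> t v x) \<le> norm (mean \<psi> 1 v x) + norm (mean \<psi> 1 v x - mean \<psi> t v x)"
    using norm_triangle_ineq4[of "mean \<psi> 1 v x" "mean \<psi> 1 v x - mean \<psi> t v x"] by simp
  ultimately have "norm (mean \<psi> t v x) \<le> sqrt (L2sq lborel \<psi>) * (?N * t powr (- \<gamma>))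
      + ?K * ?N * (t powr (- \<gamma>) / \<bar>1 - \<gamma>'\<bar>)"
    by linarith
  then show "norm (mean \<psi> t v x) \<le> (sqrt (L2sq lborel \<psi>) + ?K / \<bar>1 - \<gamma>'\<bar>) * t powr (- \<gamma>) * ?N"
    by (simp add: algebra_simps)
qed

lemma mean_bound_exists:
  fixes \<psi> :: "real^'n::finite \<Rightarrow> complex"
  shows "L2c \<psi> \<Longrightarrow> \<gamma> \<ge> 0 \<Longrightarrow> \<gamma> > real CARD('n) / 2 - real s \<Longrightarrow> \<exists>C. mean_bound \<gamma> s C \<psi>"
proof (induction s arbitrary: \<psi> \<gamma>)
  case 0
  then show ?case using mean_bound_0[of \<psi> \<gamma>] by auto
next
  case (Suc s)
  define \<gamma>' where "\<gamma>' = (if \<gamma> > 0 then \<gamma> + 1 else max 0 ((real CARD('n) / 2 - real s + 1) / 2))"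
  have "\<gamma>' \<ge> 0" "\<gamma>' > real CARD('n) / 2 - real s" and \<gamma>': "\<gamma> > 0 \<and> \<gamma>' = \<gamma> + 1 \<or> \<gamma> = 0 \<and> \<gamma>' < 1"
    using Suc.prems(2,3) by (auto simp: \<gamma>'_def max_def)
  then have "\<forall>i. \<exists>C. mean_bound \<gamma>' s C (\<lambda>h. of_real (h $ i) * \<psi> h)"
    using Suc.IH[OF L2c_component_mult[OF Suc.prems(1)]] by blast
  from choice[OF this] obtain C where "\<And>i. mean_bound \<gamma>' s (C i) (\<lambda>h. of_real (h $ i) * \<psi> h)" by blast
  from mean_bound_Suc[OF Suc.prems(1) this \<gamma>'] show ?case by blast
qed

subsection \<open>Ehrling inequalities\<close>

lemma exists_small_multiple:
  fixes A e :: real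
  assumes "A \<ge> 0" "e > 0"
  obtains \<delta> where "\<delta> > 0" "A * \<delta> \<le> e"
  using assms by (intro that[of "e / (A + 1)"]) (auto simp: field_simps add_nonneg_pos)

lemma exists_small_powr:
  assumes "p > 0" "\<eta> > 0"
  obtains t :: real where "0 < t" "t \<le> 1" "K * t powr p \<le> \<eta>"
proof -
  have "((\<lambda>t. t powr p) \<longlongrightarrow> 0) (at_right (0::real))"
    by (rule tendsto_zero_powrI[OF tendsto_ident_at tendsto_const])
       (use assms(1) eventually_mono[OF eventually_at_right_less[of 0] less_imp_le] in auto)
  then have "((\<lambda>t. K * t powr p) \<longlongrightarrow> 0) (at_right 0)" using tendsto_mult_right_zero by blast
  then have "\<forall>\<^sub>F t in at_right 0. K * t powr p < \<eta>" using assms(2) by (rule order_tendstoD)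
  moreover have "\<forall>\<^sub>F t in at_right (0::real). 0 < t \<and> t < 1" using eventually_at_right_real[of 0 1] by simp
  ultimately have "\<forall>\<^sub>F t in at_right 0. K * t powr p < \<eta> \<and> 0 < t \<and> t < 1" by eventually_elim auto
  from eventually_happens'[OF trivial_limit_at_right_real this] that show ?thesis by auto
qed

theorem ehrling_sup:
  assumes s: "real s > real CARD('n::finite) / 2" and \<eta>: "\<eta> > 0"
  shows "\<exists>C\<ge>0. \<forall>(v::real^'n \<Rightarrow> complex) x. test_fun UNIV v \<longrightarrow>
    norm (v x) \<le> \<eta> * sqrt (sobolev_sq s v) + C * sqrt (L2sq lborel v)"
proof -
  obtain r where r: "s = Suc r" using s by (cases s) auto
  let ?\<psi> = "mollifier 1 :: real^'n \<Rightarrow> complex"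
  have \<psi>: "L2c ?\<psi>" by (intro test_fun_L2c test_fun_mollifier) simp
  define \<gamma> where "\<gamma> = max 0 ((real CARD('n) / 2 - real r + 1) / 2)"
  have \<gamma>: "\<gamma> \<ge> 0" "\<gamma> > real CARD('n) / 2 - real r" "\<gamma> < 1" using s by (auto simp: \<gamma>_def r max_def)
  have "\<forall>i. \<exists>C. mean_bound \<gamma> r C (\<lambda>h. of_real (h $ i) * ?\<psi> h)"
    by (intro allI mean_bound_exists L2c_component_mult \<psi> \<gamma>)
  from choice[OF this] obtain C where C: "\<And>i. mean_bound \<gamma> r (C i) (\<lambda>h. of_real (h $ i) * ?\<psi> h)" by blast
  obtain t where t: "0 < t" "t \<le> 1" "(\<Sum>i\<in>UNIV. C i) / (1 - \<gamma>) * t powr (1 - \<gamma>) \<le> \<eta>"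
    using exists_small_powr[of "1 - \<gamma>" \<eta> "(\<Sum>i\<in>UNIV. C i) / (1 - \<gamma>)"] \<gamma>(3) \<eta> by auto
  have "norm (v x) \<le> \<eta> * sqrt (sobolev_sq s v)
      + sqrt (L2sq lborel ?\<psi>) * t powr (- (CARD('n) / 2)) * sqrt (L2sq lborel v)"
    if v: "test_fun UNIV v" for v :: "real^'n \<Rightarrow> complex" and x
  proof -
    have "norm (mean ?\<psi> t v x - mean ?\<psi> 0 v x)
        \<le> (\<Sum>i\<in>UNIV. C i) / (1 - \<gamma>) * t powr (1 - \<gamma>) * sqrt (sobolev_sq s v)"
      using mean_diff_le[OF \<psi> C v, of 0 t x] \<gamma>(3) t by (simp add: r mult_ac)
    also have "\<dots> \<le> \<eta> * sqrt (sobolev_sq s v)" using t(3) by (intro mult_right_mono) auto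
    finally have "norm (mean ?\<psi> t v x - mean ?\<psi> 0 v x) \<le> \<eta> * sqrt (sobolev_sq s v)" .
    moreover have "mean ?\<psi> 0 v x = v x" using integral_mollifier[of 1, where 'a="real^'n"] by (simp add: mean_def)
    ultimately show ?thesis
      using mean_L2_bound[OF \<psi> v t(1), of x] norm_triangle_ineq4[of "mean ?\<psi> t v x" "mean ?\<psi> t v x - mean ?\<psi> 0 v x"]
      by (simp add: mult.assoc)
  qed
  then show ?thesis by (intro exI[of _ "sqrt (L2sq lborel ?\<psi>) * t powr (- (CARD('n) / 2))"]) simp
qed

lemma L2sq_partial_le:
  assumes v: "test_fun UNIV v"
  shows "L2sq lborel (partial i v) \<le> sqrt (L2sq lborel v) * sqrt (L2sq lborel (partial i (partial i v)))"
proof -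
  have tests: "test_fun UNIV (partial i v)" "test_fun UNIV (partial i (partial i v))" by (intro test_fun_partial v)+
  have "complex_of_real (L2sq lborel (partial i v)) = (\<integral>x. of_real ((norm (partial i v x))\<^sup>2) \<partial>lborel)"
    by (simp only: L2sq_def integral_complex_of_real)
  also have "\<dots> = (\<integral>x. partial i v x * cnj (partial i v x) \<partial>lborel)"
    by (simp only: complex_norm_square)
  also have "\<dots> = - (\<integral>x. v x * cnj (partial i (partial i v) x) \<partial>lborel)"
    using integral_by_parts[OF v test_fun_cnj[OF tests(1)], of i] by (simp add: partial_cnj[OF tests(1)])
  finally have "norm (complex_of_real (L2sq lborel (partial i v)))
      = norm (\<integral>x. v x * cnj (partial i (partial i v) x) \<partial>lborel)"
    by simp
  then show ?thesis
    using L2_Cauchy_Schwarz[OF L2cD(1)[OF test_fun_L2c[OF v]]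
        L2cD(1)[OF test_fun_L2c[OF test_fun_cnj[OF tests(2)]]]] by simp
qed

lemma ehrling_partial:
  assumes v: "test_fun UNIV v" and \<delta>: "\<delta> > 0"
  shows "sqrt (L2sq lborel (partial i v)) \<le> \<delta> * sqrt (sobolev_sq (Suc (Suc 0)) v) + 1 / \<delta> * sqrt (L2sq lborel v)"
proof (rule real_le_lsqrt)
  let ?A = "1 / \<delta> * sqrt (L2sq lborel v)" and ?B = "\<delta> * sqrt (sobolev_sq (Suc (Suc 0)) v)"
  show "0 \<le> ?B + ?A" using \<delta> by simp
  have "L2sq lborel (partial i (partial i v)) \<le> sobolev_sq (Suc (Suc 0)) v"
    using sobolev_sq_partial_le[of 0 i "partial i v"] sobolev_sq_partial_le[of "Suc 0" i v] by simp
  then have "sqrt (L2sq lborel v) * sqrt (L2sq lborel (partial i (partial i v)))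
      \<le> sqrt (L2sq lborel v) * sqrt (sobolev_sq (Suc (Suc 0)) v)"
    by (intro mult_left_mono real_sqrt_le_mono) auto
  then have "L2sq lborel (partial i v) \<le> ?A * ?B" using L2sq_partial_le[OF v, of i] \<delta> by simp
  also have "\<dots> \<le> (?B + ?A)\<^sup>2" using \<delta> by (simp add: power2_sum)
  finally show "L2sq lborel (partial i v) \<le> (?B + ?A)\<^sup>2" .
qed

lemma Ck_bounded_Suc_test_funI:
  fixes v :: "real^'n::finite \<Rightarrow> complex"
  assumes v: "test_fun UNIV v" and "\<And>x. norm (v x) \<le> D" and "\<And>i. Ck_bounded m UNIV D (partial i v)"
  shows "Ck_bounded (Suc m) UNIV D v"
proof (rule Ck_bounded_SucI[OF open_UNIV test_fun_has_derivative[OF v]])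
  fix h :: "real^'n" assume "h \<in> Basis"
  then obtain i where "h = axis i 1" by (auto simp: Basis_vec_def)
  then show "Ck_bounded m UNIV D (\<lambda>x. frechet_derivative v (at x) h)"
    using assms(3)[of i] by (simp add: partial_def[abs_def])
qed (rule assms(2))

theorem ehrling_Ck:
  assumes s: "real s > real CARD('n::finite) / 2"
  shows "\<eta> > 0 \<Longrightarrow> \<exists>C\<ge>0. \<forall>v::real^'n \<Rightarrow> complex. test_fun UNIV v \<longrightarrow>
    Ck_bounded m UNIV (\<eta> * sqrt (sobolev_sq (m + s) v) + C * sqrt (L2sq lborel v)) v"
proof (induction m arbitrary: \<eta>)
  case 0
  then show ?case using ehrling_sup[OF s] by (simp add: test_fun_continuous_on)
next
  case (Suc m)
  obtain C where C: "C \<ge> 0" "\<And>(v::real^'n \<Rightarrow> complex) x. test_fun UNIV v \<Longrightarrow>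
      norm (v x) \<le> \<eta> * sqrt (sobolev_sq s v) + C * sqrt (L2sq lborel v)"
    using ehrling_sup[OF s Suc.prems] by blast
  obtain D where D: "D \<ge> 0" "\<And>v::real^'n \<Rightarrow> complex. test_fun UNIV v \<Longrightarrow>
      Ck_bounded m UNIV (\<eta> / 2 * sqrt (sobolev_sq (m + s) v) + D * sqrt (L2sq lborel v)) v"
    using Suc.IH[of "\<eta> / 2"] Suc.prems by auto
  obtain \<delta> where \<delta>: "\<delta> > 0" "D * \<delta> \<le> \<eta> / 2" using exists_small_multiple[OF D(1), of "\<eta> / 2"] Suc.prems by auto
  show ?case
  proof (intro exI[of _ "C + D / \<delta>"] conjI allI impI)
    show "0 \<le> C + D / \<delta>" using C(1) D(1) \<delta>(1) by simp
    fix v :: "real^'n \<Rightarrow> complex" assume v: "test_fun UNIV v"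
    let ?N = "sqrt (sobolev_sq (Suc m + s) v)" and ?V = "sqrt (L2sq lborel v)"
    have s_pos: "s \<ge> 1" using s by (cases s) auto
    show "Ck_bounded (Suc m) UNIV (\<eta> * ?N + (C + D / \<delta>) * ?V) v"
    proof (rule Ck_bounded_Suc_test_funI[OF v])
      fix x
      have "norm (v x) \<le> \<eta> * sqrt (sobolev_sq s v) + C * ?V" by (rule C(2)[OF v])
      also have "\<dots> \<le> \<eta> * ?N + (C + D / \<delta>) * ?V"
        using Suc.prems D(1) \<delta>(1)
        by (intro add_mono mult_left_mono mult_right_mono real_sqrt_le_mono sobolev_sq_mono) auto
      finally show "norm (v x) \<le> \<eta> * ?N + (C + D / \<delta>) * ?V" .
    next
      fix i
      have "sqrt (L2sq lborel (partial i v)) \<le> \<delta> * ?N + 1 / \<delta> * ?V"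
        by (rule order_trans[OF ehrling_partial[OF v \<delta>(1)]])
           (use s_pos \<delta>(1) in \<open>auto intro!: sobolev_sq_mono\<close>)
      then have "D * sqrt (L2sq lborel (partial i v)) \<le> D * (\<delta> * ?N + 1 / \<delta> * ?V)" by (intro mult_left_mono D(1))
      moreover have "D * \<delta> * ?N \<le> \<eta> / 2 * ?N" by (intro mult_right_mono \<delta>(2)) simp
      moreover have "\<eta> / 2 * sqrt (sobolev_sq (m + s) (partial i v)) \<le> \<eta> / 2 * ?N"
        using Suc.prems sobolev_sq_partial_le[of "m + s" i v] by (intro mult_left_mono real_sqrt_le_mono) auto
      moreover have "0 \<le> C * ?V" using C(1) by simp
      ultimately have "\<eta> / 2 * sqrt (sobolev_sq (m + s) (partial i v)) + D * sqrt (L2sq lborel (partial i v))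
          \<le> \<eta> * ?N + (C + D / \<delta>) * ?V"
        by (simp add: algebra_simps)
      then show "Ck_bounded m UNIV (\<eta> * ?N + (C + D / \<delta>) * ?V) (partial i v)"
        by (rule Ck_bounded_mono[OF _ D(2)[OF test_fun_partial[OF v]]])
    qed
  qed
qed

subsection \<open>Embedding of functions with bounded mollified Sobolev norms\<close>

lemma Ck_Cauchy_of_sobolev_bounded:
  fixes v :: "nat \<Rightarrow> real^'n::finite \<Rightarrow> complex"
  assumes s: "real s > real CARD('n) / 2" and v: "\<And>j. test_fun UNIV (v j)" and M: "\<And>j. sobolev_sq (m + s) (v j) \<le> M"
    and w: "square_integrable lborel w" and lim: "(\<lambda>j. L2sq lborel (\<lambda>x. v j x - w x)) \<longlonglongrightarrow> 0"
  shows "Ck_Cauchy m UNIV v"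
  unfolding Ck_Cauchy_def
proof (intro conjI allI impI)
  show "Ck m UNIV (v j)" for j using v[of j] by (simp add: test_fun_def smooth_on_def)
  fix e :: real assume e: "e > 0"
  have "M \<ge> 0" using M[of 0] sobolev_sq_nonneg[of "m + s" "v 0"] by linarith
  obtain \<eta> where \<eta>: "\<eta> > 0" "2 * sqrt M * \<eta> \<le> e / 2" using exists_small_multiple[of "2 * sqrt M" "e / 2"] \<open>M \<ge> 0\<close> e
    by auto
  obtain C where C: "C \<ge> 0" "\<And>v::real^'n \<Rightarrow> complex. test_fun UNIV v \<Longrightarrow>
      Ck_bounded m UNIV (\<eta> * sqrt (sobolev_sq (m + s) v) + C * sqrt (L2sq lborel v)) v"
    using ehrling_Ck[OF s \<eta>(1)] by blast
  obtain \<theta> where \<theta>: "\<theta> > 0" "2 * C * \<theta> \<le> e / 2" using exists_small_multiple[of "2 * C" "e / 2"] C(1) e by auto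
  then have "\<forall>\<^sub>F j in sequentially. L2sq lborel (\<lambda>x. v j x - w x) < \<theta>\<^sup>2" by (intro order_tendstoD[OF lim]) simp
  then obtain N where N: "\<And>j. j \<ge> N \<Longrightarrow> L2sq lborel (\<lambda>x. v j x - w x) < \<theta>\<^sup>2"
    by (auto simp: eventually_sequentially)
  show "\<exists>N. \<forall>i\<ge>N. \<forall>j\<ge>N. Ck_bounded m UNIV e (\<lambda>x. v i x - v j x)"
  proof (intro exI[of _ N] allI impI)
    fix i j assume ij: "i \<ge> N" "j \<ge> N"
    have diff: "square_integrable lborel (\<lambda>x. v j x - w x)" for j
      by (intro square_integrable_diff(1) w L2cD(1) test_fun_L2c v)
    have "L2sq lborel (\<lambda>x. v i x - v j x) \<le> 2 * L2sq lborel (\<lambda>x. v i x - w x) + 2 * L2sq lborel (\<lambda>x. v j x - w x)"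
      using square_integrable_diff(2)[OF diff diff, of i j] by simp
    also have "\<dots> \<le> (2 * \<theta>)\<^sup>2" using N[OF ij(1)] N[OF ij(2)] by (simp add: power_mult_distrib)
    finally have "sqrt (L2sq lborel (\<lambda>x. v i x - v j x)) \<le> 2 * \<theta>" using \<theta>(1) by (intro real_le_lsqrt) auto
    from mult_left_mono[OF this C(1)]
    have "C * sqrt (L2sq lborel (\<lambda>x. v i x - v j x)) \<le> e / 2" using \<theta>(2) by (simp add: mult_ac)
    moreover have "sobolev_sq (m + s) (\<lambda>x. v i x - v j x) \<le> (2 * sqrt M)\<^sup>2"
      using sobolev_sq_diff_le[OF v v, of "m + s" i j] M[of i] M[of j] \<open>M \<ge> 0\<close> by (simp add: power_mult_distrib)
    then have "sqrt (sobolev_sq (m + s) (\<lambda>x. v i x - v j x)) \<le> 2 * sqrt M" using \<open>M \<ge> 0\<close>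
      by (intro real_le_lsqrt) auto
    from mult_left_mono[OF this less_imp_le[OF \<eta>(1)]]
    have "\<eta> * sqrt (sobolev_sq (m + s) (\<lambda>x. v i x - v j x)) \<le> e / 2" using \<eta>(2) by (simp add: mult_ac)
    ultimately have "\<eta> * sqrt (sobolev_sq (m + s) (\<lambda>x. v i x - v j x))
        + C * sqrt (L2sq lborel (\<lambda>x. v i x - v j x)) \<le> e"
      by linarith
    then show "Ck_bounded m UNIV e (\<lambda>x. v i x - v j x)" by (rule Ck_bounded_mono) (intro C(2) test_fun_diff v)
  qed
qed

theorem sobolev_embedding:
  assumes s: "real s > real CARD('n::finite) / 2"
  obtains K where "\<And>(w::real^'n \<Rightarrow> complex) M. L2c w \<Longrightarrow>
    \<forall>\<^sub>F e in at_right 0. sobolev_sq (m + s) (conv (mollifier e) w) \<le> M \<Longrightarrow>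
    \<exists>V. Ck_bounded m UNIV (K * sqrt M) V \<and> (AE x in lborel. V x = w x)"
proof -
  obtain C where C: "C \<ge> 0" "\<And>v::real^'n \<Rightarrow> complex. test_fun UNIV v \<Longrightarrow>
      Ck_bounded m UNIV (1 * sqrt (sobolev_sq (m + s) v) + C * sqrt (L2sq lborel v)) v"
    using ehrling_Ck[OF s zero_less_one] by blast
  have "\<exists>V. Ck_bounded m UNIV ((1 + C) * sqrt M) V \<and> (AE x in lborel. V x = w x)"
    if w: "L2c w" and M: "\<forall>\<^sub>F e in at_right 0. sobolev_sq (m + s) (conv (mollifier e) w) \<le> M"
    for w :: "real^'n \<Rightarrow> complex" and M
  proof -
    have lim: "filterlim (\<lambda>j. 1 / real (Suc j)) (at_right 0) sequentially" by real_asymp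
    obtain N where N: "\<And>j. j \<ge> N \<Longrightarrow> sobolev_sq (m + s) (conv (mollifier (1 / real (Suc j))) w) \<le> M"
      using filterlim_iff[THEN iffD1, OF lim, rule_format, OF M] by (auto simp: eventually_sequentially)
    define v where "v j = conv (mollifier (1 / real (Suc (j + N)))) w" for j
    have v: "test_fun UNIV (v j)" and v_le: "sobolev_sq (m + s) (v j) \<le> M" for j
      unfolding v_def by (intro test_fun_conv test_fun_mollifier w) (simp, rule N, simp)
    have diff: "square_integrable lborel (\<lambda>x. v j x - w x)" for j
      by (intro square_integrable_diff(1) L2cD(1) test_fun_L2c v w)
    have L2_lim: "(\<lambda>j. L2sq lborel (\<lambda>x. v j x - w x)) \<longlonglongrightarrow> 0"
      using LIMSEQ_ignore_initial_segment[OF filterlim_compose[OF L2_tendsto_conv_mollifier[OF w] lim], of N]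
      by (simp add: v_def)
    have "Ck_bounded m UNIV ((1 + C) * sqrt M) (v j)" for j
    proof (rule Ck_bounded_mono[OF _ C(2)[OF v]])
      have "sqrt (sobolev_sq (m + s) (v j)) \<le> sqrt M" "sqrt (L2sq lborel (v j)) \<le> sqrt M"
        using v_le[of j] order_trans[OF L2sq_le_sobolev_sq v_le[of j]] by simp_all
      then show "1 * sqrt (sobolev_sq (m + s) (v j)) + C * sqrt (L2sq lborel (v j)) \<le> (1 + C) * sqrt M"
        unfolding distrib_right by (intro add_mono mult_left_mono C(1)) auto
    qed
    then obtain V where V: "uniform_limit UNIV v V sequentially" "Ck_bounded m UNIV ((1 + C) * sqrt M) V"
      using Ck_Cauchy_limit[OF open_UNIV Ck_Cauchy_of_sobolev_bounded[OF s v v_le L2cD(1)[OF w] L2_lim]] by blast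
    have "AE x in lborel. (\<lambda>j. v j x) \<longlonglongrightarrow> V x" using tendsto_uniform_limitI[OF V(1)] by simp
    from AE_eq_L2_limit[OF diff L2_lim this] V(2) show ?thesis by blast
  qed
  then show thesis by (rule that)
qed

section \<open>From local to global\<close>

subsection \<open>Local square integrability\<close>

definition locally_square_integrable :: "(real^'n::finite) set \<Rightarrow> (real^'n \<Rightarrow> complex) \<Rightarrow> bool" where
  "locally_square_integrable \<Omega> f \<longleftrightarrow> (\<forall>A. relcompact_open A \<Omega> \<longrightarrow> square_integrable (lebesgue_on A) f)"

definition locally_L2_bounded :: "(real^'n::finite) set \<Rightarrow> ('i \<Rightarrow> real^'n \<Rightarrow> complex) \<Rightarrow> bool" where
  "locally_L2_bounded \<Omega> u \<longleftrightarrow> (\<forall>A. relcompact_open A \<Omega> \<longrightarrow>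
     (\<exists>B. \<forall>n. square_integrable (lebesgue_on A) (u n) \<and> L2sq (lebesgue_on A) (u n) \<le> B))"

lemma relcompact_openD:
  assumes "relcompact_open A \<Omega>" shows "open A" "A \<subseteq> \<Omega>" "bounded A" "A \<in> sets lebesgue"
  using assms closure_subset[of A] compact_imp_bounded[of "closure A"] bounded_subset
  by (auto simp: relcompact_open_def borel_open)

lemma relcompact_open_ball: "e > 0 \<Longrightarrow> cball x e \<subseteq> \<Omega> \<Longrightarrow> relcompact_open (ball x e) \<Omega>"
  by (simp add: relcompact_open_def)

lemma L2loc_imp_locally_square_integrable:
  assumes "L2loc \<Omega> f" shows "locally_square_integrable \<Omega> f"
  unfolding locally_square_integrable_def square_integrable_def
proof (intro allI impI conjI)
  fix A assume A: "relcompact_open A \<Omega>"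
  note A_sets = relcompact_openD(4)[OF A]
  have "(\<lambda>x. indicator A x *\<^sub>R (indicator \<Omega> x *\<^sub>R f x)) \<in> borel_measurable lebesgue"
    using assms unfolding L2loc_def set_borel_measurable_def
    by (intro borel_measurable_scaleR[OF borel_measurable_indicator[OF A_sets]]) blast
  moreover have "indicator A x *\<^sub>R (indicator \<Omega> x *\<^sub>R f x) = indicator A x *\<^sub>R f x" for x
    using relcompact_openD(2)[OF A] by (auto simp: indicator_def)
  ultimately have "(\<lambda>x. indicator A x *\<^sub>R f x) \<in> borel_measurable lebesgue" by (simp only:)
  then show "f \<in> borel_measurable (lebesgue_on A)"
    using A_sets by (simp add: borel_measurable_restrict_space_iff)
  show "integrable (lebesgue_on A) (\<lambda>x. (norm (f x))\<^sup>2)"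
    using assms A A_sets by (simp add: L2loc_def set_integrable_def integrable_restrict_space)
qed

lemma locally_square_integrable_cmult:
  "locally_square_integrable \<Omega> f \<Longrightarrow> locally_square_integrable \<Omega> (\<lambda>x. c * f x)"
  by (simp add: locally_square_integrable_def square_integrable_cmult)

lemma L2dist_eq_L2sq: "A \<in> sets lebesgue \<Longrightarrow> L2dist A f g = L2sq (lebesgue_on A) (\<lambda>x. f x - g x)"
  by (simp add: L2dist_def L2sq_def set_lebesgue_integral_def integral_restrict_space)

lemma square_integrable_sum:
  fixes f :: "'i \<Rightarrow> 'a \<Rightarrow> 'b::{second_countable_topology,real_normed_vector}"
  assumes "\<And>j. square_integrable M (f j)"
  shows "square_integrable M (\<lambda>x. \<Sum>j\<in>J. f j x)"
  by (induction J rule: infinite_finite_induct)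
    (auto intro: square_integrable_add assms simp: square_integrable_def[of M "\<lambda>x. 0"])

lemma L2_convergent_series_terms_bounded:
  fixes f :: "nat \<Rightarrow> 'a \<Rightarrow> 'b::{second_countable_topology,real_normed_vector}"
  assumes f: "\<And>j. square_integrable M (f j)" and G: "square_integrable M G"
    and lim: "(\<lambda>N. L2sq M (\<lambda>x. (\<Sum>j<N. f j x) - G x)) \<longlonglongrightarrow> 0"
  shows "\<exists>B. \<forall>j. L2sq M (f j) \<le> B"
proof -
  let ?rest = "\<lambda>N x. (\<Sum>j<N. f j x) - G x"
  have rest: "square_integrable M (?rest N)" for N by (intro square_integrable_diff(1) square_integrable_sum f G)
  obtain K where K: "\<And>N. norm (L2sq M (?rest N)) \<le> K"
    using convergent_imp_Bseq[OF convergentI[OF lim]] by (auto simp: Bseq_def)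
  have "L2sq M (f j) \<le> 4 * K" for j
    using square_integrable_diff(2)[OF rest[of "Suc j"] rest[of j]] K[of j] K[of "Suc j"] by simp
  then show ?thesis by blast
qed

lemma locally_L2_bounded_series_terms:
  assumes f: "\<And>j. locally_square_integrable \<Omega> (f j)" and G: "locally_square_integrable \<Omega> G"
    and lim: "L2loc_lim \<Omega> (\<lambda>N x. \<Sum>j<N. f j x) G"
  shows "locally_L2_bounded \<Omega> f"
  unfolding locally_L2_bounded_def
proof (intro allI impI)
  fix A assume A: "relcompact_open A \<Omega>"
  then have "square_integrable (lebesgue_on A) (f j)" "square_integrable (lebesgue_on A) G"
    "(\<lambda>N. L2sq (lebesgue_on A) (\<lambda>x. (\<Sum>j<N. f j x) - G x)) \<longlonglongrightarrow> 0" for j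
    using f G lim relcompact_openD(4)[OF A]
    by (auto simp: locally_square_integrable_def L2loc_lim_def L2dist_eq_L2sq)
  then show "\<exists>B. \<forall>n. square_integrable (lebesgue_on A) (f n) \<and> L2sq (lebesgue_on A) (f n) \<le> B"
    using L2_convergent_series_terms_bounded[of "lebesgue_on A" f G] by blast
qed

subsection \<open>Representatives with compact support\<close>

lemma completion_ex_borel_measurable_euclidean:
  fixes f :: "'a \<Rightarrow> 'b::euclidean_space"
  assumes f: "f \<in> borel_measurable (completion M)"
  obtains g where "g \<in> borel_measurable M" "AE x in M. f x = g x"
proof -
  have "\<exists>p. p \<in> borel_measurable M \<and> (AE x in M. f x \<bullet> b = p x)" for b
    using completion_ex_borel_measurable_real[of "\<lambda>x. f x \<bullet> b" M] f by auto
  then obtain p where p: "\<And>b. p b \<in> borel_measurable M" "\<And>b. AE x in M. f x \<bullet> b = p b x" by metis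
  have "AE x in M. \<forall>b\<in>Basis. f x \<bullet> b = p b x" using p(2) by (simp add: AE_finite_allI)
  then have "AE x in M. f x = (\<Sum>b\<in>Basis. p b x *\<^sub>R b)"
  proof eventually_elim
    case (elim x)
    then show ?case using euclidean_representation[of "f x"] by (metis (no_types, lifting) sum.cong)
  qed
  moreover have "(\<lambda>x. \<Sum>b\<in>Basis. p b x *\<^sub>R b) \<in> borel_measurable M" using p(1) by measurable
  ultimately show ?thesis using that by blast
qed

lemma L2c_representative_exists:
  fixes h :: "'a::euclidean_space \<Rightarrow> 'b::euclidean_space"
  assumes A: "open A" "bounded A" and h: "square_integrable (lebesgue_on A) h"
  obtains u where "L2c u" "AE x in lebesgue. indicator A x *\<^sub>R h x = u x"
proof -
  have A_sets: "A \<in> sets lebesgue" and [measurable]: "A \<in> sets borel" using A(1) by (auto simp: borel_open)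
  have "(\<lambda>x. indicator A x *\<^sub>R h x) \<in> borel_measurable lebesgue"
    using square_integrableD(1)[OF h] A_sets by (simp add: borel_measurable_restrict_space_iff)
  then obtain g where [measurable]: "g \<in> borel_measurable lborel"
      and g: "AE x in lborel. indicator A x *\<^sub>R h x = g x"
    by (rule completion_ex_borel_measurable_euclidean)
  define u where "u x = indicator A x *\<^sub>R g x" for x
  have [measurable]: "u \<in> borel_measurable lborel" unfolding u_def[abs_def] by measurable
  have AE_eq: "AE x in lebesgue. indicator A x *\<^sub>R h x = u x"
    using AE_completion[OF g] by eventually_elim (auto simp: u_def indicator_def)
  have "integrable lebesgue (\<lambda>x. indicator A x *\<^sub>R (norm (h x))\<^sup>2)"
    using square_integrableD(2)[OF h] A_sets by (simp add: integrable_restrict_space)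
  then have "integrable lebesgue (\<lambda>x. (norm (u x))\<^sup>2)"
  proof (rule integrable_cong_AE_imp)
    show "(\<lambda>x. (norm (u x))\<^sup>2) \<in> borel_measurable lebesgue" by (intro measurable_completion) measurable
    show "AE x in lebesgue. indicator A x *\<^sub>R (norm (h x))\<^sup>2 = (norm (u x))\<^sup>2"
      using AE_eq by eventually_elim (auto simp: indicator_def)
  qed
  then have "square_integrable lborel u" by (simp add: square_integrable_def integrable_completion)
  moreover have "bounded {x. u x \<noteq> 0}"
    by (rule bounded_subset[OF A(2)]) (auto simp: u_def indicator_def split: if_splits)
  ultimately show ?thesis using that AE_eq by (simp add: L2c_def)
qed

lemma L2sq_representative:
  assumes A: "A \<in> sets lebesgue" and h: "square_integrable (lebesgue_on A) h" and u: "u \<in> borel_measurable borel"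
    and AE_eq: "AE x in lebesgue. indicator A x *\<^sub>R h x = u x"
  shows "L2sq lborel u = L2sq (lebesgue_on A) h"
proof -
  have u_sq: "(\<lambda>x. (norm (u x))\<^sup>2) \<in> borel_measurable lborel" using u by measurable
  have "L2sq lborel u = (\<integral>x. (norm (u x))\<^sup>2 \<partial>lebesgue)"
    unfolding L2sq_def by (rule integral_completion[OF u_sq, symmetric])
  also have "\<dots> = (\<integral>x. indicator A x *\<^sub>R (norm (h x))\<^sup>2 \<partial>lebesgue)"
  proof (rule integral_cong_AE[OF measurable_completion[OF u_sq]])
    show "(\<lambda>x. indicator A x *\<^sub>R (norm (h x))\<^sup>2) \<in> borel_measurable lebesgue"
      using square_integrableD(2)[OF h] A by (simp add: integrable_restrict_space)
    show "AE x in lebesgue. (norm (u x))\<^sup>2 = indicator A x *\<^sub>R (norm (h x))\<^sup>2"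
      using AE_eq by eventually_elim (auto simp: indicator_def)
  qed
  also have "\<dots> = L2sq (lebesgue_on A) h" using A by (simp add: L2sq_def integral_restrict_space)
  finally show ?thesis .
qed

lemma set_integral_representative:
  fixes h u q :: "real^'n::finite \<Rightarrow> complex"
  assumes A: "A \<in> sets lebesgue" "A \<subseteq> \<Omega>" and h: "h \<in> borel_measurable (lebesgue_on A)"
    and u: "u \<in> borel_measurable borel"
    and AE_eq: "AE x in lebesgue. indicator A x *\<^sub>R h x = u x" and q: "test_fun A q"
  shows "(LINT x:\<Omega>|lebesgue. h x * q x) = (\<integral>x. u x * q x \<partial>lborel)"
proof -
  have [measurable]: "q \<in> borel_measurable borel" by (rule test_fun_measurable[OF q])
  have uq: "(\<lambda>x. u x * q x) \<in> borel_measurable lborel" using u by measurable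
  have restrict: "indicator \<Omega> x *\<^sub>R (h x * q x) = (indicator A x *\<^sub>R h x) * q x" for x
    using A(2) test_fun_outside[OF q, of x] by (auto simp: indicator_def)
  have "(LINT x:\<Omega>|lebesgue. h x * q x) = (\<integral>x. u x * q x \<partial>lebesgue)"
    unfolding set_lebesgue_integral_def restrict
  proof (rule integral_cong_AE[OF _ measurable_completion[OF uq]])
    have "(\<lambda>x. indicator A x *\<^sub>R h x) \<in> borel_measurable lebesgue"
      using h A(1) by (simp add: borel_measurable_restrict_space_iff)
    then show "(\<lambda>x. (indicator A x *\<^sub>R h x) * q x) \<in> borel_measurable lebesgue"
      by (rule borel_measurable_times) (rule measurable_completion, simp)
    show "AE x in lebesgue. (indicator A x *\<^sub>R h x) * q x = u x * q x"
      using AE_eq by eventually_elim simp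
  qed
  then show ?thesis using integral_completion[OF uq] by simp
qed

subsection \<open>Interior regularity with uniform bounds\<close>

lemma Lbar_weak_cmult:
  assumes "Lbar_weak \<Omega> a b u g" shows "Lbar_weak \<Omega> a b (\<lambda>x. c * u x) (\<lambda>x. c * g x)"
  unfolding Lbar_weak_def
proof (intro allI impI)
  fix \<phi> assume "test_fun \<Omega> \<phi>"
  then have "c * (LINT x:\<Omega>|lebesgue. g x * \<phi> x) = c * (LINT x:\<Omega>|lebesgue. u x * Lbar_transpose a b \<phi> x)"
    using assms by (simp add: Lbar_weak_def)
  then show "(LINT x:\<Omega>|lebesgue. c * g x * \<phi> x) = (LINT x:\<Omega>|lebesgue. c * u x * Lbar_transpose a b \<phi> x)"
    by (simp only: mult.assoc set_integral_mult_right)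
qed

context elliptic
begin

lemma interior_Ck_bound:
  assumes \<beta>: "test_fun UNIV \<beta>" and u: "\<And>l n. l \<le> k \<Longrightarrow> L2c (u l n)" and B: "\<And>l n. l \<le> k \<Longrightarrow> L2sq lborel (u l n) \<le> B l"
    and weak: "\<And>l n. l < k \<Longrightarrow> weak_solution \<beta> (u l n) (u (Suc l) n)"
    and k: "real k > real m / 2 + real CARD('n) / 4" and \<psi>: "test_fun U \<psi>"
  obtains D where "\<And>n. \<exists>V. Ck_bounded m UNIV D V \<and> (AE x in lborel. V x = \<psi> x * u 0 n x)"
proof -
  define s where "s = 2 * k - m"
  have "real m < real (2 * k)" using k by (simp add: field_simps)
  then have ms: "m + s = 2 * k" by (simp add: s_def)
  then have "real s = 2 * real k - real m" by linarith
  then have s: "real s > real CARD('n) / 2" using k by simp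
  have "uniformly_sobolev (m + s) (\<lambda>n x. \<psi> x * u 0 n x)"
    using regularity_chain[where u=u and B=B and j=k and k=k, OF \<beta> u B weak order_refl] \<psi>
    by (simp add: locally_uniformly_sobolev_def ms)
  then obtain M where M: "\<forall>\<^sub>F e in at_right 0. \<forall>n. sobolev_sq (m + s) (conv (mollifier e) (\<lambda>x. \<psi> x * u 0 n x)) \<le> M"
    by (auto simp: uniformly_sobolev_def)
  obtain K where K: "\<And>(w::real^'n \<Rightarrow> complex) M. L2c w \<Longrightarrow>
      \<forall>\<^sub>F e in at_right 0. sobolev_sq (m + s) (conv (mollifier e) w) \<le> M \<Longrightarrow>
      \<exists>V. Ck_bounded m UNIV (K * sqrt M) V \<and> (AE x in lborel. V x = w x)"
    by (rule sobolev_embedding[OF s, of m]) blast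
  show thesis
  proof (rule that, rule K)
    show "L2c (\<lambda>x. \<psi> x * u 0 n x)" for n by (intro L2c_test_fun_mult test_fun_UNIV[OF \<psi>] u) simp
    show "\<forall>\<^sub>F e in at_right 0. sobolev_sq (m + s) (conv (mollifier e) (\<lambda>x. \<psi> x * u 0 n x)) \<le> M" for n
      using M by (rule eventually_mono) blast
  qed
qed

lemma Lbar_transpose_eq_formal_transpose:
  assumes \<phi>: "test_fun U \<phi>" and coeff: "\<And>\<mu> \<nu> x. x \<in> U \<Longrightarrow> a \<mu> \<nu> x = A \<mu> \<nu> x"
    and inverse: "\<And>x. x \<in> U \<Longrightarrow> complex_of_real (b x) * \<beta> x = 1"
  shows "Lbar_transpose A b (\<lambda>x. \<beta> x * \<phi> x) = formal_transpose \<phi>"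
proof
  fix x
  have cancel: "(\<lambda>x. complex_of_real (b x) * (\<beta> x * \<phi> x)) = \<phi>"
  proof
    fix x show "complex_of_real (b x) * (\<beta> x * \<phi> x) = \<phi> x"
      using inverse[of x] test_fun_outside[OF \<phi>, of x] by (cases "x \<in> U") (auto simp: mult.assoc[symmetric])
  qed
  have coeff': "(\<lambda>y. A \<mu> \<nu> y * partial \<mu> \<phi> y) = (\<lambda>y. a \<mu> \<nu> y * partial \<mu> \<phi> y)" for \<mu> \<nu>
  proof
    fix y show "A \<mu> \<nu> y * partial \<mu> \<phi> y = a \<mu> \<nu> y * partial \<mu> \<phi> y"
      using coeff[of y \<mu> \<nu>] test_fun_outside[OF test_fun_partial[OF \<phi>], of y \<mu>] by (cases "y \<in> U") auto
  qed
  have "test_fun UNIV (\<lambda>y. a \<mu> \<nu> y * partial \<mu> \<phi> y)" for \<mu> \<nu>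
    by (intro test_fun_mult test_fun_coeff test_fun_partial test_fun_UNIV[OF \<phi>])
  note sum = partial_sum_test_fun[OF this]
  show "Lbar_transpose A b (\<lambda>x. \<beta> x * \<phi> x) x = formal_transpose \<phi> x"
    unfolding Lbar_transpose_def cancel coeff' formal_transpose_def divergence_def dual_flux_def[abs_def] sum ..
qed

lemma Lbar_weak_imp_weak_solution:
  assumes weak: "Lbar_weak \<Omega> A b h g" and \<beta>: "test_fun UNIV \<beta>"
    and U: "U \<subseteq> \<Omega>" "U \<in> sets lebesgue" and coeff: "\<And>\<mu> \<nu> x. x \<in> U \<Longrightarrow> a \<mu> \<nu> x = A \<mu> \<nu> x"
    and inverse: "\<And>x. x \<in> U \<Longrightarrow> complex_of_real (b x) * \<beta> x = 1"
    and h: "h \<in> borel_measurable (lebesgue_on U)" "L2c u" "AE x in lebesgue. indicator U x *\<^sub>R h x = u x"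
    and g: "g \<in> borel_measurable (lebesgue_on U)" "L2c v" "AE x in lebesgue. indicator U x *\<^sub>R g x = v x"
  shows "weak_solution \<beta> u v"
  unfolding weak_solution_def
proof (intro allI impI)
  fix \<phi> assume \<phi>: "test_fun U \<phi>"
  note \<beta>\<phi> = test_fun_mult_smooth[OF \<phi> test_fun_smooth_on[OF \<beta>]]
  have "(\<integral>x. v x * (\<beta> x * \<phi> x) \<partial>lborel) = (LINT x:\<Omega>|lebesgue. g x * (\<beta> x * \<phi> x))"
    by (rule set_integral_representative[OF U(2,1) g(1) L2cD(2)[OF g(2)] g(3) \<beta>\<phi>, symmetric])
  also have "\<dots> = (LINT x:\<Omega>|lebesgue. h x * formal_transpose \<phi> x)"
    using weak test_fun_mono[OF \<beta>\<phi> U(1)]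
    by (simp add: Lbar_weak_def Lbar_transpose_eq_formal_transpose[OF \<phi> coeff inverse])
  also have "\<dots> = (\<integral>x. u x * formal_transpose \<phi> x \<partial>lborel)"
    by (rule set_integral_representative[OF U(2,1) h(1) L2cD(2)[OF h(2)] h(3) test_fun_formal_transpose[OF \<phi>]])
  finally show "(\<integral>x. v x * (\<beta> x * \<phi> x) \<partial>lborel) = (\<integral>x. u x * formal_transpose \<phi> x \<partial>lborel)" .
qed

end

locale elliptic_operator =
  fixes \<Omega> :: "(real^'n::finite) set" and a :: "'n \<Rightarrow> 'n \<Rightarrow> real^'n \<Rightarrow> complex" and b ell :: "real^'n \<Rightarrow> real"
  assumes open_\<Omega>: "open \<Omega>" and smooth_b: "smooth_on \<Omega> b" and b_pos: "\<And>x. x \<in> \<Omega> \<Longrightarrow> b x > 0"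
    and smooth_a: "\<And>\<mu> \<nu>. smooth_on \<Omega> (a \<mu> \<nu>)"
    and continuous_ell: "continuous_on \<Omega> ell" and ell_pos: "\<And>x. x \<in> \<Omega> \<Longrightarrow> ell x > 0"
    and ellipticity: "\<And>x \<xi>. x \<in> \<Omega> \<Longrightarrow> ell x * (\<Sum>\<mu>\<in>UNIV. (cmod (\<xi> $ \<mu>))\<^sup>2)
       \<le> Re (\<Sum>\<mu>\<in>UNIV. \<Sum>\<nu>\<in>UNIV. a \<mu> \<nu> x * cnj (\<xi> $ \<mu>) * \<xi> $ \<nu>)"
begin

lemma smooth_on_inverse_b: "smooth_on \<Omega> (\<lambda>x. inverse (complex_of_real (b x)))"
  unfolding smooth_on_def
proof
  fix m
  have "Ck m \<Omega> (\<lambda>x. complex_of_real (b x))"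
    using smooth_b by (intro Ck_bounded_linear_compose[OF bounded_linear_of_real open_\<Omega>]) (simp add: smooth_on_def)
  then show "Ck m \<Omega> (\<lambda>x. inverse (complex_of_real (b x)))"
    by (rule Ck_inverse[OF open_\<Omega>, rotated]) (use b_pos in force)
qed

lemma localized_coefficients:
  assumes "x \<in> \<Omega>"
  obtains e a' \<beta> c where "e > 0" "cball x e \<subseteq> \<Omega>" "elliptic a' (ball x e) c" "test_fun UNIV \<beta>"
    "\<And>\<mu> \<nu> y. y \<in> ball x e \<Longrightarrow> a' \<mu> \<nu> y = a \<mu> \<nu> y" "\<And>y. y \<in> ball x e \<Longrightarrow> complex_of_real (b y) * \<beta> y = 1"
proof -
  obtain e where e: "e > 0" "cball x e \<subseteq> \<Omega>" using open_\<Omega> assms open_contains_cball by blast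
  obtain \<eta> where \<eta>: "test_fun \<Omega> \<eta>" "\<And>y. y \<in> cball x e \<Longrightarrow> \<eta> y = 1"
    by (rule cutoff_exists[OF compact_cball open_\<Omega> e(2)]) blast
  obtain y where y: "y \<in> cball x e" "\<And>z. z \<in> cball x e \<Longrightarrow> ell y \<le> ell z"
    using continuous_attains_inf[OF compact_cball _ continuous_on_subset[OF continuous_ell e(2)]] e(1) by force
  have "elliptic (\<lambda>\<mu> \<nu> z. \<eta> z * a \<mu> \<nu> z) (ball x e) (ell y)"
  proof
    show "test_fun UNIV (\<lambda>z. \<eta> z * a \<mu> \<nu> z)" for \<mu> \<nu>
      by (rule test_fun_UNIV[OF test_fun_mult_smooth_on[OF \<eta>(1) open_\<Omega> smooth_a]])
    show "ell y > 0" using y(1) e(2) ell_pos by blast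
    fix z and \<xi> :: "complex^'n" assume "z \<in> ball x e"
    then have z: "z \<in> cball x e" "z \<in> \<Omega>" using e(2) by auto
    have "ell y * (\<Sum>\<mu>\<in>UNIV. (cmod (\<xi> $ \<mu>))\<^sup>2) \<le> ell z * (\<Sum>\<mu>\<in>UNIV. (cmod (\<xi> $ \<mu>))\<^sup>2)"
      by (intro mult_right_mono y(2) z sum_nonneg) auto
    then show "ell y * (\<Sum>\<mu>\<in>UNIV. (cmod (\<xi> $ \<mu>))\<^sup>2)
        \<le> Re (\<Sum>\<mu>\<in>UNIV. \<Sum>\<nu>\<in>UNIV. \<eta> z * a \<mu> \<nu> z * cnj (\<xi> $ \<mu>) * \<xi> $ \<nu>)"
      using ellipticity[OF z(2), of \<xi>] by (simp add: \<eta>(2)[OF z(1)])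
  qed simp
  then show thesis
  proof (rule that[OF e])
    show "test_fun UNIV (\<lambda>z. \<eta> z * inverse (complex_of_real (b z)))"
      by (rule test_fun_UNIV[OF test_fun_mult_smooth_on[OF \<eta>(1) open_\<Omega> smooth_on_inverse_b]])
    fix z assume "z \<in> ball x e"
    then have z: "z \<in> cball x e" "z \<in> \<Omega>" using e(2) by auto
    then show "\<eta> z * a \<mu> \<nu> z = a \<mu> \<nu> z" for \<mu> \<nu> by (simp add: \<eta>(2))
    show "complex_of_real (b z) * (\<eta> z * inverse (complex_of_real (b z))) = 1"
      using \<eta>(2)[OF z(1)] b_pos[OF z(2)] by simp
  qed
qed

theorem interior_regularity:
  fixes h :: "nat \<Rightarrow> 'i \<Rightarrow> real^'n \<Rightarrow> complex"
  assumes k: "real k > real m / 2 + real CARD('n) / 4" and x: "x \<in> \<Omega>"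
    and h: "\<And>l. l \<le> k \<Longrightarrow> locally_L2_bounded \<Omega> (h l)"
    and weak: "\<And>l n. l < k \<Longrightarrow> Lbar_weak \<Omega> a b (h l n) (h (Suc l) n)"
  shows "\<exists>r>0. ball x r \<subseteq> \<Omega> \<and> (\<exists>D. \<forall>n. \<exists>V. Ck_bounded m (ball x r) D V
    \<and> (AE y in lebesgue. y \<in> ball x r \<longrightarrow> V y = h 0 n y))"
proof -
  obtain e a' \<beta> c where e: "e > 0" "cball x e \<subseteq> \<Omega>" and ell: "elliptic a' (ball x e) c" and \<beta>: "test_fun UNIV \<beta>"
    and coeff: "\<And>\<mu> \<nu> y. y \<in> ball x e \<Longrightarrow> a' \<mu> \<nu> y = a \<mu> \<nu> y" "\<And>y. y \<in> ball x e \<Longrightarrow> complex_of_real (b y) * \<beta> y = 1"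
    using localized_coefficients[OF x] by metis
  interpret elliptic a' "ball x e" c by (rule ell)
  let ?B = "ball x e"
  have relcompact: "relcompact_open ?B \<Omega>" by (rule relcompact_open_ball[OF e])
  note B_sets = relcompact_openD(2,4)[OF relcompact]
  have "\<forall>l. \<exists>B. l \<le> k \<longrightarrow> (\<forall>n. square_integrable (lebesgue_on ?B) (h l n) \<and> L2sq (lebesgue_on ?B) (h l n) \<le> B)"
    using h relcompact by (auto simp: locally_L2_bounded_def)
  from choice[OF this] obtain B where B: "\<And>l n. l \<le> k \<Longrightarrow> square_integrable (lebesgue_on ?B) (h l n)"
    "\<And>l n. l \<le> k \<Longrightarrow> L2sq (lebesgue_on ?B) (h l n) \<le> B l" by blast
  have "\<exists>u. l \<le> k \<longrightarrow> L2c u \<and> (AE y in lebesgue. indicator ?B y *\<^sub>R h l n y = u y)" for l n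
    using L2c_representative_exists[OF open_ball bounded_ball B(1)] by metis
  then obtain u where u: "\<And>l n. l \<le> k \<Longrightarrow> L2c (u l n)"
    "\<And>l n. l \<le> k \<Longrightarrow> AE y in lebesgue. indicator ?B y *\<^sub>R h l n y = u l n y" by metis
  have bound: "L2sq lborel (u l n) \<le> B l" if "l \<le> k" for l n
    using L2sq_representative[OF B_sets(2) B(1) L2cD(2)[OF u(1)] u(2)] B(2) that by simp
  have weak': "weak_solution \<beta> (u l n) (u (Suc l) n)" if "l < k" for l n
    by (rule Lbar_weak_imp_weak_solution[OF weak[OF that] \<beta> B_sets coeff square_integrableD(1)[OF B(1)] u
          square_integrableD(1)[OF B(1)] u]) (use that in simp_all)
  obtain \<psi> where \<psi>: "test_fun ?B \<psi>" "\<And>y. y \<in> cball x (e / 2) \<Longrightarrow> \<psi> y = 1"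
    by (rule cutoff_exists[OF compact_cball open_ball, of x "e / 2" x e]) (use e(1) in auto)
  obtain D where D: "\<And>n. \<exists>V. Ck_bounded m UNIV D V \<and> (AE y in lborel. V y = \<psi> y * u 0 n y)"
    using interior_Ck_bound[where u=u and B=B and k=k and m=m, OF \<beta> u(1) bound weak' k \<psi>(1)] by metis
  have "\<exists>V. Ck_bounded m (ball x (e / 2)) D V \<and> (AE y in lebesgue. y \<in> ball x (e / 2) \<longrightarrow> V y = h 0 n y)" for n
  proof -
    obtain V where V: "Ck_bounded m UNIV D V" "AE y in lborel. V y = \<psi> y * u 0 n y" using D by blast
    have "AE y in lebesgue. y \<in> ball x (e / 2) \<longrightarrow> V y = h 0 n y"
      using AE_completion[OF V(2)] u(2)[OF le0, of n]
    proof eventually_elim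
      case (elim y)
      then show ?case using \<psi>(2)[of y] e(1) by auto
    qed
    then show ?thesis using Ck_bounded_subset[OF subset_UNIV V(1)] by blast
  qed
  moreover have "ball x (e / 2) \<subseteq> \<Omega>" using B_sets(1) e(1) by auto
  ultimately show ?thesis using e(1) half_gt_zero by blast
qed

end

subsection \<open>Power series with local representatives\<close>

lemma continuous_on_local_eq:
  fixes V :: "'a::metric_space \<Rightarrow> 'b::topological_space"
  assumes r: "\<And>x. x \<in> \<Omega> \<Longrightarrow> r x > 0" and W: "\<And>x. x \<in> \<Omega> \<Longrightarrow> continuous_on (ball x (r x)) (W x)"
    and local_eq: "\<And>x y. x \<in> \<Omega> \<Longrightarrow> y \<in> \<Omega> \<Longrightarrow> y \<in> ball x (r x) \<Longrightarrow> V y = W x y"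
  shows "continuous_on \<Omega> V"
proof (rule continuous_on_eq_continuous_within[THEN iffD2], rule ballI)
  fix x assume x: "x \<in> \<Omega>"
  have "isCont (W x) x" using W[OF x] continuous_on_eq_continuous_at[OF open_ball] r[OF x] by (metis centre_in_ball)
  then have "continuous (at x within \<Omega>) (W x)" by (rule continuous_at_imp_continuous_at_within)
  then show "continuous (at x within \<Omega>) V"
  proof (rule continuous_transform_within[OF _ r[OF x] x])
    show "W x y = V y" if "y \<in> \<Omega>" "dist y x < r x" for y
      using local_eq[OF x that(1)] that(2) by (simp add: dist_commute)
  qed
qed

lemma continuous_representative_of_local:
  fixes f :: "'a::euclidean_space \<Rightarrow> 'b::real_normed_vector"
  assumes local: "\<And>x. x \<in> \<Omega> \<Longrightarrow> \<exists>r>0. \<exists>V. continuous_on (ball x r) V \<and> (AE y in lebesgue. y \<in> ball x r \<longrightarrow> V y = f y)"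
  obtains V where "continuous_on \<Omega> V" "AE y in lebesgue. y \<in> \<Omega> \<longrightarrow> V y = f y"
proof -
  have "\<forall>x\<in>\<Omega>. \<exists>r V. r > 0 \<and> continuous_on (ball x r) V \<and> (AE y in lebesgue. y \<in> ball x r \<longrightarrow> V y = f y)"
    using local by blast
  from bchoice[OF this] obtain r where
    "\<forall>x\<in>\<Omega>. \<exists>V. r x > 0 \<and> continuous_on (ball x (r x)) V \<and> (AE y in lebesgue. y \<in> ball x (r x) \<longrightarrow> V y = f y)"
    by (rule exE)
  from bchoice[OF this] obtain W where
    "\<forall>x\<in>\<Omega>. r x > 0 \<and> continuous_on (ball x (r x)) (W x) \<and> (AE y in lebesgue. y \<in> ball x (r x) \<longrightarrow> W x y = f y)"
    by (rule exE)
  then have W: "\<And>x. x \<in> \<Omega> \<Longrightarrow> r x > 0" "\<And>x. x \<in> \<Omega> \<Longrightarrow> continuous_on (ball x (r x)) (W x)"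
    "\<And>x. x \<in> \<Omega> \<Longrightarrow> AE y in lebesgue. y \<in> ball x (r x) \<longrightarrow> W x y = f y"
    by blast+
  have diagonal: "W y y = W x y" if x: "x \<in> \<Omega>" and y: "y \<in> \<Omega>" "y \<in> ball x (r x)" for x y
  proof (rule continuous_on_AE_eq_imp_eq[where U="ball y (r y) \<inter> ball x (r x)" and f="W y" and g="W x" and x=y])
    show "continuous_on (ball y (r y) \<inter> ball x (r x)) (W y)" "continuous_on (ball y (r y) \<inter> ball x (r x)) (W x)"
      using W(2)[OF x] W(2)[OF y(1)] by (auto intro: continuous_on_subset)
    show "AE z in lebesgue. z \<in> ball y (r y) \<inter> ball x (r x) \<longrightarrow> W y z = W x z"
      using W(3)[OF x] W(3)[OF y(1)] by eventually_elim auto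
  qed (use W(1)[OF y(1)] y in auto)
  have near: "AE y in lebesgue. y \<in> ball x (r x) \<inter> \<Omega> \<longrightarrow> W y y = f y" if "x \<in> \<Omega>" for x
    using W(3)[OF that]
  proof eventually_elim
    case (elim y)
    then show ?case using diagonal[OF that, of y] by auto
  qed
  show thesis
  proof (rule that[of "\<lambda>y. W y y"])
    show "continuous_on \<Omega> (\<lambda>y. W y y)"
      by (rule continuous_on_local_eq[OF W(1,2) diagonal])
    have "AE y in lebesgue. y \<in> \<Omega> \<longrightarrow> y \<in> \<Omega> \<longrightarrow> W y y = f y"
    proof (rule AE_open_local[where P="\<lambda>y. y \<in> \<Omega> \<longrightarrow> W y y = f y"])
      fix x assume x: "x \<in> \<Omega>"
      have "AE y in lebesgue. y \<in> ball x (r x) \<longrightarrow> y \<in> \<Omega> \<longrightarrow> W y y = f y"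
        using near[OF x] by eventually_elim auto
      then show "\<exists>V. open V \<and> x \<in> V \<and> (AE y in lebesgue. y \<in> V \<longrightarrow> y \<in> \<Omega> \<longrightarrow> W y y = f y)"
        using W(1)[OF x] by (intro exI[of _ "ball x (r x)"]) simp
    qed
    then show "AE y in lebesgue. y \<in> \<Omega> \<longrightarrow> W y y = f y" by eventually_elim auto
  qed
qed

lemma locally_L2_limit_AE_eq:
  assumes "open \<Omega>" and f: "\<And>N. locally_square_integrable \<Omega> (f N)" and F: "locally_square_integrable \<Omega> F"
    and lim: "L2loc_lim \<Omega> f F" and pointwise: "AE x in lebesgue. x \<in> \<Omega> \<longrightarrow> (\<lambda>N. f N x) \<longlonglongrightarrow> G x"
  shows "AE x in lebesgue. x \<in> \<Omega> \<longrightarrow> G x = F x"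
proof (rule AE_open_local)
  fix x assume "x \<in> \<Omega>"
  then obtain e where e: "e > 0" "cball x e \<subseteq> \<Omega>" using \<open>open \<Omega>\<close> open_contains_cball by blast
  then have A: "relcompact_open (ball x e) \<Omega>" by (rule relcompact_open_ball)
  note A_sets = relcompact_openD(2,4)[OF A]
  have "AE y in lebesgue_on (ball x e). G y = F y"
  proof (rule AE_eq_L2_limit)
    show "square_integrable (lebesgue_on (ball x e)) (\<lambda>y. f N y - F y)" for N
      using f F A by (auto simp: locally_square_integrable_def intro: square_integrable_diff)
    show "(\<lambda>N. L2sq (lebesgue_on (ball x e)) (\<lambda>y. f N y - F y)) \<longlonglongrightarrow> 0"
      using lim A unfolding L2dist_eq_L2sq[OF A_sets(2), symmetric] by (simp add: L2loc_lim_def)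
    have "AE y in lebesgue. y \<in> ball x e \<longrightarrow> (\<lambda>N. f N y) \<longlonglongrightarrow> G y"
      using pointwise by eventually_elim (use A_sets(1) in blast)
    then show "AE y in lebesgue_on (ball x e). (\<lambda>N. f N y) \<longlonglongrightarrow> G y"
      using A_sets(2) by (simp add: AE_restrict_space_iff)
  qed
  then have "AE y in lebesgue. y \<in> ball x e \<longrightarrow> G y = F y" using A_sets(2) by (simp add: AE_restrict_space_iff)
  then show "\<exists>V. open V \<and> x \<in> V \<and> (AE y in lebesgue. y \<in> V \<longrightarrow> G y = F y)"
    using e(1) by (intro exI[of _ "ball x e"]) simp
qed

lemma locally_square_integrable_sum:
  "(\<And>j. locally_square_integrable \<Omega> (f j)) \<Longrightarrow> locally_square_integrable \<Omega> (\<lambda>x. \<Sum>j\<in>J. f j x)"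
  by (simp add: locally_square_integrable_def square_integrable_sum)

lemma Ck_bounded_AE_cong:
  fixes W V :: "'a::euclidean_space \<Rightarrow> 'b::real_normed_vector"
  assumes "open B" and W: "Ck_bounded m B D W" and "continuous_on B V" "AE y in lebesgue. y \<in> B \<longrightarrow> W y = V y"
  shows "Ck_bounded m B D V"
proof (rule Ck_bounded_cong[OF \<open>open B\<close> _ W])
  show "W y = V y" if "y \<in> B" for y
    by (rule continuous_on_AE_eq_imp_eq[OF \<open>open B\<close> Ck_continuous_on[OF Ck_bounded_imp_Ck[OF W]] assms(3,4) that])
qed

lemma Ck_bounded_representatives:
  fixes f :: "nat \<Rightarrow> 'a::euclidean_space \<Rightarrow> complex"
  assumes local: "\<And>\<rho> x. 0 < \<rho> \<Longrightarrow> \<rho> < S \<Longrightarrow> x \<in> \<Omega> \<Longrightarrow>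
      \<exists>r>0. ball x r \<subseteq> \<Omega> \<and> (\<exists>D. \<forall>j. \<exists>V. Ck_bounded m (ball x r) D V
        \<and> (AE y in lebesgue. y \<in> ball x r \<longrightarrow> V y = of_real (\<rho> ^ j) * f j y))"
  shows "\<exists>V. (\<forall>j. AE y in lebesgue. y \<in> \<Omega> \<longrightarrow> V j y = f j y) \<and>
    (\<forall>\<rho> x. 0 < \<rho> \<longrightarrow> \<rho> < S \<longrightarrow> x \<in> \<Omega> \<longrightarrow>
      (\<exists>r>0. \<exists>D. \<forall>j. Ck_bounded m (ball x r) D (\<lambda>y. of_real (\<rho> ^ j) * V j y)))"
proof (cases "S > 0")
  case True
  obtain \<rho> where \<rho>: "0 < \<rho>" "\<rho> < S" using dense[OF True] by blast
  have "\<forall>j. \<exists>V. continuous_on \<Omega> V \<and> (AE y in lebesgue. y \<in> \<Omega> \<longrightarrow> V y = f j y)"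
  proof
    fix j
    have "\<exists>r>0. \<exists>V. continuous_on (ball x r) V \<and> (AE y in lebesgue. y \<in> ball x r \<longrightarrow> V y = of_real (\<rho> ^ j) * f j y)"
      if "x \<in> \<Omega>" for x
      using local[OF \<rho> that] Ck_continuous_on[OF Ck_bounded_imp_Ck] by blast
    then obtain V where V: "continuous_on \<Omega> V" "AE y in lebesgue. y \<in> \<Omega> \<longrightarrow> V y = of_real (\<rho> ^ j) * f j y"
      by (rule continuous_representative_of_local)
    have "continuous_on \<Omega> (\<lambda>y. V y / of_real (\<rho> ^ j))" using \<rho>(1) V(1) by (intro continuous_intros) auto
    moreover have "AE y in lebesgue. y \<in> \<Omega> \<longrightarrow> V y / of_real (\<rho> ^ j) = f j y"
      using V(2) by eventually_elim (use \<rho>(1) in auto)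
    ultimately show "\<exists>V. continuous_on \<Omega> V \<and> (AE y in lebesgue. y \<in> \<Omega> \<longrightarrow> V y = f j y)" by blast
  qed
  from choice[OF this] obtain V where V: "\<And>j. continuous_on \<Omega> (V j)" "\<And>j. AE y in lebesgue. y \<in> \<Omega> \<longrightarrow> V j y = f j y"
    by blast
  have "\<exists>r>0. \<exists>D. \<forall>j. Ck_bounded m (ball x r) D (\<lambda>y. of_real (\<rho> ^ j) * V j y)"
    if \<rho>: "0 < \<rho>" "\<rho> < S" and x: "x \<in> \<Omega>" for \<rho> x
  proof -
    obtain r D where r: "r > 0" "ball x r \<subseteq> \<Omega>" and D: "\<And>j. \<exists>W. Ck_bounded m (ball x r) D W
        \<and> (AE y in lebesgue. y \<in> ball x r \<longrightarrow> W y = of_real (\<rho> ^ j) * f j y)"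
      using local[OF \<rho> x] by blast
    have "Ck_bounded m (ball x r) D (\<lambda>y. of_real (\<rho> ^ j) * V j y)" for j
    proof -
      obtain W where W: "Ck_bounded m (ball x r) D W"
        "AE y in lebesgue. y \<in> ball x r \<longrightarrow> W y = of_real (\<rho> ^ j) * f j y"
        using D by blast
      have "AE y in lebesgue. y \<in> ball x r \<longrightarrow> W y = of_real (\<rho> ^ j) * V j y"
        using W(2) V(2)[of j] by eventually_elim (use r(2) in auto)
      then show ?thesis
        by (intro Ck_bounded_AE_cong[OF open_ball W(1)] continuous_intros continuous_on_subset[OF V(1) r(2)])
    qed
    then show ?thesis using r(1) by blast
  qed
  then show ?thesis using V(2) by blast
qed (auto intro!: exI[of _ f])

lemma summable_power_series_of_Ck_bounded:
  fixes V :: "nat \<Rightarrow> 'a::euclidean_space \<Rightarrow> complex"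
  assumes z: "norm z < S" and bound: "\<And>\<rho>. 0 < \<rho> \<Longrightarrow> \<rho> < S \<Longrightarrow>
      \<exists>r>0. \<exists>D. \<forall>j. Ck_bounded m (ball x r) D (\<lambda>y. of_real (\<rho> ^ j) * V j y)"
  shows "summable (\<lambda>j. z ^ j * V j x)"
proof -
  obtain \<rho> where \<rho>: "norm z < \<rho>" "\<rho> < S" using dense[OF z] by blast
  then have "\<rho> > 0" using norm_ge_zero[of z] by linarith
  obtain r where r: "r > 0" "\<exists>D. \<forall>j. Ck_bounded m (ball x r) D (\<lambda>y. of_real (\<rho> ^ j) * V j y)"
    using bound[OF \<open>\<rho> > 0\<close> \<rho>(2)] by blast
  from r(2) obtain D where D: "\<forall>j. Ck_bounded m (ball x r) D (\<lambda>y. of_real (\<rho> ^ j) * V j y)" by (rule exE)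
  have "norm (of_real (\<rho> ^ j) * V j x) \<le> D" for j
    by (rule Ck_bounded_norm_le[OF spec[OF D]]) (use r(1) in simp)
  then have "norm (V j x) * \<rho> ^ j \<le> D" for j
    using \<open>\<rho> > 0\<close> by (simp add: norm_mult norm_power mult.commute)
  then have "summable (\<lambda>j. norm (V j x) * norm z ^ j)" by (rule Abel_lemma[OF norm_ge_zero \<rho>(1)])
  then have "summable (\<lambda>j. norm (z ^ j * V j x))" by (simp add: norm_mult norm_power mult.commute)
  then show ?thesis by (rule summable_norm_cancel)
qed

theorem Ck_representative_power_series:
  fixes \<Omega> :: "(real^'n::finite) set" and f :: "nat \<Rightarrow> real^'n \<Rightarrow> complex" and F :: "complex \<Rightarrow> real^'n \<Rightarrow> complex"
  assumes "open \<Omega>" and f: "\<And>j. locally_square_integrable \<Omega> (f j)"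
    and F: "\<And>z. z \<in> ball 0 S \<Longrightarrow> locally_square_integrable \<Omega> (F z)"
    and lim: "\<And>z. z \<in> ball 0 S \<Longrightarrow> L2loc_lim \<Omega> (\<lambda>N x. \<Sum>j<N. z ^ j * f j x) (F z)"
    and local: "\<And>\<rho> x. 0 < \<rho> \<Longrightarrow> \<rho> < S \<Longrightarrow> x \<in> \<Omega> \<Longrightarrow>
      \<exists>r>0. ball x r \<subseteq> \<Omega> \<and> (\<exists>D. \<forall>j. \<exists>V. Ck_bounded m (ball x r) D V
        \<and> (AE y in lebesgue. y \<in> ball x r \<longrightarrow> V y = of_real (\<rho> ^ j) * f j y))"
  shows "\<exists>Fr. (\<forall>z\<in>ball 0 S. AE x in lebesgue. x \<in> \<Omega> \<longrightarrow> Fr z x = F z x) \<and> (\<forall>z\<in>ball 0 S. Ck m \<Omega> (Fr z))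
    \<and> Ck m (ball 0 S \<times> \<Omega>) (\<lambda>(z, x). Fr z x)"
proof -
  from Ck_bounded_representatives[OF local] obtain V where V: "\<forall>j. AE y in lebesgue. y \<in> \<Omega> \<longrightarrow> V j y = f j y"
    and bound: "\<And>\<rho> x. 0 < \<rho> \<Longrightarrow> \<rho> < S \<Longrightarrow> x \<in> \<Omega> \<Longrightarrow> \<exists>r>0. \<exists>D. \<forall>j. Ck_bounded m (ball x r) D (\<lambda>y. of_real (\<rho> ^ j) * V j y)"
    by blast
  define Fr where "Fr z x = (\<Sum>j. z ^ j * V j x)" for z x
  have joint: "Ck m (ball 0 S \<times> \<Omega>) (\<lambda>(z, x). Fr z x)"
    unfolding Fr_def by (rule Ck_power_series[OF \<open>open \<Omega>\<close> bound])
  have sums: "(\<lambda>j. z ^ j * V j x) sums Fr z x" if "z \<in> ball 0 S" "x \<in> \<Omega>" for z x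
    unfolding Fr_def by (rule summable_sums[OF summable_power_series_of_Ck_bounded[OF _ bound]]) (use that in auto)
  have "AE x in lebesgue. x \<in> \<Omega> \<longrightarrow> Fr z x = F z x" if z: "z \<in> ball 0 S" for z
  proof (rule locally_L2_limit_AE_eq[OF \<open>open \<Omega>\<close> _ F[OF z] lim[OF z]])
    show "locally_square_integrable \<Omega> (\<lambda>x. \<Sum>j<N. z ^ j * f j x)" for N
      by (intro locally_square_integrable_sum locally_square_integrable_cmult f)
    have "AE x in lebesgue. \<forall>j. x \<in> \<Omega> \<longrightarrow> V j x = f j x" unfolding AE_all_countable by (rule V)
    then show "AE x in lebesgue. x \<in> \<Omega> \<longrightarrow> (\<lambda>N. \<Sum>j<N. z ^ j * f j x) \<longlonglongrightarrow> Fr z x"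
    proof eventually_elim
      case (elim x)
      then show ?case using sums[OF z, of x] by (auto simp: sums_def)
    qed
  qed
  moreover have "Ck m \<Omega> (Fr z)" if "z \<in> ball 0 S" for z
    using Ck_section[OF \<open>open \<Omega>\<close> that joint] by simp
  ultimately show ?thesis using joint by blast
qed

theorem theoremB2:
  fixes \<Omega> :: "(real^'n::finite) set"
    and a :: "'n \<Rightarrow> 'n \<Rightarrow> real^'n \<Rightarrow> complex"
    and b :: "real^'n \<Rightarrow> real"
    and ell :: "real^'n \<Rightarrow> real"
    and f :: "nat \<Rightarrow> real^'n \<Rightarrow> complex"
    and fL :: "nat \<Rightarrow> nat \<Rightarrow> real^'n \<Rightarrow> complex"
    and F :: "complex \<Rightarrow> real^'n \<Rightarrow> complex"
    and FL :: "nat \<Rightarrow> complex \<Rightarrow> real^'n \<Rightarrow> complex"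
    and S :: real and k m :: nat
  assumes "open \<Omega>" and "connected \<Omega>"
    and "smooth_on \<Omega> b" and "\<forall>x\<in>\<Omega>. b x > 0"
    and "\<forall>\<mu> \<nu>. smooth_on \<Omega> (a \<mu> \<nu>)"
    and "\<forall>\<mu> \<nu>. \<forall>x\<in>\<Omega>. a \<mu> \<nu> x = a \<nu> \<mu> x"
    and "continuous_on \<Omega> ell" and "\<forall>x\<in>\<Omega>. ell x > 0"
    and "\<forall>x\<in>\<Omega>. \<forall>\<xi>::complex^'n.
           Re (\<Sum>\<mu>\<in>UNIV. \<Sum>\<nu>\<in>UNIV. a \<mu> \<nu> x * cnj (\<xi> $ \<mu>) * \<xi> $ \<nu>)
             \<ge> ell x * (\<Sum>\<mu>\<in>UNIV. (cmod (\<xi> $ \<mu>))\<^sup>2)"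
    and "k \<ge> 1"
    \<comment> \<open>fL j l is (a representative of) Lbar^l f_j\<close>
    and "\<forall>j. fL j 0 = f j"
    and "\<forall>j. \<forall>l\<le>k. L2loc \<Omega> (fL j l)"
    and "\<forall>j. \<forall>l<k. Lbar_weak \<Omega> a b (fL j l) (fL j (Suc l))"
    \<comment> \<open>F analytic from B_S(0) into L^2_loc\<close>
    and "\<forall>z\<in>ball 0 S. L2loc \<Omega> (F z)"
    and "analytic_L2loc \<Omega> (ball 0 S) F"
    \<comment> \<open>(i)\<close>
    and "\<forall>z\<in>ball 0 S. L2loc_lim \<Omega> (\<lambda>N x. \<Sum>j<N. z ^ j / of_nat (fact j) * f j x) (F z)"
    \<comment> \<open>(ii): FL l z is (a representative of) Lbar^l F(z)\<close>
    and "\<forall>z\<in>ball 0 S. FL 0 z = F z"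
    and "\<forall>z\<in>ball 0 S. \<forall>l\<le>k. L2loc \<Omega> (FL l z)"
    and "\<forall>z\<in>ball 0 S. \<forall>l<k. Lbar_weak \<Omega> a b (FL l z) (FL (Suc l) z)"
    \<comment> \<open>(iii)\<close>
    and "\<forall>z\<in>ball 0 S. \<forall>l\<in>{1..k}.
           L2loc_lim \<Omega> (\<lambda>N x. \<Sum>j<N. z ^ j / of_nat (fact j) * fL j l x) (FL l z)"
    and "real k > real m / 2 + real CARD('n) / 4"
  shows "\<exists>Fr :: complex \<Rightarrow> real^'n \<Rightarrow> complex.
           (\<forall>z\<in>ball 0 S. AE x in lebesgue. x \<in> \<Omega> \<longrightarrow> Fr z x = F z x)
         \<and> (\<forall>z\<in>ball 0 S. Ck m \<Omega> (Fr z))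
         \<and> Ck m (ball 0 S \<times> \<Omega>) (\<lambda>(z, x). Fr z x)"
proof -
  interpret elliptic_operator \<Omega> a b ell by standard (use assms in auto)
  have limits: "L2loc_lim \<Omega> (\<lambda>N x. \<Sum>j<N. z ^ j / of_nat (fact j) * fL j l x) (FL l z)"
    if "z \<in> ball 0 S" "l \<le> k" for z l
    using assms(11,16,17,20) that by (cases "l = 0") auto
  note L2 = L2loc_imp_locally_square_integrable
  show ?thesis
  proof (rule Ck_representative_power_series[where f="\<lambda>j x. 1 / of_nat (fact j) * f j x", OF \<open>open \<Omega>\<close>])
    show "locally_square_integrable \<Omega> (\<lambda>x. 1 / of_nat (fact j) * f j x)" for j
      using assms(11,12) by (intro locally_square_integrable_cmult L2) (metis le0)
    show "locally_square_integrable \<Omega> (F z)" "L2loc_lim \<Omega> (\<lambda>N x. \<Sum>j<N. z ^ j * (1 / of_nat (fact j) * f j x)) (F z)"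
      if "z \<in> ball 0 S" for z using assms(14,16) that by (auto intro: L2)
    fix \<rho> x assume \<rho>: "0 < \<rho>" "\<rho> < S" and x: "x \<in> \<Omega>"
    let ?h = "\<lambda>l j y. complex_of_real \<rho> ^ j / of_nat (fact j) * fL j l y"
    have "locally_L2_bounded \<Omega> (?h l)" if "l \<le> k" for l
    proof (rule locally_L2_bounded_series_terms[OF locally_square_integrable_cmult[OF L2] L2
        limits[of "of_real \<rho>" l]])
      show "L2loc \<Omega> (fL j l)" "L2loc \<Omega> (FL l (of_real \<rho>))" for j using assms(12,18) \<rho> that by auto
    qed (use \<rho> that in auto)
    moreover have "Lbar_weak \<Omega> a b (?h l j) (?h (Suc l) j)" if "l < k" for l j
      using assms(13) that by (intro Lbar_weak_cmult) simp
    ultimately show "\<exists>r>0. ball x r \<subseteq> \<Omega> \<and> (\<exists>D. \<forall>j. \<exists>V. Ck_bounded m (ball x r) D V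
        \<and> (AE y in lebesgue. y \<in> ball x r \<longrightarrow> V y = of_real (\<rho> ^ j) * (1 / of_nat (fact j) * f j y)))"
      using interior_regularity[OF assms(21) x, of ?h] assms(11) by simp
  qed
qed

end
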